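(* Let $\bar x$ be a feasible solution to the problem $\mathrm{P}(0,0)$ (i.e. $\min f(x)$ s.t. $G(x)\in\mathcal{K}$), where $\mathcal{K}$ is $C^2$-cone reducible. Suppose that the Robinson constraint qualification (RCQ) holds at $\bar x$, and let $\bar y\in M(\bar x,0,0)\neq\emptyset$. Then the following statements are equivalent: (i) the strict Robinson constraint qualification (SRCQ) holds at $\bar x$ with respect to $\bar y$, and the second order sufficient condition (SOSC) holds at $\bar x$ for $\mathrm{P}(0,0)$; (ii) $\bar x$ is a locally optimal solution to $\mathrm{P}(0,0)$ and $S_{\mathrm{KKT}}$ is robustly isolated calm at the origin for $(\bar x,\bar y)$; (iii) $\bar x$ is a locally optimal solution to $\mathrm{P}(0,0)$ and $S_{\mathrm{KKT}}$ is isolated calm at the origin for $(\bar x,\bar y)$; (iv) $\bar x$ is a locally optimal solution to $\mathrm{P}(0,0)$ and $F^{-1}$ is isolated calm at the origin for $(\bar x,\bar y)$.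
   Context: Setting. $\mathcal{X},\mathcal{Y}$ are finite dimensional real Euclidean spaces, $f:\mathcal{X}\to\mathbb{R}$ and $G:\mathcal{X}\to\mathcal{Y}$ are twice continuously differentiable, and $\mathcal{K}\subset\mathcal{Y}$ is a nonempty closed convex set. For $(a,b)\in\mathcal{X}\times\mathcal{Y}$, $\mathrm{P}(a,b)$ is the problem $\min f(x)-\langle a,x\rangle$ s.t. $G(x)+b\in\mathcal{K}$. $C^2$-cone reducibility (standing assumption on $\mathcal{K}$): for every $\overline A\in\mathcal{K}$ there exist an open neighborhood $\mathcal{W}\subset\mathcal{Y}$ of $\overline A$, a pointed closed convex cone $\mathcal{Q}$ (pointed: its lineality space is $\{0\}$) in a finite dimensional space $\mathcal{Z}$, and a twice continuously differentiable $\Xi:\mathcal{W}\to\mathcal{Z}$ such that $\Xi(\overline A)=0$, $\Xi'(\overline A):\mathcal{Y}\to\mathcal{Z}$ is onto, and $\mathcal{K}\cap\mathcal{W}=\{A\in\mathcal{W}\mid\Xi(A)\in\mathcal{Q}\}$. KKT system. $L(x;y):=f(x)+\langle y,G(x)\rangle$, so $\nabla_xL(x;y)=\nabla f(x)+G'(x)^*y$; $\nabla^2_{xx}L(\bar x;y)$ is the Hessian of $L(\cdot;y)$ at $\bar x$. $\mathcal{N}_{\mathcal{K}}(z)$ is the normal cone of convex analysis. $S_{\mathrm{KKT}}(a,b)$ is the set of all $(x,y)\in\mathcal{X}\times\mathcal{Y}$ with $a=\nabla_xL(x;y)$ and $y\in\mathcal{N}_{\mathcal{K}}(G(x)+b)$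 (in particular $G(x)+b\in\mathcal{K}$), and $M(x,a,b):=\{y\mid(x,y)\in S_{\mathrm{KKT}}(a,b)\}$ is the set of Lagrange multipliers. $F:\mathcal{X}\times\mathcal{Y}\to\mathcal{X}\times\mathcal{Y}$ is the map $F(x,y):=\big(\nabla f(x)+G'(x)^*y,\ G(x)-\Pi_{\mathcal{K}}(G(x)+y)\big)$, with $\Pi_{\mathcal{K}}$ the metric projection onto $\mathcal{K}$; $F^{-1}$ is its set-valued inverse. Tangent sets. $\mathcal{T}_{\mathcal{K}}(z):=\{d\mid\exists z^k\to z,\ z^k\in\mathcal{K},\ t^k\downarrow0,\ (z^k-z)/t^k\to d\}$. Second order tangent set: $\mathcal{T}^2_{\mathcal{K}}(z,h):=\{w\in\mathcal{Y}\mid\exists t_k\downarrow0\text{ such that }\mathrm{dist}(z+t_kh+\tfrac12t_k^2w,\mathcal{K})=o(t_k^2)\}$. $\sigma(y,Z):=\sup\{\langle y,z\rangle\mid z\in Z\}$ is the support function. $\bar y^\perp:=\{z\mid\langle z,\bar y\rangle=0\}$. Conditions at a feasible point $\bar x$ of $\mathrm{P}(0,0)$. RCQ: $G'(\bar x)\mathcal{X}+\mathcal{T}_{\mathcal{K}}(G(\bar x))=\mathcal{Y}$. SRCQ with respect to $\bar y\in M(\bar x,0,0)$: $G'(\bar x)\mathcal{X}+\mathcal{T}_{\mathcal{K}}(G(\bar x))\cap\bar y^\perp=\mathcal{Y}$. Critical cone: $\mathcal{C}(\bar x):=\{d\in\mathcal{X}\mid G'(\bar x)d\in\mathcal{T}_{\mathcal{K}}(G(\bar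 x)),\ f'(\bar x)d\le0\}$. SOSC: $\sup_{y\in M(\bar x,0,0)}\{\langle d,\nabla^2_{xx}L(\bar x;y)d\rangle-\sigma(y,\mathcal{T}^2_{\mathcal{K}}(G(\bar x),G'(\bar x)d))\}>0$ for all $d\in\mathcal{C}(\bar x)\setminus\{0\}$. Set-valued notions. For a set-valued mapping $\Psi:\mathcal{E}\rightrightarrows\mathcal{F}$ between finite dimensional Euclidean spaces and $\bar q\in\Psi(\bar p)$: $\Psi$ is isolated calm at $\bar p$ for $\bar q$ if there are $\kappa>0$ and open neighborhoods $\mathcal{U}$ of $\bar p$, $\mathcal{V}$ of $\bar q$ with $\Psi(p)\cap\mathcal{V}\subset\{\bar q\}+\kappa\|p-\bar p\|\mathbb{B}_{\mathcal{F}}$ for all $p\in\mathcal{U}$ ($\mathbb{B}_{\mathcal{F}}$ the unit ball of $\mathcal{F}$); it is robustly isolated calm if in addition, for these neighborhoods, $\Psi(p)\cap\mathcal{V}\ne\emptyset$ for every $p\in\mathcal{U}$. *)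

theory Defs
  imports "HOL-Analysis.Analysis" "HOL-Library.Landau_Symbols"
begin

section \<open>Differentiability\<close>

text \<open>To be used for open \<open>S\<close> only.  The derivatives are elements of the normed spaces of bounded
  linear maps, so that continuity of the second derivative is continuity in operator norm.\<close>

definition twice_cont_diff_on ::
    "('a::real_normed_vector \<Rightarrow> 'b::real_normed_vector) \<Rightarrow> 'a set \<Rightarrow> bool" where
  "twice_cont_diff_on f S \<longleftrightarrow>
     (\<exists>(f' :: 'a \<Rightarrow> 'a \<Rightarrow>\<^sub>L 'b) (f'' :: 'a \<Rightarrow> 'a \<Rightarrow>\<^sub>L ('a \<Rightarrow>\<^sub>L 'b)).
        (\<forall>x\<in>S. (f has_derivative blinfun_apply (f' x)) (at x)) \<and>
        (\<forall>x\<in>S. (f' has_derivative blinfun_apply (f'' x)) (at x)) \<and>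
        continuous_on S f'')"

definition grad :: "('a::real_inner \<Rightarrow> real) \<Rightarrow> 'a \<Rightarrow> 'a" where
  "grad f x = (THE D. GDERIV f x :> D)"

definition hessian :: "('a::real_inner \<Rightarrow> real) \<Rightarrow> 'a \<Rightarrow> 'a \<Rightarrow> 'a" where
  "hessian f x = frechet_derivative (grad f) (at x)"


section \<open>Convex and variational analysis\<close>

definition normal_cone :: "'a::real_inner set \<Rightarrow> 'a \<Rightarrow> 'a set" where
  "normal_cone K z = {y. z \<in> K \<and> (\<forall>w\<in>K. inner y (w - z) \<le> 0)}"

definition tangent_cone :: "'a::real_normed_vector set \<Rightarrow> 'a \<Rightarrow> 'a set" where
  "tangent_cone K z =
     {d. \<exists>(zs :: nat \<Rightarrow> 'a) (t :: nat \<Rightarrow> real).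
           (\<forall>k. zs k \<in> K) \<and> zs \<longlonglongrightarrow> z \<and> (\<forall>k. 0 < t k) \<and> t \<longlonglongrightarrow> 0 \<and>
           (\<lambda>k. (zs k - z) /\<^sub>R t k) \<longlonglongrightarrow> d}"

definition second_order_tangent_set :: "'a::real_normed_vector set \<Rightarrow> 'a \<Rightarrow> 'a \<Rightarrow> 'a set" where
  "second_order_tangent_set K z h =
     {w. \<exists>t :: nat \<Rightarrow> real. (\<forall>k. 0 < t k) \<and> t \<longlonglongrightarrow> 0 \<and>
           (\<lambda>k. infdist (z + t k *\<^sub>R h + ((t k)\<^sup>2 / 2) *\<^sub>R w) K) \<in> o(\<lambda>k. (t k)\<^sup>2)}"

text \<open>Extended real valued: the supremum over the empty set is \<open>- \<infinity>\<close>.\<close>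

definition support_fun :: "'a::real_inner \<Rightarrow> 'a set \<Rightarrow> ereal" where
  "support_fun y Z = (SUP z\<in>Z. ereal (inner y z))"

definition pointed :: "'a::real_vector set \<Rightarrow> bool" where
  "pointed Q \<longleftrightarrow> Q \<inter> uminus ` Q = {0}"

text \<open>The auxiliary space is a linear subspace \<open>Z\<close> of the ambient space, possibly \<open>{0}\<close> (as it must
  be at interior points of \<open>K\<close>).  Up to a linear isometry this covers every finite dimensional
  Euclidean space that can occur, since the derivative of \<open>\<Xi>\<close> at \<open>A\<close> maps the ambient space onto it.\<close>

definition C2_cone_reducible :: "'a::euclidean_space set \<Rightarrow> bool" where
  "C2_cone_reducible K \<longleftrightarrow>
     (\<forall>A\<in>K. \<exists>(W :: 'a set) (Z :: 'a set) (Q :: 'a set) (\<Xi> :: 'a \<Rightarrow> 'a).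
        open W \<and> A \<in> W \<and> subspace Z \<and>
        Q \<subseteq> Z \<and> cone Q \<and> convex Q \<and> closed Q \<and> pointed Q \<and>
        \<Xi> ` W \<subseteq> Z \<and> twice_cont_diff_on \<Xi> W \<and>
        \<Xi> A = 0 \<and> range (frechet_derivative \<Xi> (at A)) = Z \<and>
        K \<inter> W = {B \<in> W. \<Xi> B \<in> Q})"


section \<open>Isolated calmness of set-valued mappings\<close>

definition isolated_calm ::
    "('e::euclidean_space \<Rightarrow> 'f::euclidean_space set) \<Rightarrow> 'e \<Rightarrow> 'f \<Rightarrow> bool" where
  "isolated_calm \<Psi> p0 q0 \<longleftrightarrow> q0 \<in> \<Psi> p0 \<and>
     (\<exists>\<kappa>>0. \<exists>U V. open U \<and> p0 \<in> U \<and> open V \<and> q0 \<in> V \<and>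
        (\<forall>p\<in>U. \<Psi> p \<inter> V \<subseteq> cball q0 (\<kappa> * norm (p - p0))))"

definition robustly_isolated_calm ::
    "('e::euclidean_space \<Rightarrow> 'f::euclidean_space set) \<Rightarrow> 'e \<Rightarrow> 'f \<Rightarrow> bool" where
  "robustly_isolated_calm \<Psi> p0 q0 \<longleftrightarrow> q0 \<in> \<Psi> p0 \<and>
     (\<exists>\<kappa>>0. \<exists>U V. open U \<and> p0 \<in> U \<and> open V \<and> q0 \<in> V \<and>
        (\<forall>p\<in>U. \<Psi> p \<inter> V \<subseteq> cball q0 (\<kappa> * norm (p - p0)) \<and> \<Psi> p \<inter> V \<noteq> {}))"


section \<open>The perturbed optimization problem\<close>

text \<open>In what follows \<open>f\<close>, \<open>G\<close>, \<open>K\<close> are the data of the problem of minimizing \<open>f x - \<langle>a, x\<rangle>\<close>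
  subject to \<open>G x + b \<in> K\<close>, with perturbation parameters \<open>a\<close> and \<open>b\<close>.\<close>

definition feasible ::
    "('x \<Rightarrow> 'y::euclidean_space) \<Rightarrow> 'y set \<Rightarrow> 'y \<Rightarrow> 'x::euclidean_space \<Rightarrow> bool" where
  "feasible G K b x \<longleftrightarrow> G x + b \<in> K"

definition locally_optimal ::
    "('x \<Rightarrow> real) \<Rightarrow> ('x \<Rightarrow> 'y::euclidean_space) \<Rightarrow> 'y set \<Rightarrow> 'x \<Rightarrow> 'y \<Rightarrow> 'x::euclidean_space \<Rightarrow> bool" where
  "locally_optimal f G K a b x \<longleftrightarrow> feasible G K b x \<and>
     (\<exists>U. open U \<and> x \<in> U \<and>
        (\<forall>x'\<in>U. feasible G K b x' \<longrightarrow> f x - inner a x \<le> f x' - inner a x'))"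

definition lagrangian ::
    "('x \<Rightarrow> real) \<Rightarrow> ('x \<Rightarrow> 'y::euclidean_space) \<Rightarrow> 'y \<Rightarrow> 'x::euclidean_space \<Rightarrow> real" where
  "lagrangian f G y x = f x + inner y (G x)"

definition S_KKT ::
    "('x \<Rightarrow> real) \<Rightarrow> ('x \<Rightarrow> 'y::euclidean_space) \<Rightarrow> 'y set \<Rightarrow>
      'x::euclidean_space \<times> 'y \<Rightarrow> ('x \<times> 'y) set" where
  "S_KKT f G K = (\<lambda>(a, b).
     {(x, y). a = grad (lagrangian f G y) x \<and> y \<in> normal_cone K (G x + b)})"

definition multipliers ::
    "('x \<Rightarrow> real) \<Rightarrow> ('x \<Rightarrow> 'y::euclidean_space) \<Rightarrow> 'y set \<Rightarrow>
      'x::euclidean_space \<Rightarrow> 'x \<Rightarrow> 'y \<Rightarrow> 'y set" where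
  "multipliers f G K x a b = {y. (x, y) \<in> S_KKT f G K (a, b)}"

definition KKT_map ::
    "('x \<Rightarrow> real) \<Rightarrow> ('x \<Rightarrow> 'y::euclidean_space) \<Rightarrow> 'y set \<Rightarrow>
      'x::euclidean_space \<times> 'y \<Rightarrow> 'x \<times> 'y" where
  "KKT_map f G K = (\<lambda>(x, y).
     (grad f x + adjoint (frechet_derivative G (at x)) y,
      G x - closest_point K (G x + y)))"

definition KKT_map_inv ::
    "('x \<Rightarrow> real) \<Rightarrow> ('x \<Rightarrow> 'y::euclidean_space) \<Rightarrow> 'y set \<Rightarrow>
      'x::euclidean_space \<times> 'y \<Rightarrow> ('x \<times> 'y) set" where
  "KKT_map_inv f G K p = KKT_map f G K -` {p}"


section \<open>Constraint qualifications and second order condition\<close>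

text \<open>The sums below are Minkowski sums of sets.\<close>

definition RCQ ::
    "('x \<Rightarrow> 'y::euclidean_space) \<Rightarrow> 'y set \<Rightarrow> 'x::euclidean_space \<Rightarrow> bool" where
  "RCQ G K x \<longleftrightarrow>
     range (frechet_derivative G (at x)) + tangent_cone K (G x) = UNIV"

definition SRCQ ::
    "('x \<Rightarrow> 'y::euclidean_space) \<Rightarrow> 'y set \<Rightarrow> 'x::euclidean_space \<Rightarrow> 'y \<Rightarrow> bool" where
  "SRCQ G K x y \<longleftrightarrow>
     range (frechet_derivative G (at x)) + (tangent_cone K (G x) \<inter> {z. inner z y = 0}) = UNIV"

definition critical_cone ::
    "('x \<Rightarrow> real) \<Rightarrow> ('x \<Rightarrow> 'y::euclidean_space) \<Rightarrow> 'y set \<Rightarrow> 'x::euclidean_space \<Rightarrow> 'x set" where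
  "critical_cone f G K x =
     {d. frechet_derivative G (at x) d \<in> tangent_cone K (G x) \<and>
         frechet_derivative f (at x) d \<le> 0}"

definition SOSC ::
    "('x \<Rightarrow> real) \<Rightarrow> ('x \<Rightarrow> 'y::euclidean_space) \<Rightarrow> 'y set \<Rightarrow> 'x::euclidean_space \<Rightarrow> bool" where
  "SOSC f G K x \<longleftrightarrow>
     (\<forall>d \<in> critical_cone f G K x - {0}.
        (SUP y \<in> multipliers f G K x 0 0.
           ereal (inner d (hessian (lagrangian f G y) x d))
           - support_fun y
               (second_order_tangent_set K (G x) (frechet_derivative G (at x) d))) > 0)"

end

theory Submission
  imports Defs
begin

text \<open>
  Write \<open>A = G xbar\<close>.  Cone reducibility is used once, to straighten \<open>K\<close> near \<open>A\<close>: there is a local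
  diffeomorphism \<open>\<Phi>\<close> with \<open>\<Phi> A = 0\<close> and \<open>\<Phi>'(A) = id\<close> that carries \<open>K\<close> to a closed convex cone \<open>T\<close>, which
  is therefore the tangent cone of \<open>K\<close> at \<open>A\<close> (\<open>C2_cone_reducible_chart\<close>).  Its second derivative measures
  the curvature of \<open>K\<close>.  Three expansions of the normal cone mapping along sequences approaching
  \<open>(A, ybar)\<close> hold all that is needed about this curvature: \<open>fixed_multiplier_second_order_bound\<close>,
  \<open>multiplier_second_order_limit\<close> and \<open>multiplier_first_order_bound\<close>.  In particular the support function of
  the second order tangent set equals \<open>- <ybar, \<Phi>''(h) h>\<close> on critical directions, so that, once the
  multiplier is unique, the second order condition says that the symmetric form
  \<open>Q d d = \<nabla>\<^sup>2L d d + <ybar, \<Phi>''(G' d)(G' d)>\<close> is positive on the nonzero critical directions.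

  Sufficiency.  If calmness failed, normalized differences of perturbed KKT points would converge to a
  nonzero pair \<open>(d, v)\<close> that solves the linearized system; the expansions give \<open>Q d d \<le> 0\<close> with \<open>d\<close>
  critical, hence \<open>d = 0\<close>, and then the strict constraint qualification gives \<open>v = 0\<close>
  (\<open>strict_cq_sosc_imp_calm\<close>).  Existence of KKT points for small perturbations comes from minimizing
  an exact penalty function \<open>f + \<rho> dist(G, K)\<close> with \<open>\<rho> > \<bar>ybar\<bar>\<close>.  It has \<open>xbar\<close> as a strict local minimizer
  (\<open>sosc_imp_penalty_strict_min\<close>), so minimizers of the perturbed penalty functions stay near \<open>xbar\<close>, and
  since a multiplier at an infeasible minimizer has norm exactly \<open>\<rho>\<close> while the multipliers converge to
  \<open>ybar\<close>, these minimizers are feasible (\<open>perturbed_kkt_points\<close>).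

  Necessity.  Perturbing the multiplier alone turns calmness into the estimate
  \<open>\<bar>e\<bar> \<le> \<kappa> \<bar>G'\<^sup>* e\<bar>\<close> on the polar of \<open>T \<inter> ybar\<^sup>\<bottom>\<close>, which is the strict constraint qualification in dual form
  (\<open>calm_imp_strict_cq\<close>).  For the second order condition, take a critical \<open>d \<noteq> 0\<close> with \<open>Q d d \<le> 0\<close> and look
  at KKT points \<open>x\<^sub>t\<close> of the tilted problem of minimizing \<open>f x + \<Lambda> \<bar>x - xbar - t d\<bar>\<^sup>2\<close>.  With
  \<open>e\<^sub>t = x\<^sub>t - xbar - t d\<close> and \<open>\<Lambda>\<close> large, local optimality and the expansions give
  \<open>0 \<le> f x\<^sub>t - f xbar \<le> t\<^sup>2/2 Q d d - 2 \<Lambda> \<bar>e\<^sub>t\<bar>\<^sup>2 - 1/2 Q e\<^sub>t e\<^sub>t + o(t\<^sup>2)\<close>, whence \<open>e\<^sub>t = o(t)\<close>.  But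
  \<open>- 2 \<Lambda> e\<^sub>t\<close> is the residual of the KKT system at \<open>x\<^sub>t\<close>, whose distance from \<open>xbar\<close> is of order \<open>t\<close>:
  calmness fails (\<open>calm_local_min_imp_sosc\<close>).

  The map \<open>F\<close> is handled by the substitution \<open>(a, b, y) \<mapsto> (a + G'(x)\<^sup>* b, - b, y + b)\<close>, which turns solutions
  of \<open>F(x, y) = (a, b)\<close> into perturbed KKT points and is Lipschitz near \<open>xbar\<close>.
\<close>

section \<open>Second-order expansions along sequences\<close>

lemma has_derivative_remainder:
  fixes f' :: "'a::real_normed_vector \<Rightarrow> 'b::real_normed_vector"
  assumes "(f' has_derivative D) (at A)" and "e > 0"
  shows "\<exists>d>0. \<forall>s. norm s < d \<longrightarrow> norm (f' (A + s) - f' A - D s) \<le> e * norm s"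
proof -
  from assms obtain d where "d > 0" and d: "\<And>y. norm (y - A) < d \<Longrightarrow> norm (f' y - f' A - D (y - A)) \<le> e * norm (y - A)"
    unfolding has_derivative_at_alt by blast
  have "norm (f' (A + s) - f' A - D s) \<le> e * norm s" if "norm s < d" for s
    using d[of "A + s"] that by simp
  with \<open>d > 0\<close> show ?thesis by blast
qed

text \<open>Both values are the limit of the second difference quotient
  \<open>(f (A + t u + t v) - f (A + t u) - f (A + t v) + f A) / t\<^sup>2\<close>, which is symmetric in \<open>u\<close> and \<open>v\<close>; the mean
  value inequality along the segment in direction \<open>v\<close> gives the limit.\<close>
lemma second_derivative_symmetric:
  fixes f :: "'a::real_normed_vector \<Rightarrow> 'b::real_normed_vector"
    and f' :: "'a \<Rightarrow> 'a \<Rightarrow>\<^sub>L 'b" and f'' :: "'a \<Rightarrow>\<^sub>L ('a \<Rightarrow>\<^sub>L 'b)"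
  assumes S: "open S" "A \<in> S"
    and f: "\<And>x. x \<in> S \<Longrightarrow> (f has_derivative f' x) (at x)"
    and f': "(f' has_derivative f'') (at A)"
  shows "f'' u v = f'' v u"
proof -
  define m where "m = norm u + norm v"
  define \<Delta> where "\<Delta> u v = f (A + u + v) - f (A + u) - f (A + v) + f A" for u v
  have main: "\<exists>d>0. \<forall>t. 0 < t \<and> t < d \<longrightarrow>
      norm (\<Delta> (t *\<^sub>R u) (t *\<^sub>R v) - t\<^sup>2 *\<^sub>R f'' u v) \<le> e * t\<^sup>2 * (2 * (norm u + norm v)\<^sup>2)" 
    if e: "e > 0" for e u v
  proof -
    define m where "m = norm u + norm v"
    have m: "m \<ge> 0" by (simp add: m_def)
    obtain d1 where d1: "d1 > 0" "\<And>s. norm s < d1 \<Longrightarrow> norm (f' (A + s) - f' A - f'' s) \<le> e * norm s"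
      using has_derivative_remainder[OF f' e] by blast
    obtain d2 where d2: "d2 > 0" "ball A d2 \<subseteq> S" using S open_contains_ball by blast
    define d where "d = min d1 d2 / (m + 1)"
    have d: "d > 0" using d1 d2 m by (simp add: d_def)
    show ?thesis
    proof (intro exI[of _ d] conjI allI impI d)
      fix t :: real assume t: "0 < t \<and> t < d"
      have tm: "t * m < min d1 d2"
      proof -
        have "t * m \<le> t * (m+1)" using t by simp
        also have "\<dots> < d * (m+1)" using t m by simp
        finally show ?thesis using m by (simp add: d_def)
      qed
      have small: "norm (a *\<^sub>R (t *\<^sub>R u) + s *\<^sub>R (t *\<^sub>R v)) \<le> t * m" if "0 \<le> a" "a \<le> 1" "0 \<le> s" "s \<le> 1" for a s
      proof -
        have "norm (a *\<^sub>R (t *\<^sub>R u) + s *\<^sub>R (t *\<^sub>R v)) \<le> norm (a *\<^sub>R (t *\<^sub>R u)) + norm (s *\<^sub>R (t *\<^sub>R v))"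
          by (rule norm_triangle_ineq)
        also have "\<dots> \<le> t * norm u + t * norm v"
          using that t by (simp add: mult_left_le_one_le add_mono)
        finally show ?thesis by (simp add: m_def algebra_simps)
      qed
      define \<psi> where "\<psi> s = f (A + (t *\<^sub>R u + s *\<^sub>R (t *\<^sub>R v))) - f (A + s *\<^sub>R (t *\<^sub>R v)) - (s * t\<^sup>2) *\<^sub>R f'' u v" for s :: real
      define w1 where "w1 s = t *\<^sub>R u + s *\<^sub>R (t *\<^sub>R v)" for s
      define w2 where "w2 s = s *\<^sub>R (t *\<^sub>R v)" for s
      have inS: "A + w1 s \<in> S" "A + w2 s \<in> S" and nw: "norm (w1 s) \<le> t * m" "norm (w2 s) \<le> t * m"
        if "s \<in> {0..1}" for s
      proof -
        show 1: "norm (w1 s) \<le> t * m" "norm (w2 s) \<le> t * m"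
          using small[of 1 s] small[of 0 s] that by (auto simp: w1_def w2_def)
        show "A + w1 s \<in> S" "A + w2 s \<in> S" using 1 tm d2 by (auto simp: dist_norm subset_iff)
      qed
      have der: "(\<psi> has_derivative (\<lambda>h. h *\<^sub>R (f' (A + w1 s) (t *\<^sub>R v) - f' (A + w2 s) (t *\<^sub>R v) - t\<^sup>2 *\<^sub>R f'' u v))) (at s within {0..1})"
        if s: "s \<in> {0..1}" for s
      proof -
        have 1: "((\<lambda>s. f (A + w1 s)) has_derivative (\<lambda>h. f' (A + w1 s) (h *\<^sub>R (t *\<^sub>R v)))) (at s within {0..1})"
          by (rule has_derivative_compose[where f="\<lambda>s. A + w1 s" and g=f, OF _ f[OF inS(1)[OF s]]])
             (auto simp: w1_def intro!: derivative_eq_intros)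
        have 2: "((\<lambda>s. f (A + w2 s)) has_derivative (\<lambda>h. f' (A + w2 s) (h *\<^sub>R (t *\<^sub>R v)))) (at s within {0..1})"
          by (rule has_derivative_compose[where f="\<lambda>s. A + w2 s" and g=f, OF _ f[OF inS(2)[OF s]]])
             (auto simp: w2_def intro!: derivative_eq_intros)
        have 3: "((\<lambda>s. (s * t\<^sup>2) *\<^sub>R f'' u v) has_derivative (\<lambda>h. (h * t\<^sup>2) *\<^sub>R f'' u v)) (at s within {0..1})"
          by (auto intro!: derivative_eq_intros)
        show ?thesis
          using has_derivative_diff[OF has_derivative_diff[OF 1 2] 3]
          by (simp add: \<psi>_def[abs_def] w1_def w2_def blinfun.scaleR_right scaleR_right_diff_distrib)
      qed
      have bound: "onorm (\<lambda>h. h *\<^sub>R (f' (A + w1 s) (t *\<^sub>R v) - f' (A + w2 s) (t *\<^sub>R v) - t\<^sup>2 *\<^sub>R f'' u v)) \<le> e * t\<^sup>2 * (2 * m\<^sup>2)"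
        if s: "s \<in> {0..1}" for s
      proof -
        let ?z = "f' (A + w1 s) (t *\<^sub>R v) - f' (A + w2 s) (t *\<^sub>R v) - t\<^sup>2 *\<^sub>R f'' u v"
        let ?r1 = "f' (A + w1 s) - f' A - f'' (w1 s)" and ?r2 = "f' (A + w2 s) - f' A - f'' (w2 s)"
        have "w1 s - w2 s = t *\<^sub>R u" by (simp add: w1_def w2_def)
        then have "f'' (w1 s) = f'' (w2 s) + t *\<^sub>R f'' u"
          by (metis (no_types, lifting) add.commute blinfun.add_right blinfun.scaleR_right diff_add_cancel)
        then have "?z = (?r1 - ?r2) (t *\<^sub>R v)"
          by (simp add: blinfun.diff_left blinfun.add_left blinfun.scaleR_left blinfun.scaleR_right power2_eq_square algebra_simps)
        then have "norm ?z \<le> norm (?r1 - ?r2) * norm (t *\<^sub>R v)" using norm_blinfun by metis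
        also have "norm (?r1 - ?r2) \<le> e * norm (w1 s) + e * norm (w2 s)"
          using d1(2)[of "w1 s"] d1(2)[of "w2 s"] nw[OF s] tm norm_triangle_ineq4[of ?r1 ?r2] by linarith
        also have "\<dots> \<le> e * (t * m) + e * (t * m)"
          using nw[OF s] e by (intro add_mono mult_left_mono) auto
        also have "norm (t *\<^sub>R v) \<le> t * m" using t by (simp add: m_def)
        finally have "norm ?z \<le> (e * (t * m) + e * (t * m)) * (t * m)"
          using m t e by (simp add: mult_left_mono mult_right_mono)
        also have "\<dots> = e * t\<^sup>2 * (2 * m\<^sup>2)" by (simp add: power2_eq_square algebra_simps)
        finally have nz: "norm ?z \<le> e * t\<^sup>2 * (2 * m\<^sup>2)" .
        show ?thesis
          by (rule onorm_le) (use nz in \<open>simp add: mult.commute[of _ "\<bar>_\<bar>"] mult_left_mono\<close>)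
      qed
      have "norm (\<psi> 1 - \<psi> 0) \<le> e * t\<^sup>2 * (2 * m\<^sup>2) * norm (1 - 0 :: real)"
        by (rule differentiable_bound[OF _ der bound]) auto
      then show "norm (\<Delta> (t *\<^sub>R u) (t *\<^sub>R v) - t\<^sup>2 *\<^sub>R f'' u v) \<le> e * t\<^sup>2 * (2 * (norm u + norm v)\<^sup>2)"
        by (simp add: \<psi>_def \<Delta>_def m_def algebra_simps)
    qed
  qed
  have "norm (f'' u v - f'' v u) \<le> e" if e: "e > 0" for e
  proof -
    define e' where "e' = e / (4 * m\<^sup>2 + 1)"
    have p: "4 * m\<^sup>2 + 1 > 0" by (meson add_nonneg_pos mult_nonneg_nonneg zero_le_numeral zero_le_power2 zero_less_one)
    have e': "e' > 0" using e p by (simp add: e'_def)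
    obtain d1 where d1: "d1 > 0" "\<And>t. 0 < t \<and> t < d1 \<Longrightarrow>
      norm (\<Delta> (t *\<^sub>R u) (t *\<^sub>R v) - t\<^sup>2 *\<^sub>R f'' u v) \<le> e' * t\<^sup>2 * (2 * (norm u + norm v)\<^sup>2)"
      using main[OF e', of u v] by blast
    obtain d2 where d2: "d2 > 0" "\<And>t. 0 < t \<and> t < d2 \<Longrightarrow>
      norm (\<Delta> (t *\<^sub>R v) (t *\<^sub>R u) - t\<^sup>2 *\<^sub>R f'' v u) \<le> e' * t\<^sup>2 * (2 * (norm v + norm u)\<^sup>2)"
      using main[OF e', of v u] by blast
    define t where "t = min d1 d2 / 2"
    have t: "t > 0" "t < d1" "t < d2" using d1 d2 by (auto simp: t_def)
    have sw: "\<Delta> (t *\<^sub>R v) (t *\<^sub>R u) = \<Delta> (t *\<^sub>R u) (t *\<^sub>R v)" by (simp add: \<Delta>_def algebra_simps)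
    have "norm (t\<^sup>2 *\<^sub>R (f'' u v - f'' v u)) \<le> norm (\<Delta> (t *\<^sub>R u) (t *\<^sub>R v) - t\<^sup>2 *\<^sub>R f'' v u) + norm (\<Delta> (t *\<^sub>R u) (t *\<^sub>R v) - t\<^sup>2 *\<^sub>R f'' u v)"
      by (rule order_trans[OF _ norm_triangle_ineq4]) (simp add: algebra_simps)
    also have "\<dots> \<le> e' * t\<^sup>2 * (2 * m\<^sup>2) + e' * t\<^sup>2 * (2 * m\<^sup>2)"
      using d1(2)[of t] d2(2)[of t] t sw by (auto intro!: add_mono simp: m_def add.commute)
    also have "\<dots> = t\<^sup>2 * (e' * (4 * m\<^sup>2))" by (simp add: algebra_simps)
    finally have "t\<^sup>2 * norm (f'' u v - f'' v u) \<le> t\<^sup>2 * (e' * (4 * m\<^sup>2))" by simp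
    then have "norm (f'' u v - f'' v u) \<le> e' * (4 * m\<^sup>2)" using t by simp
    also have "\<dots> \<le> e' * (4 * m\<^sup>2 + 1)" using e' by simp
    also have "\<dots> = e" using p by (simp add: e'_def)
    finally show ?thesis .
  qed
  then have "norm (f'' u v - f'' v u) \<le> 0" by (rule field_le_epsilon) simp
  then show ?thesis by simp
qed

text \<open>Second-order information is extracted along sequences \<open>s\<close> that approach the origin with speed
  \<open>t\<close> in a definite direction, so that expansions become limits and can be combined freely.\<close>
lemma small_o_along_sequence:
  fixes r :: "'a::real_normed_vector \<Rightarrow> 'b::real_normed_vector"
  assumes r: "\<And>e. e > 0 \<Longrightarrow> \<exists>d>0. \<forall>s. norm s < d \<longrightarrow> norm (r s) \<le> e * norm s ^ n"
    and t: "\<And>k. t k > 0" "t \<longlonglongrightarrow> (0::real)"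
    and s: "(\<lambda>k. s k /\<^sub>R t k) \<longlonglongrightarrow> \<sigma>"
  shows "(\<lambda>k. r (s k) /\<^sub>R t k ^ n) \<longlonglongrightarrow> 0"
proof (rule tendstoI)
  fix \<epsilon> :: real assume \<epsilon>: "\<epsilon> > 0"
  obtain M where M: "M > 0" "\<And>k. norm (s k /\<^sub>R t k) \<le> M"
    using convergent_imp_Bseq[OF convergentI[OF s]] unfolding Bseq_def by blast
  define e where "e = \<epsilon> / (2 * M ^ n)"
  have e: "e > 0" using M \<epsilon> by (simp add: e_def)
  obtain d where d: "d > 0" "\<And>s. norm s < d \<Longrightarrow> norm (r s) \<le> e * norm s ^ n"
    using r[OF e] by blast
  have "(\<lambda>k. t k *\<^sub>R (s k /\<^sub>R t k)) \<longlonglongrightarrow> 0 *\<^sub>R \<sigma>" by (rule tendsto_scaleR[OF t(2) s])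
  moreover have "t k *\<^sub>R (s k /\<^sub>R t k) = s k" for k using t(1)[of k] by simp
  ultimately have "s \<longlonglongrightarrow> 0" by (simp only: scaleR_zero_left)
  from tendstoD[OF this d(1)] have "\<forall>\<^sub>F k in sequentially. norm (s k) < d" by (simp only: dist_norm diff_zero)
  then show "\<forall>\<^sub>F k in sequentially. dist (r (s k) /\<^sub>R t k ^ n) 0 < \<epsilon>"
  proof eventually_elim
    case (elim k)
    have tn: "t k ^ n > 0" by (rule zero_less_power[OF t(1)])
    have "norm (r (s k) /\<^sub>R t k ^ n) = norm (r (s k)) / t k ^ n"
      using tn by (simp only: norm_scaleR abs_inverse abs_of_pos divide_inverse mult.commute)
    also have "\<dots> \<le> e * norm (s k) ^ n / t k ^ n"
      using d(2)[OF elim] tn by (simp only: divide_right_mono less_imp_le)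
    also have "\<dots> = e * (norm (s k) / t k) ^ n"
      by (simp only: power_divide times_divide_eq_right)
    also have "norm (s k) / t k = norm (s k /\<^sub>R t k)"
      using t(1)[of k] by (simp only: norm_scaleR abs_inverse abs_of_pos divide_inverse mult.commute)
    also have "e * norm (s k /\<^sub>R t k) ^ n \<le> e * M ^ n" using M(2)[of k] e by (intro mult_left_mono power_mono) auto
    also have "\<dots> = \<epsilon> / 2" using M by (simp add: e_def)
    also have "\<dots> < \<epsilon>" using \<epsilon> by simp
    finally show ?case by (simp only: dist_norm diff_zero)
  qed
qed

lemma derivative_along_sequence:
  fixes g :: "'a::real_normed_vector \<Rightarrow> 'b::real_normed_vector"
  assumes g: "(g has_derivative D) (at A)"
    and t: "\<And>k. t k > 0" "t \<longlonglongrightarrow> (0::real)"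
    and x: "(\<lambda>k. (x k - A) /\<^sub>R t k) \<longlonglongrightarrow> \<sigma>"
  shows "(\<lambda>k. (g (x k) - g A) /\<^sub>R t k) \<longlonglongrightarrow> D \<sigma>"
proof -
  interpret D: bounded_linear D using g has_derivative_bounded_linear by blast
  have "(\<lambda>k. (g (A + (x k - A)) - g A - D (x k - A)) /\<^sub>R t k ^ 1) \<longlonglongrightarrow> 0"
    by (rule small_o_along_sequence[where r="\<lambda>s. g (A + s) - g A - D s", OF _ t x],
        unfold power_one_right, rule has_derivative_remainder[OF g])
  then have "(\<lambda>k. (g (x k) - g A - D (x k - A)) /\<^sub>R t k + D ((x k - A) /\<^sub>R t k)) \<longlonglongrightarrow> 0 + D \<sigma>"
    by (intro tendsto_add D.tendsto x) simp
  moreover have "(g (x k) - g A - D (x k - A)) /\<^sub>R t k + D ((x k - A) /\<^sub>R t k) = (g (x k) - g A) /\<^sub>R t k" for k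
    by (simp only: D.scaleR flip: scaleR_add_right) (simp only: diff_add_cancel)
  ultimately show ?thesis by (simp only: add_0)
qed

text \<open>The remainder at \<open>A + s\<close> is estimated by applying the mean value inequality on \<open>[0, 1]\<close> to
  \<open>a \<mapsto> f (A + a s) - a f'(A) s - (a\<^sup>2/2) f''(s) s\<close>, whose derivative is \<open>o(s)\<close> applied to \<open>s\<close>.\<close>
lemma second_order_taylor_along_sequence:
  fixes f :: "'a::real_normed_vector \<Rightarrow> 'b::real_normed_vector"
    and f' :: "'a \<Rightarrow> 'a \<Rightarrow>\<^sub>L 'b" and f'' :: "'a \<Rightarrow>\<^sub>L ('a \<Rightarrow>\<^sub>L 'b)"
  assumes S: "open S" "A \<in> S"
    and f: "\<And>x. x \<in> S \<Longrightarrow> (f has_derivative f' x) (at x)"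
    and f': "(f' has_derivative f'') (at A)"
    and t: "\<And>k. t k > 0" "t \<longlonglongrightarrow> (0::real)"
    and x: "(\<lambda>k. (x k - A) /\<^sub>R t k) \<longlonglongrightarrow> \<sigma>"
  shows "(\<lambda>k. (f (x k) - f A - f' A (x k - A)) /\<^sub>R (t k)\<^sup>2) \<longlonglongrightarrow> (1/2) *\<^sub>R f'' \<sigma> \<sigma>"
proof -
  define r where "r s = f (A + s) - f A - f' A s - (1/2) *\<^sub>R f'' s s" for s
  have "\<exists>d>0. \<forall>s. norm s < d \<longrightarrow> norm (r s) \<le> e * norm s ^ 2" if e: "e > 0" for e
  proof -
    obtain d1 where d1: "d1 > 0" "\<And>s. norm s < d1 \<Longrightarrow> norm (f' (A + s) - f' A - f'' s) \<le> e * norm s"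
      using has_derivative_remainder[OF f' e] by blast
    obtain d2 where d2: "d2 > 0" "ball A d2 \<subseteq> S" using S open_contains_ball by blast
    have "norm (r s) \<le> e * norm s ^ 2" if s: "norm s < min d1 d2" for s
    proof -
      define \<psi> where "\<psi> a = f (A + a *\<^sub>R s) - a *\<^sub>R f' A s - (a\<^sup>2/2) *\<^sub>R f'' s s" for a :: real
      have na: "norm (a *\<^sub>R s) < d1" "norm (a *\<^sub>R s) < d2" "norm (a *\<^sub>R s) \<le> norm s" if "a \<in> {0..1}" for a
      proof -
        show "norm (a *\<^sub>R s) \<le> norm s" using that by (simp add: mult_left_le_one_le)
        then show "norm (a *\<^sub>R s) < d1" "norm (a *\<^sub>R s) < d2" using s by linarith+
      qed
      have der: "(\<psi> has_derivative (\<lambda>h. h *\<^sub>R ((f' (A + a *\<^sub>R s) - f' A - f'' (a *\<^sub>R s)) s))) (at a within {0..1})"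
        if a: "a \<in> {0..1}" for a
      proof -
        have "A + a *\<^sub>R s \<in> S" using na[OF a] d2 by (auto simp: dist_norm subset_iff)
        then have 1: "((\<lambda>a. f (A + a *\<^sub>R s)) has_derivative (\<lambda>h. f' (A + a *\<^sub>R s) (h *\<^sub>R s))) (at a within {0..1})"
          by (intro has_derivative_compose[OF _ f]) (auto intro!: derivative_eq_intros)
        have 2: "((\<lambda>a. a *\<^sub>R f' A s) has_derivative (\<lambda>h. h *\<^sub>R f' A s)) (at a within {0..1})"
          by (auto intro!: derivative_eq_intros)
        have 3: "((\<lambda>a. (a\<^sup>2/2) *\<^sub>R f'' s s) has_derivative (\<lambda>h. (h * a) *\<^sub>R f'' s s)) (at a within {0..1})"
          by (auto intro!: derivative_eq_intros)
        show ?thesis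
          using has_derivative_diff[OF has_derivative_diff[OF 1 2] 3]
          by (simp add: \<psi>_def[abs_def] blinfun.scaleR_right blinfun.scaleR_left blinfun.diff_left scaleR_right_diff_distrib)
      qed
      have bound: "onorm (\<lambda>h. h *\<^sub>R ((f' (A + a *\<^sub>R s) - f' A - f'' (a *\<^sub>R s)) s)) \<le> e * norm s ^ 2"
        if a: "a \<in> {0..1}" for a
      proof -
        let ?z = "(f' (A + a *\<^sub>R s) - f' A - f'' (a *\<^sub>R s)) s"
        have "norm ?z \<le> norm (f' (A + a *\<^sub>R s) - f' A - f'' (a *\<^sub>R s)) * norm s" by (rule norm_blinfun)
        also have "\<dots> \<le> (e * norm (a *\<^sub>R s)) * norm s" using d1(2)[OF na(1)[OF a]] by (intro mult_right_mono) auto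
        also have "\<dots> \<le> (e * norm s) * norm s" using na[OF a] e by (intro mult_right_mono mult_left_mono) auto
        finally have nz: "norm ?z \<le> e * norm s ^ 2" by (simp add: power2_eq_square)
        show ?thesis
          by (rule onorm_le) (use nz in \<open>simp add: mult.commute[of _ "\<bar>_\<bar>"] mult_left_mono\<close>)
      qed
      have "norm (\<psi> 1 - \<psi> 0) \<le> e * norm s ^ 2 * norm (1 - 0 :: real)"
        by (rule differentiable_bound[OF _ der bound]) auto
      then show ?thesis by (simp add: \<psi>_def r_def algebra_simps)
    qed
    then show ?thesis using d1 d2 by (intro exI[of _ "min d1 d2"]) auto
  qed
  then have "(\<lambda>k. r (x k - A) /\<^sub>R (t k)\<^sup>2) \<longlonglongrightarrow> 0" by (rule small_o_along_sequence[OF _ t x])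
  then have "(\<lambda>k. r (x k - A) /\<^sub>R (t k)\<^sup>2 + (1/2) *\<^sub>R f'' ((x k - A) /\<^sub>R t k) ((x k - A) /\<^sub>R t k)) \<longlonglongrightarrow> 0 + (1/2) *\<^sub>R f'' \<sigma> \<sigma>"
    by (intro tendsto_add tendsto_scaleR[OF tendsto_const] blinfun.tendsto[OF blinfun.tendsto[OF tendsto_const x] x])
  moreover have "r (x k - A) /\<^sub>R (t k)\<^sup>2 + (1/2) *\<^sub>R f'' ((x k - A) /\<^sub>R t k) ((x k - A) /\<^sub>R t k)
      = (f (x k) - f A - f' A (x k - A)) /\<^sub>R (t k)\<^sup>2" for k
  proof -
    have "(1/2) *\<^sub>R f'' ((x k - A) /\<^sub>R t k) ((x k - A) /\<^sub>R t k) = ((1/2) *\<^sub>R f'' (x k - A) (x k - A)) /\<^sub>R (t k)\<^sup>2"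
      by (simp only: blinfun.scaleR_right blinfun.scaleR_left scaleR_scaleR power2_eq_square inverse_mult_distrib mult_ac)
    then show ?thesis
      by (simp only: r_def flip: scaleR_add_right) (simp only: add_diff_eq add_diff_cancel_left' diff_add_cancel)
  qed
  ultimately show ?thesis by (simp only: add_0)
qed


lemma adjoint_blinfun:
  fixes g :: "'a::euclidean_space \<Rightarrow>\<^sub>L 'b::euclidean_space"
  shows "linear (adjoint (blinfun_apply g))" and "inner (adjoint (blinfun_apply g) y) v = inner y (g v)"
proof -
  have "linear g" by (rule bounded_linear.linear[OF blinfun.bounded_linear_right])
  then show "linear (adjoint (blinfun_apply g))" "inner (adjoint (blinfun_apply g) y) v = inner y (g v)"
    using adjoint_linear adjoint_works[of g v y] by (simp_all add: inner_commute)
qed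


section \<open>Distance penalties and their Fermat rule\<close>

text \<open>The subdifferential of \<open>\<rho> dist(\<cdot>, K)\<close> at \<open>z\<close>.  The last equation selects, outside \<open>K\<close>, the multiple of
  norm \<open>\<rho>\<close> of \<open>z\<close> minus its projection, and is void at points of \<open>K\<close>.\<close>
definition penalty_multipliers :: "'y::euclidean_space set \<Rightarrow> real \<Rightarrow> 'y \<Rightarrow> 'y set" where
  "penalty_multipliers K \<rho> z = {y \<in> normal_cone K (closest_point K z).
     norm y \<le> \<rho> \<and> inner y (z - closest_point K z) = \<rho> * infdist z K}"

lemma infdist_eq_dist_closest_point:
  assumes "closed K" "K \<noteq> {}"
  shows "infdist z K = norm (z - closest_point K z)"
  using setdist_closest_point[OF assms, of z] by (simp add: infdist_eq_setdist dist_norm)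

lemma normal_cone_closed_graph:
  assumes "closed K" and "z \<longlonglongrightarrow> z0" and "y \<longlonglongrightarrow> y0" and "\<And>k. y k \<in> normal_cone K (z k)"
  shows "y0 \<in> normal_cone K z0"
proof -
  have z0: "z0 \<in> K"
    using closed_sequentially[OF assms(1) _ assms(2)] assms(4) by (simp add: normal_cone_def)
  have "inner y0 (w - z0) \<le> 0" if "w \<in> K" for w
  proof (rule LIMSEQ_le_const2)
    show "(\<lambda>k. inner (y k) (w - z k)) \<longlonglongrightarrow> inner y0 (w - z0)"
      by (rule tendsto_inner[OF assms(3) tendsto_diff[OF tendsto_const assms(2)]])
    show "\<exists>N. \<forall>n\<ge>N. inner (y n) (w - z n) \<le> 0" using assms(4) that by (auto simp: normal_cone_def)
  qed
  with z0 show ?thesis by (simp add: normal_cone_def)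
qed

lemma penalty_multipliers_closed_graph:
  assumes K: "closed K" "convex K" "K \<noteq> {}"
    and z: "z \<longlonglongrightarrow> z0" and y: "y \<longlonglongrightarrow> y0" and mem: "\<And>k. y k \<in> penalty_multipliers K \<rho> (z k)"
  shows "y0 \<in> penalty_multipliers K \<rho> z0"
proof -
  have p: "(\<lambda>k. closest_point K (z k)) \<longlonglongrightarrow> closest_point K z0"
    using continuous_at_closest_point[OF K(2,1,3)] z isCont_tendsto_compose by blast
  have 1: "y0 \<in> normal_cone K (closest_point K z0)"
    by (rule normal_cone_closed_graph[OF K(1) p y]) (use mem in \<open>simp add: penalty_multipliers_def\<close>)
  have 2: "norm y0 \<le> \<rho>"
    by (rule LIMSEQ_le_const2[OF tendsto_norm[OF y]]) (use mem in \<open>simp add: penalty_multipliers_def\<close>)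
  have l: "(\<lambda>k. inner (y k) (z k - closest_point K (z k))) \<longlonglongrightarrow> inner y0 (z0 - closest_point K z0)"
    by (rule tendsto_inner[OF y tendsto_diff[OF z p]])
  have r: "(\<lambda>k. \<rho> * infdist (z k) K) \<longlonglongrightarrow> \<rho> * infdist z0 K"
    by (rule tendsto_mult_left[OF tendsto_infdist[OF z]])
  have e: "inner (y k) (z k - closest_point K (z k)) = \<rho> * infdist (z k) K" for k
    using mem by (simp add: penalty_multipliers_def)
  have "inner y0 (z0 - closest_point K z0) = \<rho> * infdist z0 K"
    by (rule LIMSEQ_unique[OF l]) (use r in \<open>simp only: e\<close>)
  with 1 2 show ?thesis by (simp add: penalty_multipliers_def)
qed

lemma penalty_multipliers_subgradient:
  assumes K: "closed K" "convex K" "K \<noteq> {}" and y: "y \<in> penalty_multipliers K \<rho> z"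
  shows "\<rho> * infdist z K + inner y (w - z) \<le> \<rho> * infdist w K"
proof -
  let ?p = "closest_point K"
  have "inner y (w - ?p w) \<le> norm y * norm (w - ?p w)" by (rule norm_cauchy_schwarz)
  also have "\<dots> \<le> \<rho> * infdist w K"
    using y by (simp add: infdist_eq_dist_closest_point[OF K(1,3)] penalty_multipliers_def mult_right_mono)
  finally have 1: "inner y (w - ?p w) \<le> \<rho> * infdist w K" .
  have 2: "inner y (?p w - ?p z) \<le> 0"
    using y closest_point_in_set[OF K(1,3)] by (simp add: penalty_multipliers_def normal_cone_def)
  have 3: "inner y (z - ?p z) = \<rho> * infdist z K" using y by (simp add: penalty_multipliers_def)
  show ?thesis using 1 2 3 by (simp add: inner_diff_right)
qed

lemma penalty_multipliers_nonempty:
  assumes K: "closed K" "convex K" "K \<noteq> {}" and "\<rho> \<ge> 0"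
  shows "penalty_multipliers K \<rho> z \<noteq> {}"
proof (cases "z \<in> K")
  case True
  then have "0 \<in> penalty_multipliers K \<rho> z"
    using assms by (simp add: penalty_multipliers_def normal_cone_def closest_point_self)
  then show ?thesis by blast
next
  case False
  let ?p = "closest_point K z"
  define n where "n = norm (z - ?p)"
  have pK: "?p \<in> K" using closest_point_in_set[OF K(1,3)] .
  then have n: "n > 0" using False by (auto simp: n_def)
  have 1: "(\<rho> / n) *\<^sub>R (z - ?p) \<in> normal_cone K ?p"
    using pK mult_nonneg_nonpos[of "\<rho> / n", OF _ closest_point_dot[OF K(2,1), of _ z]] n \<open>\<rho> \<ge> 0\<close>
    unfolding normal_cone_def inner_scaleR_left by simp
  have 2: "norm ((\<rho> / n) *\<^sub>R (z - ?p)) = \<rho>" using n \<open>\<rho> \<ge> 0\<close> by (simp add: n_def)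
  have 3: "inner ((\<rho> / n) *\<^sub>R (z - ?p)) (z - ?p) = \<rho> * infdist z K"
    using n by (simp add: infdist_eq_dist_closest_point[OF K(1,3)] n_def dot_square_norm power2_eq_square)
  from 1 2 3 have "(\<rho> / n) *\<^sub>R (z - ?p) \<in> penalty_multipliers K \<rho> z"
    by (simp add: penalty_multipliers_def)
  then show ?thesis by blast
qed

lemma penalty_multipliers_compact_convex:
  assumes K: "closed K" "convex K" "K \<noteq> {}"
  shows "compact (penalty_multipliers K \<rho> z)" "convex (penalty_multipliers K \<rho> z)"
proof -
  have "closed (penalty_multipliers K \<rho> z)"
    unfolding closed_sequential_limits
    using penalty_multipliers_closed_graph[OF K tendsto_const] by blast
  moreover have "bounded (penalty_multipliers K \<rho> z)"
    unfolding bounded_iff by (auto simp: penalty_multipliers_def)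
  ultimately show "compact (penalty_multipliers K \<rho> z)" by (simp add: compact_eq_bounded_closed)
  show "convex (penalty_multipliers K \<rho> z)"
  proof (rule convexI)
    fix x y u v assume x: "x \<in> penalty_multipliers K \<rho> z" and y: "y \<in> penalty_multipliers K \<rho> z"
      and uv: "(0::real) \<le> u" "0 \<le> v" "u + v = 1"
    have "norm (u *\<^sub>R x + v *\<^sub>R y) \<le> \<rho>"
      using convexD[OF convex_cball[of 0 \<rho>], of x y u v] x y uv by (simp add: penalty_multipliers_def)
    moreover have "inner (u *\<^sub>R x + v *\<^sub>R y) (w - closest_point K z) \<le> 0" if "w \<in> K" for w
      using x y uv that
      by (simp add: inner_add_left penalty_multipliers_def normal_cone_def mult_nonneg_nonpos add_nonpos_nonpos)
    moreover have "inner (u *\<^sub>R x + v *\<^sub>R y) (z - closest_point K z) = \<rho> * infdist z K"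
    proof -
      have "inner (u *\<^sub>R x + v *\<^sub>R y) (z - closest_point K z) = u * (\<rho> * infdist z K) + v * (\<rho> * infdist z K)"
        using x y by (simp add: inner_add_left penalty_multipliers_def)
      then show ?thesis using uv by (simp flip: distrib_right)
    qed
    ultimately show "u *\<^sub>R x + v *\<^sub>R y \<in> penalty_multipliers K \<rho> z"
      using x by (simp add: penalty_multipliers_def normal_cone_def)
  qed
qed

lemma penalty_multipliers_feasible:
  assumes "closed K" "z \<in> K" "y \<in> penalty_multipliers K \<rho> z"
  shows "y \<in> normal_cone K z"
  using assms by (simp add: penalty_multipliers_def closest_point_self)

lemma norm_penalty_multipliers_infeasible:
  assumes K: "closed K" "K \<noteq> {}" and z: "z \<notin> K" and y: "y \<in> penalty_multipliers K \<rho> z"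
  shows "norm y = \<rho>"
proof -
  let ?p = "closest_point K z"
  have n: "norm (z - ?p) > 0" using z closest_point_in_set[OF K, of z] by auto
  have "\<rho> * norm (z - ?p) \<le> norm y * norm (z - ?p)"
    using y norm_cauchy_schwarz[of y "z - ?p"]
    by (simp add: penalty_multipliers_def infdist_eq_dist_closest_point[OF K])
  then have "\<rho> \<le> norm y" using n by simp
  then show ?thesis using y by (simp add: penalty_multipliers_def)
qed

lemma bounded_sequence_subsequence:
  fixes y :: "nat \<Rightarrow> 'a::euclidean_space"
  assumes "\<And>k. norm (y k) \<le> M"
  obtains r l where "strict_mono r" "(\<lambda>k. y (r k)) \<longlonglongrightarrow> l"
  using bounded_imp_convergent_subsequence[of y] assms
  unfolding bounded_iff o_def by blast

text \<open>The vectors \<open>D\<^sup>* y\<close> with \<open>y\<close> a penalty multiplier at \<open>G x0\<close> form a compact convex set.  If it does not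
  contain \<open>- F'\<close>, a separating hyperplane yields a direction along which \<open>F'\<close> plus every such vector
  is negative.  The increase of the penalty along this direction is bounded by the
  subgradients at the points ahead, and these accumulate at penalty multipliers of \<open>G x0\<close>; so the
  penalized function would decrease.\<close>
theorem penalty_fermat_rule:
  fixes F :: "'x::euclidean_space \<Rightarrow> real" and G :: "'x \<Rightarrow> 'y::euclidean_space"
  assumes K: "closed K" "convex K" "K \<noteq> {}" and \<rho>: "\<rho> \<ge> 0"
    and U: "open U" "x0 \<in> U"
    and min: "\<And>x. x \<in> U \<Longrightarrow> F x0 + \<rho> * infdist (G x0) K \<le> F x + \<rho> * infdist (G x) K"
    and F: "(F has_derivative F') (at x0)" and G: "(G has_derivative D) (at x0)"
  shows "\<exists>y \<in> penalty_multipliers K \<rho> (G x0). \<forall>v. F' v + inner y (D v) = 0"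
proof (rule ccontr)
  assume no: "\<not> ?thesis"
  let ?P = "penalty_multipliers K \<rho>"
  have lF: "linear F'" and lD: "linear D"
    using F G has_derivative_bounded_linear bounded_linear.linear by blast+
  define g where "g = adjoint F' 1"
  have g: "F' v = inner g v" for v
    using adjoint_works[OF lF, of v 1] by (simp add: g_def inner_commute)
  have adj: "inner (adjoint D y) v = inner y (D v)" for y v
    using adjoint_works[OF lD, of v y] by (simp add: inner_commute)
  have "compact (adjoint D ` ?P (G x0))" "convex (adjoint D ` ?P (G x0))"
    using penalty_multipliers_compact_convex[OF K, of \<rho> "G x0"] adjoint_linear[OF lD]
    by (auto intro!: compact_continuous_image linear_continuous_on convex_linear_image
        simp: linear_conv_bounded_linear)
  moreover have "- g \<notin> adjoint D ` ?P (G x0)"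
  proof
    assume "- g \<in> adjoint D ` ?P (G x0)"
    then obtain y where "y \<in> ?P (G x0)" and "- g = adjoint D y" by blast
    then have "F' v + inner y (D v) = 0" for v
      using adj[of y v] by (simp add: g flip: \<open>- g = adjoint D y\<close>)
    with no \<open>y \<in> ?P (G x0)\<close> show False by blast
  qed
  ultimately obtain a b where ab: "inner a (- g) < b" "\<And>x. x \<in> adjoint D ` ?P (G x0) \<Longrightarrow> inner a x > b"
    using separating_hyperplane_closed_point[of "adjoint D ` ?P (G x0)" "- g"] compact_imp_closed by blast
  have neg: "F' (- a) + inner y (D (- a)) < 0" if "y \<in> ?P (G x0)" for y
    using ab(1) ab(2)[OF imageI[OF that]] adj[of y a]
    by (simp add: g linear_neg[OF lD] inner_commute)
  define t where "t k = inverse (real (Suc k))" for k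
  have t: "\<And>k. t k > 0" "t \<longlonglongrightarrow> 0"
    unfolding t_def using LIMSEQ_inverse_real_of_nat by simp_all
  define x where "x k = x0 + t k *\<^sub>R (- a)" for k
  have dx: "(x k - x0) /\<^sub>R t k = - a" for k using t(1)[of k] by (simp add: x_def)
  have xlim: "x \<longlonglongrightarrow> x0"
    unfolding x_def using tendsto_add[OF tendsto_const[of x0] tendsto_scaleR[OF t(2) tendsto_const[of "-a"]]] by simp
  have "\<exists>y. \<forall>k. y k \<in> ?P (G (x k))"
    using penalty_multipliers_nonempty[OF K \<rho>] by (intro choice) blast
  then obtain y where y: "\<And>k. y k \<in> ?P (G (x k))" by blast
  obtain r l where r: "strict_mono r" and l: "(\<lambda>k. y (r k)) \<longlonglongrightarrow> l"
    by (rule bounded_sequence_subsequence[of y \<rho>]) (use y in \<open>auto simp: penalty_multipliers_def\<close>)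
  have Gx: "(\<lambda>k. G (x (r k))) \<longlonglongrightarrow> G x0"
    using isCont_tendsto_compose[OF has_derivative_continuous[OF G] xlim] LIMSEQ_subseq_LIMSEQ[OF _ r]
    unfolding o_def by blast
  have lP: "l \<in> ?P (G x0)" by (rule penalty_multipliers_closed_graph[OF K Gx l y])
  have tr: "\<And>k. t (r k) > 0" "(\<lambda>k. t (r k)) \<longlonglongrightarrow> 0"
    using t LIMSEQ_subseq_LIMSEQ[OF t(2) r] by (auto simp: o_def)
  have dxr: "(\<lambda>k. (x (r k) - x0) /\<^sub>R t (r k)) \<longlonglongrightarrow> - a" by (simp only: dx tendsto_const)
  have q: "(\<lambda>k. (F (x (r k)) - F x0) /\<^sub>R t (r k) + inner (y (r k)) ((G (x (r k)) - G x0) /\<^sub>R t (r k))) \<longlonglongrightarrow>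
      F' (- a) + inner l (D (- a))"
    by (rule tendsto_add[OF derivative_along_sequence[OF F tr dxr] tendsto_inner[OF l derivative_along_sequence[OF G tr dxr]]])
  have ev: "\<forall>\<^sub>F k in sequentially. x (r k) \<in> U"
    using topological_tendstoD[OF LIMSEQ_subseq_LIMSEQ[OF xlim r] U] by (simp add: o_def)
  have "\<forall>\<^sub>F k in sequentially. 0 \<le> (F (x (r k)) - F x0) /\<^sub>R t (r k) + inner (y (r k)) ((G (x (r k)) - G x0) /\<^sub>R t (r k))"
    using ev
  proof eventually_elim
    case (elim k)
    have "\<rho> * infdist (G (x (r k))) K + inner (y (r k)) (G x0 - G (x (r k))) \<le> \<rho> * infdist (G x0) K"
      by (rule penalty_multipliers_subgradient[OF K y])
    with min[OF elim] have "0 \<le> (F (x (r k)) - F x0) + inner (y (r k)) (G (x (r k)) - G x0)"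
      by (simp add: inner_diff_right)
    then have "0 \<le> ((F (x (r k)) - F x0) + inner (y (r k)) (G (x (r k)) - G x0)) /\<^sub>R t (r k)"
      using tr(1)[of k] by simp
    then show ?case by (simp only: inner_scaleR_right distrib_left real_scaleR_def)
  qed
  then have "0 \<le> F' (- a) + inner l (D (- a))"
    using tendsto_lowerbound[OF q] by simp
  with neg[OF lP] show False by simp
qed


section \<open>KKT points of perturbed problems by exact penalization\<close>

lemma ball_minimizers:
  fixes \<phi> :: "nat \<Rightarrow> 'a::euclidean_space \<Rightarrow> real"
  assumes "\<delta> > 0" and "\<And>k. continuous_on (cball xbar \<delta>) (\<phi> k)"
  shows "\<exists>x0. \<forall>k. x0 k \<in> cball xbar \<delta> \<and> (\<forall>x\<in>cball xbar \<delta>. \<phi> k (x0 k) \<le> \<phi> k x)"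
proof (rule choice, rule allI)
  fix k
  show "\<exists>z. z \<in> cball xbar \<delta> \<and> (\<forall>x\<in>cball xbar \<delta>. \<phi> k z \<le> \<phi> k x)"
    using continuous_attains_inf[OF compact_cball _ assms(2), of k] assms(1) by auto
qed

lemma tendsto_derivative_apply:
  fixes F' :: "'a::real_normed_vector \<Rightarrow> 'a \<Rightarrow>\<^sub>L 'b::real_normed_vector"
  assumes "isCont F' z" "x \<longlonglongrightarrow> z"
  shows "(\<lambda>k. F' (x k) v) \<longlonglongrightarrow> F' z v"
  by (rule blinfun.tendsto[OF isCont_tendsto_compose[OF assms] tendsto_const])

text \<open>Minimizers of the perturbed penalty functions over the ball exist even when the perturbed
  constraint set is not known to be nonempty, and strictness of the minimizer \<open>xbar\<close> makes them converge
  to it.  Their Fermat multipliers accumulate at a multiplier of the unperturbed problem, hence at \<open>ybar\<close>,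
  so they eventually have norm less than \<open>\<rho>\<close>.  At an infeasible point a penalty multiplier has norm
  exactly \<open>\<rho>\<close>; thus the minimizers become feasible and the multipliers normal vectors.\<close>
lemma perturbed_kkt_points:
  fixes F :: "'x::euclidean_space \<Rightarrow> real" and G :: "'x \<Rightarrow> 'y::euclidean_space"
    and F' :: "'x \<Rightarrow> 'x \<Rightarrow>\<^sub>L real" and G' :: "'x \<Rightarrow> 'x \<Rightarrow>\<^sub>L 'y"
  assumes K: "closed K" "convex K" "K \<noteq> {}"
    and F: "\<And>x. (F has_derivative F' x) (at x)" "isCont F' xbar"
    and G: "\<And>x. (G has_derivative G' x) (at x)" "isCont G' xbar"
    and A: "G xbar \<in> K" and \<delta>: "\<delta> > 0"
    and strict: "\<forall>x\<in>cball xbar \<delta>. x \<noteq> xbar \<longrightarrow> F xbar < F x + \<rho> * infdist (G x) K"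
    and uniq: "\<forall>y\<in>normal_cone K (G xbar). (\<forall>v. F' xbar v + inner y (G' xbar v) = 0) \<longrightarrow> y = ybar"
    and \<rho>: "norm ybar < \<rho>"
    and a: "a \<longlonglongrightarrow> 0" and b: "b \<longlonglongrightarrow> 0"
  shows "\<exists>r x y. strict_mono (r :: nat \<Rightarrow> nat) \<and> x \<longlonglongrightarrow> xbar \<and> y \<longlonglongrightarrow> ybar \<and>
    (\<forall>k v. F' (x k) v + inner (y k) (G' (x k) v) = inner (a (r k)) v) \<and>
    (\<forall>k. y k \<in> normal_cone K (G (x k) + b (r k))) \<and>
    (\<forall>k. F (x k) - inner (a (r k)) (x k) \<le> F xbar - inner (a (r k)) xbar + \<rho> * infdist (G xbar + b (r k)) K)"
proof -
  have \<rho>0: "\<rho> \<ge> 0" using \<rho> norm_ge_zero[of ybar] by linarith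
  let ?P = "penalty_multipliers K \<rho>"
  define \<phi> where "\<phi> k x = (F x - inner (a k) x) + \<rho> * infdist (G x + b k) K" for k x
  have cF: "isCont F x" and cG: "isCont G x" for x
    using F(1) G(1) has_derivative_continuous by blast+
  have "continuous_on (cball xbar \<delta>) (\<phi> k)" for k
    unfolding \<phi>_def
    by (intro continuous_intros continuous_at_imp_continuous_on ballI cF cG)
  from ball_minimizers[where \<phi>=\<phi>, OF \<delta> this]
  obtain x0 where x0: "\<And>k. x0 k \<in> cball xbar \<delta>" "\<And>k x. x \<in> cball xbar \<delta> \<Longrightarrow> \<phi> k (x0 k) \<le> \<phi> k x" by blast
  have "norm (x0 k) \<le> norm xbar + \<delta>" for k
    using x0(1)[of k] norm_triangle_sub[of "x0 k" xbar] by (simp add: dist_norm norm_minus_commute)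
  then obtain r1 z where r1: "strict_mono r1" and z: "(\<lambda>k. x0 (r1 k)) \<longlonglongrightarrow> z"
    by (rule bounded_sequence_subsequence)
  have zc: "z \<in> cball xbar \<delta>" by (rule closed_sequentially[OF closed_cball _ z]) (use x0 in blast)
  have sub: "(\<lambda>k. a (r k)) \<longlonglongrightarrow> 0" "(\<lambda>k. b (r k)) \<longlonglongrightarrow> 0" if "strict_mono r" for r
    using LIMSEQ_subseq_LIMSEQ[OF a that] LIMSEQ_subseq_LIMSEQ[OF b that] by (auto simp: o_def)
  have lim: "(\<lambda>k. \<phi> (r1 k) (x (r1 k))) \<longlonglongrightarrow> (F w - inner 0 w) + \<rho> * infdist (G w + 0) K"
    if "(\<lambda>k. x (r1 k)) \<longlonglongrightarrow> w" for x w
    unfolding \<phi>_def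
    by (intro tendsto_add tendsto_diff tendsto_inner tendsto_mult_left tendsto_infdist
        sub[OF r1] isCont_tendsto_compose[OF cF] isCont_tendsto_compose[OF cG] that)
  have "(F z - inner 0 z) + \<rho> * infdist (G z + 0) K \<le> (F xbar - inner 0 xbar) + \<rho> * infdist (G xbar + 0) K"
    by (rule LIMSEQ_le[OF lim[OF z] lim[where x="\<lambda>_. xbar", OF tendsto_const]])
       (use x0(2)[of xbar] \<delta> in auto)
  then have "F z + \<rho> * infdist (G z) K \<le> F xbar" using A by simp
  then have zx: "z = xbar" using bspec[OF strict zc] by fastforce
  obtain N where N: "\<And>k. k \<ge> N \<Longrightarrow> dist (x0 (r1 k)) xbar < \<delta>"
    using tendstoD[OF z \<delta>] unfolding zx eventually_sequentially by blast
  define r2 where "r2 k = r1 (k + N)" for k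
  have r2: "strict_mono r2" using r1 by (simp add: r2_def strict_mono_def)
  have x2: "(\<lambda>k. x0 (r2 k)) \<longlonglongrightarrow> xbar"
    using LIMSEQ_ignore_initial_segment[OF z] unfolding zx r2_def .
  have "\<exists>y \<in> ?P (G (x0 (r2 k)) + b (r2 k)). \<forall>v. (F' (x0 (r2 k)) v - inner (a (r2 k)) v) + inner y (G' (x0 (r2 k)) v) = 0" for k
  proof (rule penalty_fermat_rule[OF K \<rho>0 open_ball, where F="\<lambda>x. F x - inner (a (r2 k)) x" and G="\<lambda>x. G x + b (r2 k)"])
    show "x0 (r2 k) \<in> ball xbar \<delta>" using N[of "k + N"] by (simp add: r2_def dist_commute)
    show "F (x0 (r2 k)) - inner (a (r2 k)) (x0 (r2 k)) + \<rho> * infdist (G (x0 (r2 k)) + b (r2 k)) K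
        \<le> F x - inner (a (r2 k)) x + \<rho> * infdist (G x + b (r2 k)) K" if "x \<in> ball xbar \<delta>" for x
      using x0(2)[of x "r2 k"] that by (simp add: \<phi>_def)
    show "((\<lambda>x. F x - inner (a (r2 k)) x) has_derivative (\<lambda>v. F' (x0 (r2 k)) v - inner (a (r2 k)) v)) (at (x0 (r2 k)))"
      by (intro has_derivative_diff F(1) has_derivative_inner_right has_derivative_ident)
    show "((\<lambda>x. G x + b (r2 k)) has_derivative (\<lambda>v. G' (x0 (r2 k)) v)) (at (x0 (r2 k)))"
      using has_derivative_add[OF G(1) has_derivative_const] by simp
  qed
  then have "\<exists>y. \<forall>k. y k \<in> ?P (G (x0 (r2 k)) + b (r2 k)) \<and>
      (\<forall>v. (F' (x0 (r2 k)) v - inner (a (r2 k)) v) + inner (y k) (G' (x0 (r2 k)) v) = 0)"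
    by (intro choice) blast
  then obtain y where y: "\<And>k. y k \<in> ?P (G (x0 (r2 k)) + b (r2 k))"
    and st: "\<And>k v. (F' (x0 (r2 k)) v - inner (a (r2 k)) v) + inner (y k) (G' (x0 (r2 k)) v) = 0"
    by blast
  have "norm (y k) \<le> \<rho>" for k using y[of k] by (simp add: penalty_multipliers_def)
  then obtain r3 l where r3: "strict_mono r3" and l: "(\<lambda>k. y (r3 k)) \<longlonglongrightarrow> l"
    by (rule bounded_sequence_subsequence)
  have r23: "strict_mono (\<lambda>k. r2 (r3 k))" using strict_mono_o[OF r2 r3] by (simp add: o_def)
  have x3: "(\<lambda>k. x0 (r2 (r3 k))) \<longlonglongrightarrow> xbar"
    using LIMSEQ_subseq_LIMSEQ[OF x2 r3] by (simp add: o_def)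
  have "(\<lambda>k. G (x0 (r2 (r3 k))) + b (r2 (r3 k))) \<longlonglongrightarrow> G xbar + 0"
    by (intro tendsto_add isCont_tendsto_compose[OF cG x3] sub[OF r23])
  then have "l \<in> ?P (G xbar + 0)" by (rule penalty_multipliers_closed_graph[OF K _ l]) (rule y)
  then have lN: "l \<in> normal_cone K (G xbar)" using penalty_multipliers_feasible[OF K(1) A] by simp
  moreover have "F' xbar v + inner l (G' xbar v) = 0" for v
  proof -
    have "(\<lambda>k. (F' (x0 (r2 (r3 k))) v - inner (a (r2 (r3 k))) v) + inner (y (r3 k)) (G' (x0 (r2 (r3 k))) v))
        \<longlonglongrightarrow> (F' xbar v - inner 0 v) + inner l (G' xbar v)"
      by (intro tendsto_add tendsto_diff tendsto_inner tendsto_const l sub[OF r23]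
          tendsto_derivative_apply[OF F(2) x3] tendsto_derivative_apply[OF G(2) x3])
    then have "(\<lambda>k. 0) \<longlonglongrightarrow> (F' xbar v - inner 0 v) + inner l (G' xbar v)" by (simp only: st)
    then show ?thesis using LIMSEQ_unique[OF tendsto_const] by fastforce
  qed
  ultimately have ly: "l = ybar" using uniq by blast
  have "\<forall>\<^sub>F k in sequentially. norm (y (r3 k)) < \<rho>"
    using order_tendstoD(2)[OF tendsto_norm[OF l]] \<rho> ly by simp
  then obtain N2 where N2: "\<And>k. k \<ge> N2 \<Longrightarrow> norm (y (r3 k)) < \<rho>"
    unfolding eventually_sequentially by blast
  define s where "s k = r3 (k + N2)" for k
  show ?thesis
  proof (intro exI[of _ "\<lambda>k. r2 (s k)"] exI[of _ "\<lambda>k. x0 (r2 (s k))"] exI[of _ "\<lambda>k. y (s k)"] conjI allI)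
    show "strict_mono (\<lambda>k. r2 (s k))" using r23 by (simp add: s_def strict_mono_def)
    show "(\<lambda>k. x0 (r2 (s k))) \<longlonglongrightarrow> xbar"
      unfolding s_def by (rule LIMSEQ_ignore_initial_segment[OF x3])
    show "(\<lambda>k. y (s k)) \<longlonglongrightarrow> ybar"
      unfolding s_def using LIMSEQ_ignore_initial_segment[OF l] ly by simp
    show "F' (x0 (r2 (s k))) v + inner (y (s k)) (G' (x0 (r2 (s k))) v) = inner (a (r2 (s k))) v" for k v
      using st[of "s k" v] by simp
    have "G (x0 (r2 (s k))) + b (r2 (s k)) \<in> K" for k
      using norm_penalty_multipliers_infeasible[OF K(1,3) _ y[of "s k"]] N2[of "k + N2"] by (fastforce simp: s_def)
    then show "y (s k) \<in> normal_cone K (G (x0 (r2 (s k))) + b (r2 (s k)))" for k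
      using penalty_multipliers_feasible[OF K(1) _ y] by blast
    have "\<phi> k (x0 k) \<le> \<phi> k xbar" for k using x0(2)[of xbar k] \<delta> by simp
    moreover have "F (x0 k) - inner (a k) (x0 k) \<le> \<phi> k (x0 k)" for k
      using mult_nonneg_nonneg[OF \<rho>0 infdist_nonneg] by (simp add: \<phi>_def)
    ultimately show "F (x0 (r2 (s k))) - inner (a (r2 (s k))) (x0 (r2 (s k))) \<le>
        F xbar - inner (a (r2 (s k))) xbar + \<rho> * infdist (G xbar + b (r2 (s k))) K" for k
      unfolding \<phi>_def using order_trans by blast
  qed
qed

text \<open>If every \<open>\<rho>\<close> failed, the minimizers for \<open>\<rho> = k\<close> would be infeasible, so their multipliers would have
  norm \<open>k\<close>; divided by \<open>k\<close>, these accumulate at a unit normal vector annihilated by \<open>G'\<^sup>*\<close>, which the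
  constraint qualification rules out.  The quadratic term forces the minimizers to converge to \<open>xbar\<close>.\<close>
lemma exact_penalty:
  fixes F :: "'x::euclidean_space \<Rightarrow> real" and G :: "'x \<Rightarrow> 'y::euclidean_space"
    and F' :: "'x \<Rightarrow> 'x \<Rightarrow>\<^sub>L real" and G' :: "'x \<Rightarrow> 'x \<Rightarrow>\<^sub>L 'y"
  assumes K: "closed K" "convex K" "K \<noteq> {}"
    and F: "\<And>x. (F has_derivative F' x) (at x)" "isCont F' xbar"
    and G: "\<And>x. (G has_derivative G' x) (at x)" "isCont G' xbar"
    and A: "G xbar \<in> K" and \<delta>: "\<delta> > 0"
    and locmin: "\<forall>x\<in>cball xbar \<delta>. G x \<in> K \<longrightarrow> F xbar \<le> F x"
    and cq: "\<forall>\<eta>\<in>normal_cone K (G xbar). (\<forall>v. inner \<eta> (G' xbar v) = 0) \<longrightarrow> \<eta> = 0"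
  shows "\<exists>\<rho>>0. \<forall>x\<in>cball xbar \<delta>. F xbar \<le> F x + (norm (x - xbar))\<^sup>2 + \<rho> * infdist (G x) K"
proof (rule ccontr)
  assume neg: "\<not> ?thesis"
  define q where "q k = real (Suc k)" for k
  have q: "q k > 0" for k by (simp add: q_def)
  have qinf: "(\<lambda>k. inverse (q k)) \<longlonglongrightarrow> 0" unfolding q_def by (rule LIMSEQ_inverse_real_of_nat)
  define H where "H x = F x + (norm (x - xbar))\<^sup>2" for x
  define \<phi> where "\<phi> k x = H x + q k * infdist (G x) K" for k x
  have cF: "isCont F x" and cG: "isCont G x" for x
    using F(1) G(1) has_derivative_continuous by blast+
  have "continuous_on (cball xbar \<delta>) (\<phi> k)" for k
    unfolding \<phi>_def H_def
    by (intro continuous_intros continuous_at_imp_continuous_on ballI cF cG)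
  from ball_minimizers[where \<phi>=\<phi>, OF \<delta> this]
  obtain x0 where x0: "\<And>k. x0 k \<in> cball xbar \<delta>" "\<And>k x. x \<in> cball xbar \<delta> \<Longrightarrow> \<phi> k (x0 k) \<le> \<phi> k x" by blast
  have less: "\<phi> k (x0 k) < F xbar" for k
  proof -
    obtain x where x: "x \<in> cball xbar \<delta>" "F x + (norm (x - xbar))\<^sup>2 + q k * infdist (G x) K < F xbar"
      using neg q[of k] by (meson not_le)
    then have "\<phi> k x < F xbar" by (simp add: \<phi>_def H_def)
    with x0(2)[OF x(1), of k] show ?thesis by linarith
  qed
  have HF: "F x \<le> H x" for x by (simp add: H_def)
  have out: "G (x0 k) \<notin> K" for k
    using less[of k] bspec[OF locmin x0(1)[of k]] HF[of "x0 k"] by (auto simp: \<phi>_def)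
  have "norm (x0 k) \<le> norm xbar + \<delta>" for k
    using x0(1)[of k] norm_triangle_sub[of "x0 k" xbar] by (simp add: dist_norm norm_minus_commute)
  then obtain r1 z where r1: "strict_mono r1" and z: "(\<lambda>k. x0 (r1 k)) \<longlonglongrightarrow> z"
    by (rule bounded_sequence_subsequence)
  have zc: "z \<in> cball xbar \<delta>" by (rule closed_sequentially[OF closed_cball _ z]) (use x0 in blast)
  have qr: "(\<lambda>k. inverse (q (r1 k))) \<longlonglongrightarrow> 0"
    using LIMSEQ_subseq_LIMSEQ[OF qinf r1] by (simp add: o_def)
  have Hz: "(\<lambda>k. H (x0 (r1 k))) \<longlonglongrightarrow> H z"
    unfolding H_def by (intro tendsto_intros isCont_tendsto_compose[OF cF z] z)
  have dz: "(\<lambda>k. infdist (G (x0 (r1 k))) K) \<longlonglongrightarrow> infdist (G z) K"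
    by (intro tendsto_infdist isCont_tendsto_compose[OF cG z])
  have up: "infdist (G (x0 (r1 k))) K \<le> (F xbar - H (x0 (r1 k))) * inverse (q (r1 k))" for k
    using less[of "r1 k"] q[of "r1 k"] by (simp add: \<phi>_def field_simps)
  have "infdist (G z) K \<le> (F xbar - H z) * 0"
    by (rule LIMSEQ_le[OF dz tendsto_mult[OF tendsto_diff[OF tendsto_const Hz] qr]]) (use up in blast)
  then have "infdist (G z) K = 0" using infdist_nonneg[of "G z" K] by simp
  then have Gz: "G z \<in> K" using in_closed_iff_infdist_zero[OF K(1,3)] by blast
  have "H (x0 (r1 k)) \<le> F xbar" for k
    using less[of "r1 k"] mult_nonneg_nonneg[OF less_imp_le[OF q[of "r1 k"]] infdist_nonneg[of "G (x0 (r1 k))" K]]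
    unfolding \<phi>_def by linarith
  then have "H z \<le> F xbar" by (intro LIMSEQ_le_const2[OF Hz]) blast
  with bspec[OF locmin zc, THEN mp, OF Gz] have "(norm (z - xbar))\<^sup>2 \<le> 0" unfolding H_def by linarith
  then have zx: "z = xbar" by simp
  obtain N where N: "\<And>k. k \<ge> N \<Longrightarrow> dist (x0 (r1 k)) xbar < \<delta>"
    using tendstoD[OF z \<delta>] unfolding zx eventually_sequentially by blast
  define r2 where "r2 k = r1 (k + N)" for k
  define x where "x k = x0 (r2 k)" for k
  have xlim: "x \<longlonglongrightarrow> xbar"
    using LIMSEQ_ignore_initial_segment[OF z] unfolding zx r2_def x_def .
  have q2: "(\<lambda>k. inverse (q (r2 k))) \<longlonglongrightarrow> 0"
    using LIMSEQ_ignore_initial_segment[OF qr] unfolding r2_def .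
  have "\<exists>y \<in> penalty_multipliers K (q (r2 k)) (G (x k)). \<forall>v. (F' (x k) v + 2 * inner (x k - xbar) v) + inner y (G' (x k) v) = 0" for k
  proof (rule penalty_fermat_rule[OF K less_imp_le[OF q] open_ball])
    show "x k \<in> ball xbar \<delta>" using N[of "k + N"] by (simp add: x_def r2_def dist_commute)
    show "H (x k) + q (r2 k) * infdist (G (x k)) K \<le> H w + q (r2 k) * infdist (G w) K" if "w \<in> ball xbar \<delta>" for w
      using x0(2)[of w "r2 k"] that by (simp add: \<phi>_def x_def)
    have "((\<lambda>w. F w + inner (w - xbar) (w - xbar)) has_derivative (\<lambda>v. F' (x k) v + (inner (x k - xbar) v + inner v (x k - xbar)))) (at (x k))"
      by (intro has_derivative_add F(1) has_derivative_inner) (auto intro!: derivative_eq_intros)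
    then show "(H has_derivative (\<lambda>v. F' (x k) v + 2 * inner (x k - xbar) v)) (at (x k))"
      by (simp add: H_def[abs_def] power2_norm_eq_inner inner_commute)
    show "(G has_derivative (\<lambda>v. G' (x k) v)) (at (x k))" by (rule G(1))
  qed
  then have "\<exists>y. \<forall>k. y k \<in> penalty_multipliers K (q (r2 k)) (G (x k)) \<and>
      (\<forall>v. (F' (x k) v + 2 * inner (x k - xbar) v) + inner (y k) (G' (x k) v) = 0)"
    by (intro choice) blast
  then obtain y where y: "\<And>k. y k \<in> penalty_multipliers K (q (r2 k)) (G (x k))"
    and st: "\<And>k v. (F' (x k) v + 2 * inner (x k - xbar) v) + inner (y k) (G' (x k) v) = 0"
    by blast
  define \<eta> where "\<eta> k = inverse (q (r2 k)) *\<^sub>R y k" for k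
  have n1: "norm (\<eta> k) = 1" for k
    using norm_penalty_multipliers_infeasible[OF K(1,3) _ y[of k]] out q[of "r2 k"] by (simp add: \<eta>_def x_def)
  have \<eta>P: "\<eta> k \<in> penalty_multipliers K 1 (G (x k))" for k
  proof -
    have "inner (\<eta> k) (w - closest_point K (G (x k))) \<le> 0" if "w \<in> K" for w
      using y[of k] q[of "r2 k"] that mult_nonneg_nonpos[of "inverse (q (r2 k))"]
      by (simp add: \<eta>_def penalty_multipliers_def normal_cone_def)
    moreover have "inner (\<eta> k) (G (x k) - closest_point K (G (x k))) = infdist (G (x k)) K"
      using y[of k] q[of "r2 k"] by (simp add: \<eta>_def penalty_multipliers_def)
    ultimately show ?thesis
      using y[of k] n1[of k] by (simp add: penalty_multipliers_def normal_cone_def)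
  qed
  have "norm (\<eta> k) \<le> 1" for k using n1 by simp
  then obtain r3 l where r3: "strict_mono r3" and l: "(\<lambda>k. \<eta> (r3 k)) \<longlonglongrightarrow> l"
    by (rule bounded_sequence_subsequence)
  have x3: "(\<lambda>k. x (r3 k)) \<longlonglongrightarrow> xbar"
    using LIMSEQ_subseq_LIMSEQ[OF xlim r3] by (simp add: o_def)
  have q3: "(\<lambda>k. inverse (q (r2 (r3 k)))) \<longlonglongrightarrow> 0"
    using LIMSEQ_subseq_LIMSEQ[OF q2 r3] by (simp add: o_def)
  have "l \<in> penalty_multipliers K 1 (G xbar)"
    by (rule penalty_multipliers_closed_graph[OF K isCont_tendsto_compose[OF cG x3] l]) (rule \<eta>P)
  then have "l \<in> normal_cone K (G xbar)" by (rule penalty_multipliers_feasible[OF K(1) A])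
  moreover have "inner l (G' xbar v) = 0" for v
  proof -
    have "(\<lambda>k. inverse (q (r2 (r3 k))) * (F' (x (r3 k)) v + 2 * inner (x (r3 k) - xbar) v) + inner (\<eta> (r3 k)) (G' (x (r3 k)) v))
        \<longlonglongrightarrow> 0 * (F' xbar v + 2 * inner (xbar - xbar) v) + inner l (G' xbar v)"
      by (intro tendsto_add tendsto_mult tendsto_diff tendsto_inner tendsto_const l q3 x3
          tendsto_derivative_apply[OF F(2) x3] tendsto_derivative_apply[OF G(2) x3])
    moreover have "inverse (q (r2 (r3 k))) * (F' (x (r3 k)) v + 2 * inner (x (r3 k) - xbar) v) + inner (\<eta> (r3 k)) (G' (x (r3 k)) v) = 0" for k
    proof -
      have "inverse (q (r2 (r3 k))) * ((F' (x (r3 k)) v + 2 * inner (x (r3 k) - xbar) v) + inner (y (r3 k)) (G' (x (r3 k)) v)) = 0"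
        by (simp only: st mult_zero_right)
      then show ?thesis by (simp only: \<eta>_def inner_scaleR_left distrib_left)
    qed
    ultimately have "(\<lambda>k. 0) \<longlonglongrightarrow> 0 * (F' xbar v + 2 * inner (xbar - xbar) v) + inner l (G' xbar v)" by (simp only:)
    then show ?thesis using LIMSEQ_unique[OF tendsto_const] by fastforce
  qed
  ultimately have "l = 0" using cq by blast
  moreover have "norm l = 1"
    by (rule LIMSEQ_unique[OF tendsto_norm[OF l]]) (simp only: n1 tendsto_const)
  ultimately show False by simp
qed


section \<open>Straightening a cone reducible set\<close>

text \<open>A straightening of \<open>K\<close> at \<open>A\<close>: the diffeomorphism \<open>\<Phi>\<close> from \<open>U\<close> to \<open>V\<close>, with inverse \<open>\<Psi>\<close>, maps \<open>K\<close> to the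
  cone \<open>T\<close>.  Normalizing \<open>\<Phi>'(A)\<close> to the identity identifies tangent directions of \<open>K\<close> at \<open>A\<close> with
  those of \<open>T\<close> at \<open>0\<close> and multipliers at \<open>A\<close> with elements of the polar cone of \<open>T\<close>.\<close>
locale cone_chart =
  fixes K :: "'y::euclidean_space set" and A :: 'y and \<Phi> :: "'y \<Rightarrow> 'y"
    and \<Phi>' :: "'y \<Rightarrow> 'y \<Rightarrow>\<^sub>L 'y" and \<Phi>'' :: "'y \<Rightarrow>\<^sub>L ('y \<Rightarrow>\<^sub>L 'y)"
    and T U V :: "'y set" and \<Psi> :: "'y \<Rightarrow> 'y"
  assumes closed_K: "closed K" and convex_K: "convex K" and A_in: "A \<in> K"
    and open_U: "open U" and A_U: "A \<in> U" and open_V: "open V"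
    and \<Phi>_A: "\<Phi> A = 0" and \<Phi>'_A: "\<Phi>' A = id_blinfun"
    and \<Phi>_der: "\<And>B. B \<in> U \<Longrightarrow> (\<Phi> has_derivative \<Phi>' B) (at B)"
    and \<Phi>'_der: "(\<Phi>' has_derivative \<Phi>'') (at A)"
    and homeo: "homeomorphism U V \<Phi> \<Psi>"
    and \<Psi>_der: "\<And>c. c \<in> V \<Longrightarrow> (\<Psi> has_derivative inv (\<Phi>' (\<Psi> c))) (at c)"
    and \<Phi>'_bij: "\<And>c. c \<in> V \<Longrightarrow> bij (\<Phi>' (\<Psi> c))"
    and T: "closed T" "convex T" "cone T" "0 \<in> T"
    and K_T: "K \<inter> U = {B \<in> U. \<Phi> B \<in> T}"
begin

lemma \<Phi>_\<Psi>: "c \<in> V \<Longrightarrow> \<Phi> (\<Psi> c) = c"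
  by (rule homeomorphism_apply2[OF homeo])

lemma \<Psi>_\<Phi>: "B \<in> U \<Longrightarrow> \<Psi> (\<Phi> B) = B"
  by (rule homeomorphism_apply1[OF homeo])

lemma \<Phi>_V: "B \<in> U \<Longrightarrow> \<Phi> B \<in> V"
  using homeomorphism_image1[OF homeo] by blast

lemma \<Psi>_U: "c \<in> V \<Longrightarrow> \<Psi> c \<in> U"
  using homeomorphism_image2[OF homeo] by blast

lemma V_0: "0 \<in> V" and \<Psi>_0: "\<Psi> 0 = A"
  using \<Phi>_V[OF A_U] \<Psi>_\<Phi>[OF A_U] by (simp_all add: \<Phi>_A)

lemma \<Psi>_K: "c \<in> V \<Longrightarrow> c \<in> T \<Longrightarrow> \<Psi> c \<in> K"
proof -
  assume "c \<in> V" "c \<in> T"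
  then have "\<Psi> c \<in> {B \<in> U. \<Phi> B \<in> T}" by (simp add: \<Psi>_U \<Phi>_\<Psi>)
  then show "\<Psi> c \<in> K" by (simp flip: K_T)
qed

lemma \<Phi>_T: "B \<in> U \<Longrightarrow> B \<in> K \<Longrightarrow> \<Phi> B \<in> T"
proof -
  assume "B \<in> U" "B \<in> K"
  then have "B \<in> {B \<in> U. \<Phi> B \<in> T}" by (simp flip: K_T)
  then show "\<Phi> B \<in> T" by simp
qed

lemma scale_T: "c \<in> T \<Longrightarrow> a \<ge> 0 \<Longrightarrow> a *\<^sub>R c \<in> T"
  using T(3) by (simp add: cone_def)

definition reduced_normal :: "'y \<Rightarrow> 'y \<Rightarrow> 'y \<Rightarrow> bool" where
  "reduced_normal B y u \<longleftrightarrow> (\<forall>v. inner y v = inner u (\<Phi>' B v)) \<and> inner u (\<Phi> B) = 0 \<and> (\<forall>c\<in>T. inner u c \<le> 0)"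

text \<open>In the coordinates of the chart a normal vector \<open>y\<close> of \<open>K\<close> at \<open>B\<close> becomes a normal vector \<open>u\<close> of \<open>T\<close> at
  \<open>\<Phi> B\<close>: test \<open>y\<close> along the preimages of segments in \<open>T\<close> that start at \<open>\<Phi> B\<close>.  As \<open>T\<close> is a cone, normality
  splits into complementarity and membership in the polar cone.\<close>
lemma reduced_multiplier:
  assumes B: "B \<in> U" and y: "y \<in> normal_cone K B"
  shows "\<exists>u. reduced_normal B y u"
proof -
  have BK: "B \<in> K" using y by (simp add: normal_cone_def)
  let ?c = "\<Phi> B" and ?g' = "inv (\<Phi>' B)"
  have c: "?c \<in> V" "?c \<in> T" using \<Phi>_V[OF B] \<Phi>_T[OF B BK] by auto
  have der: "(\<Psi> has_derivative ?g') (at ?c)" and bij: "bij (\<Phi>' B)"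
    using \<Psi>_der[OF c(1)] \<Phi>'_bij[OF c(1)] by (simp_all add: \<Psi>_\<Phi>[OF B])
  have lg: "linear ?g'" using der has_derivative_bounded_linear bounded_linear.linear by blast
  define u where "u = adjoint ?g' y"
  have u: "inner u w = inner y (?g' w)" for w
    using adjoint_works[OF lg, of w y] by (simp add: u_def inner_commute)
  have 1: "inner y v = inner u (\<Phi>' B v)" for v
    using bij by (simp add: u bij_is_inj)
  have 2: "inner u (d - ?c) \<le> 0" if d: "d \<in> T" for d
  proof -
    define t where "t k = inverse (real (Suc k))" for k
    have t: "\<And>k. t k > 0" "t \<longlonglongrightarrow> 0"
      unfolding t_def using LIMSEQ_inverse_real_of_nat by simp_all
    define x where "x k = ?c + t k *\<^sub>R (d - ?c)" for k
    have dx: "(x k - ?c) /\<^sub>R t k = d - ?c" for k using t(1)[of k] by (simp add: x_def)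
    have xlim: "x \<longlonglongrightarrow> ?c"
      unfolding x_def using tendsto_add[OF tendsto_const[of ?c] tendsto_scaleR[OF t(2) tendsto_const[of "d - ?c"]]] by simp
    have "(\<lambda>k. (x k - ?c) /\<^sub>R t k) \<longlonglongrightarrow> d - ?c" by (simp only: dx tendsto_const)
    then have lim: "(\<lambda>k. inner y ((\<Psi> (x k) - \<Psi> ?c) /\<^sub>R t k)) \<longlonglongrightarrow> inner y (?g' (d - ?c))"
      by (intro tendsto_inner tendsto_const derivative_along_sequence[OF der t])
    have xT: "x k \<in> T" for k
    proof -
      have "x k = (1 - t k) *\<^sub>R ?c + t k *\<^sub>R d" by (simp add: x_def algebra_simps)
      moreover have "t k \<le> 1" by (simp add: t_def inverse_le_1_iff)
      ultimately show ?thesis using convexD_alt[OF T(2) c(2) d, of "t k"] t(1)[of k] by simp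
    qed
    have "\<forall>\<^sub>F k in sequentially. x k \<in> V" by (rule topological_tendstoD[OF xlim open_V c(1)])
    then have "\<forall>\<^sub>F k in sequentially. inner y ((\<Psi> (x k) - \<Psi> ?c) /\<^sub>R t k) \<le> 0"
    proof eventually_elim
      case (elim k)
      have "inner y (\<Psi> (x k) - \<Psi> ?c) \<le> 0"
        using y \<Psi>_K[OF elim xT] by (simp add: normal_cone_def \<Psi>_\<Phi>[OF B])
      then show ?case using t(1)[of k] by (simp add: mult_nonneg_nonpos)
    qed
    then show ?thesis unfolding u by (rule tendsto_upperbound[OF lim]) simp
  qed
  have 3: "inner u ?c = 0"
    using 2[OF T(4)] 2[OF scale_T[OF c(2), of 2]] by (simp add: inner_diff_right scaleR_2 inner_add_right)
  have "inner u d \<le> 0" if "d \<in> T" for d using 2[OF that] 3 by (simp add: inner_diff_right)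
  with 1 3 show ?thesis unfolding reduced_normal_def by (intro exI[of _ u] conjI allI ballI)
qed

lemma sequence_to_A:
  assumes t: "\<And>k. t k > 0" "t \<longlonglongrightarrow> (0::real)" and B: "(\<lambda>k. (B k - A) /\<^sub>R t k) \<longlonglongrightarrow> \<beta>"
  shows "B \<longlonglongrightarrow> A"
proof -
  have "(\<lambda>k. A + t k *\<^sub>R ((B k - A) /\<^sub>R t k)) \<longlonglongrightarrow> A + 0 *\<^sub>R \<beta>"
    by (rule tendsto_add[OF tendsto_const tendsto_scaleR[OF t(2) B]])
  moreover have "A + t k *\<^sub>R ((B k - A) /\<^sub>R t k) = B k" for k using t(1)[of k] by simp
  ultimately show ?thesis by simp
qed

lemma chart_curve:
  assumes h: "h \<in> T"
  shows "\<exists>s. (\<forall>k. s k > 0) \<and> s \<longlonglongrightarrow> 0 \<and> (\<forall>k. s k *\<^sub>R h \<in> V) \<and> (\<forall>k. \<Psi> (s k *\<^sub>R h) \<in> K) \<and>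
    (\<lambda>k. (\<Psi> (s k *\<^sub>R h) - A) /\<^sub>R s k) \<longlonglongrightarrow> h"
proof -
  define t where "t k = inverse (real (Suc k))" for k
  have t: "\<And>k. t k > 0" "t \<longlonglongrightarrow> 0"
    unfolding t_def using LIMSEQ_inverse_real_of_nat by simp_all
  have "(\<lambda>k. t k *\<^sub>R h) \<longlonglongrightarrow> 0" using tendsto_scaleR[OF t(2) tendsto_const[of h]] by simp
  then have "\<forall>\<^sub>F k in sequentially. t k *\<^sub>R h \<in> V" by (rule topological_tendstoD[OF _ open_V V_0])
  then obtain N where N: "\<And>k. k \<ge> N \<Longrightarrow> t k *\<^sub>R h \<in> V" unfolding eventually_sequentially by blast
  define s where "s k = t (k + N)" for k
  have s: "\<And>k. s k > 0" "s \<longlonglongrightarrow> 0" unfolding s_def using t LIMSEQ_ignore_initial_segment[OF t(2)] by simp_all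
  have "(\<lambda>k. (s k *\<^sub>R h - 0) /\<^sub>R s k) \<longlonglongrightarrow> h"
  proof -
    have "(s k *\<^sub>R h - 0) /\<^sub>R s k = h" for k using s(1)[of k] by simp
    then show ?thesis by (simp only: tendsto_const)
  qed
  then have "(\<lambda>k. (\<Psi> (s k *\<^sub>R h) - \<Psi> 0) /\<^sub>R s k) \<longlonglongrightarrow> inv (\<Phi>' (\<Psi> 0)) h"
    by (rule derivative_along_sequence[OF \<Psi>_der[OF V_0] s])
  moreover have "inv (blinfun_apply id_blinfun) = (\<lambda>x. x :: 'y)" by (simp add: inv_equality)
  ultimately have lim: "(\<lambda>k. (\<Psi> (s k *\<^sub>R h) - A) /\<^sub>R s k) \<longlonglongrightarrow> h" by (simp add: \<Psi>_0 \<Phi>'_A)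
  have sV: "s k *\<^sub>R h \<in> V" for k using N by (simp add: s_def)
  have "\<Psi> (s k *\<^sub>R h) \<in> K" for k
    using \<Psi>_K[OF sV] scale_T[OF h] s(1)[of k] by simp
  with s sV lim show ?thesis by (intro exI[of _ s] conjI allI)
qed

lemma tangent_cone_eq: "tangent_cone K A = T"
proof (intro set_eqI iffI)
  fix h assume "h \<in> tangent_cone K A"
  then obtain zs t where z: "\<And>k. zs k \<in> K" "zs \<longlonglongrightarrow> A" and t: "\<And>k. 0 < t k" "t \<longlonglongrightarrow> 0"
    and h: "(\<lambda>k. (zs k - A) /\<^sub>R t k) \<longlonglongrightarrow> h"
    unfolding tangent_cone_def by blast
  have "(\<lambda>k. (\<Phi> (zs k) - \<Phi> A) /\<^sub>R t k) \<longlonglongrightarrow> \<Phi>' A h"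
    by (rule derivative_along_sequence[OF \<Phi>_der[OF A_U] t h])
  then have lim: "(\<lambda>k. \<Phi> (zs k) /\<^sub>R t k) \<longlonglongrightarrow> h" by (simp add: \<Phi>_A \<Phi>'_A)
  have "\<forall>\<^sub>F k in sequentially. zs k \<in> U" by (rule topological_tendstoD[OF z(2) open_U A_U])
  then have "\<forall>\<^sub>F k in sequentially. \<Phi> (zs k) /\<^sub>R t k \<in> T"
  proof eventually_elim
    case (elim k)
    then show ?case using scale_T[OF \<Phi>_T[OF elim z(1)]] t(1)[of k] by simp
  qed
  then show "h \<in> T" using Lim_in_closed_set[OF T(1) _ _ lim] by simp
next
  fix h assume h: "h \<in> T"
  obtain s where s: "\<forall>k. s k > 0" "s \<longlonglongrightarrow> 0" and sK: "\<forall>k. \<Psi> (s k *\<^sub>R h) \<in> K"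
    and lim: "(\<lambda>k. (\<Psi> (s k *\<^sub>R h) - A) /\<^sub>R s k) \<longlonglongrightarrow> h"
    using chart_curve[OF h] by (elim exE conjE) (rule that)
  have "(\<lambda>k. \<Psi> (s k *\<^sub>R h)) \<longlonglongrightarrow> A" by (rule sequence_to_A[OF _ s(2) lim]) (use s(1) in blast)
  then show "h \<in> tangent_cone K A"
    unfolding tangent_cone_def mem_Collect_eq using s sK lim
    by (intro exI[of _ "\<lambda>k. \<Psi> (s k *\<^sub>R h)"] exI[of _ s] conjI)
qed

lemma \<Phi>_taylor:
  assumes "\<And>k. t k > 0" "t \<longlonglongrightarrow> (0::real)" and "(\<lambda>k. (B k - A) /\<^sub>R t k) \<longlonglongrightarrow> \<beta>"
  shows "(\<lambda>k. (\<Phi> (B k) - (B k - A)) /\<^sub>R (t k)\<^sup>2) \<longlonglongrightarrow> (1/2) *\<^sub>R \<Phi>'' \<beta> \<beta>"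
  using second_order_taylor_along_sequence[OF open_U A_U \<Phi>_der \<Phi>'_der assms]
  by (simp add: \<Phi>_A \<Phi>'_A)

lemma normal_cone_imp_polar:
  assumes "y \<in> normal_cone K A" and "c \<in> T"
  shows "inner y c \<le> 0"
proof -
  obtain u where u: "\<forall>v. inner y v = inner u (\<Phi>' A v)" "\<forall>c\<in>T. inner u c \<le> 0"
    using reduced_multiplier[OF A_U assms(1)] unfolding reduced_normal_def by (elim exE conjE) (rule that)
  then show ?thesis using assms(2) by (simp add: \<Phi>'_A)
qed

text \<open>Expands \<open><y, \<Phi> B> \<le> 0\<close>, valid for \<open>y\<close> in the polar of \<open>T\<close> and \<open>B\<close> in \<open>K\<close>, to second order at \<open>A\<close>.\<close>
lemma fixed_multiplier_second_order_bound:
  assumes y: "y \<in> normal_cone K A" and BK: "\<And>k. B k \<in> K"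
    and t: "\<And>k. t k > 0" "t \<longlonglongrightarrow> (0::real)" and B: "(\<lambda>k. (B k - A) /\<^sub>R t k) \<longlonglongrightarrow> \<beta>"
  shows "\<exists>r. r \<longlonglongrightarrow> - (1/2) * inner y (\<Phi>'' \<beta> \<beta>) \<and> (\<forall>\<^sub>F k in sequentially. inner y (B k - A) / (t k)\<^sup>2 \<le> r k)"
proof -
  define r where "r k = - inner y ((\<Phi> (B k) - (B k - A)) /\<^sub>R (t k)\<^sup>2)" for k
  have "r \<longlonglongrightarrow> - inner y ((1/2) *\<^sub>R \<Phi>'' \<beta> \<beta>)"
    unfolding r_def by (intro tendsto_minus tendsto_inner tendsto_const \<Phi>_taylor[OF t B])
  moreover have "\<forall>\<^sub>F k in sequentially. B k \<in> U"
    by (rule topological_tendstoD[OF sequence_to_A[OF t B] open_U A_U])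
  then have "\<forall>\<^sub>F k in sequentially. inner y (B k - A) / (t k)\<^sup>2 \<le> r k"
  proof eventually_elim
    case (elim k)
    have "inner y (\<Phi> (B k)) \<le> 0" by (rule normal_cone_imp_polar[OF y \<Phi>_T[OF elim BK]])
    then have "inner y (\<Phi> (B k)) / (t k)\<^sup>2 \<le> 0" by (simp add: divide_nonpos_nonneg)
    then show ?case by (simp add: r_def inner_diff_right divide_inverse algebra_simps)
  qed
  ultimately show ?thesis by (intro exI[of _ r]) simp
qed

text \<open>Since \<open>\<Phi>'(B k)\<close> tends to the identity, the reduced multipliers converge to the limit of the
  original ones.\<close>
lemma reduced_multiplier_sequence:
  assumes BK: "\<And>k. y k \<in> normal_cone K (B k)" and B: "B \<longlonglongrightarrow> A" and y: "y \<longlonglongrightarrow> y0"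
  shows "\<exists>u. u \<longlonglongrightarrow> y0 \<and>
    (\<forall>\<^sub>F k in sequentially. reduced_normal (B k) (y k) (u k))"
proof -
  let ?Q = "\<lambda>k. reduced_normal (B k) (y k)"
  have "\<exists>u. ?Q k u" if "B k \<in> U" for k
    by (rule reduced_multiplier[OF that BK])
  then have "\<forall>k. \<exists>u. B k \<in> U \<longrightarrow> ?Q k u" by simp
  from choice[OF this] obtain u where u: "\<And>k. B k \<in> U \<Longrightarrow> ?Q k (u k)" by blast
  have evU: "\<forall>\<^sub>F k in sequentially. B k \<in> U" by (rule topological_tendstoD[OF B open_U A_U])
  define e where "e k = norm (\<Phi>' (B k) - id_blinfun)" for k
  have "(\<lambda>k. norm (\<Phi>' (B k) - \<Phi>' A)) \<longlonglongrightarrow> norm (\<Phi>' A - \<Phi>' A)"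
    by (intro tendsto_norm tendsto_diff tendsto_const isCont_tendsto_compose[OF has_derivative_continuous[OF \<Phi>'_der] B])
  then have e: "e \<longlonglongrightarrow> 0" by (simp add: e_def[abs_def] \<Phi>'_A)
  have eh: "\<forall>\<^sub>F k in sequentially. e k < 1/2" using order_tendstoD(2)[OF e, of "1/2"] by simp
  have "\<forall>\<^sub>F k in sequentially. norm (y k - u k) \<le> 2 * e k * norm (y k)"
    using evU eh
  proof eventually_elim
    case (elim k)
    let ?w = "y k - u k"
    have e0: "e k \<ge> 0" by (simp add: e_def)
    have "inner ?w ?w = inner (u k) ((\<Phi>' (B k) - id_blinfun) ?w)"
      using u[OF elim(1)] by (simp add: reduced_normal_def inner_diff_left blinfun.diff_left blinfun.diff_right inner_diff_right)
    also have "\<dots> \<le> norm (u k) * norm ((\<Phi>' (B k) - id_blinfun) ?w)" by (rule norm_cauchy_schwarz)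
    also have "\<dots> \<le> norm (u k) * (e k * norm ?w)"
      unfolding e_def by (intro mult_left_mono norm_blinfun) simp
    finally have "norm ?w * norm ?w \<le> (e k * norm (u k)) * norm ?w"
      by (simp add: dot_square_norm power2_eq_square mult_ac)
    then have 1: "norm ?w \<le> e k * norm (u k)"
      by (cases "norm ?w = 0") (use e0 in \<open>auto simp: mult_le_cancel_right\<close>)
    have "norm (u k) \<le> norm (y k) + norm ?w"
      using norm_triangle_ineq4[of "y k" ?w] by simp
    then have "e k * norm (u k) \<le> e k * norm (y k) + e k * norm ?w"
      using mult_left_mono[OF _ e0] by (metis distrib_left)
    also have "\<dots> \<le> e k * norm (y k) + (1/2) * norm ?w"
      using mult_right_mono[of "e k" "1/2" "norm ?w"] elim(2) by simp
    finally show ?case using 1 by simp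
  qed
  moreover have "(\<lambda>k. 2 * e k * norm (y k)) \<longlonglongrightarrow> 2 * 0 * norm y0"
    by (intro tendsto_mult tendsto_const e tendsto_norm y)
  then have z: "(\<lambda>k. 2 * e k * norm (y k)) \<longlonglongrightarrow> 0" by simp
  ultimately have "(\<lambda>k. y k - u k) \<longlonglongrightarrow> 0" by (rule Lim_null_comparison)
  then have "(\<lambda>k. y k - (y k - u k)) \<longlonglongrightarrow> y0 - 0" by (rule tendsto_diff[OF y])
  then have "u \<longlonglongrightarrow> y0" by simp
  moreover have "\<forall>\<^sub>F k in sequentially. ?Q k (u k)"
    using evU by eventually_elim (rule u)
  ultimately show ?thesis by (intro exI[of _ u] conjI)
qed

text \<open>With the reduced multiplier \<open>u\<close> of \<open>y\<close>, complementarity gives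
  \<open><y, B - A> = <u, \<Phi>'(B)(B - A) - \<Phi> B>\<close>, and the vector on the right is \<open>1/2 \<Phi>''(B - A)(B - A)\<close> up to
  second order.  With \<open>y\<close> moving along with
  \<open>B\<close> the curvature term thus has the sign opposite to the one for a fixed multiplier.\<close>
lemma multiplier_second_order_limit:
  assumes yN: "\<And>k. y k \<in> normal_cone K (B k)" and y: "y \<longlonglongrightarrow> y0"
    and t: "\<And>k. t k > 0" "t \<longlonglongrightarrow> (0::real)" and B: "(\<lambda>k. (B k - A) /\<^sub>R t k) \<longlonglongrightarrow> \<beta>"
  shows "(\<lambda>k. inner (y k) (B k - A) / (t k)\<^sup>2) \<longlonglongrightarrow> (1/2) * inner y0 (\<Phi>'' \<beta> \<beta>)"
proof -
  obtain u where u: "u \<longlonglongrightarrow> y0"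
    and uQ: "\<forall>\<^sub>F k in sequentially. reduced_normal (B k) (y k) (u k)"
    using reduced_multiplier_sequence[OF yN sequence_to_A[OF t B] y] by (elim exE conjE) (rule that)
  have "(\<lambda>k. (\<Phi>' (B k) - \<Phi>' A) /\<^sub>R t k) \<longlonglongrightarrow> \<Phi>'' \<beta>"
    by (rule derivative_along_sequence[OF \<Phi>'_der t B])
  then have "(\<lambda>k. inner (u k) (((\<Phi>' (B k) - \<Phi>' A) /\<^sub>R t k) ((B k - A) /\<^sub>R t k) - (\<Phi> (B k) - (B k - A)) /\<^sub>R (t k)\<^sup>2))
      \<longlonglongrightarrow> inner y0 (\<Phi>'' \<beta> \<beta> - (1/2) *\<^sub>R \<Phi>'' \<beta> \<beta>)"
    by (intro tendsto_inner tendsto_diff u blinfun.tendsto B \<Phi>_taylor[OF t B])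
  moreover have "inner y0 (\<Phi>'' \<beta> \<beta> - (1/2) *\<^sub>R \<Phi>'' \<beta> \<beta>) = (1/2) * inner y0 (\<Phi>'' \<beta> \<beta>)"
    by (simp add: inner_diff_right)
  moreover have "\<forall>\<^sub>F k in sequentially.
      inner (u k) (((\<Phi>' (B k) - \<Phi>' A) /\<^sub>R t k) ((B k - A) /\<^sub>R t k) - (\<Phi> (B k) - (B k - A)) /\<^sub>R (t k)\<^sup>2)
      = inner (y k) (B k - A) / (t k)\<^sup>2"
    using uQ
  proof eventually_elim
    case (elim k)
    then have 1: "inner (u k) (\<Phi>' (B k) (B k - A) - (B k - A) - (\<Phi> (B k) - (B k - A))) = inner (y k) (B k - A)"
      by (simp add: reduced_normal_def inner_diff_right blinfun.diff_right)
    have 2: "((\<Phi>' (B k) - \<Phi>' A) /\<^sub>R t k) ((B k - A) /\<^sub>R t k) = (\<Phi>' (B k) (B k - A) - (B k - A)) /\<^sub>R (t k)\<^sup>2"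
      by (simp only: \<Phi>'_A blinfun.scaleR_left blinfun.scaleR_right blinfun.diff_left blinfun_apply_id_blinfun
          scaleR_scaleR power2_eq_square inverse_mult_distrib)
    show ?case
      by (simp only: 2 1 inner_scaleR_right divide_inverse mult.commute flip: scaleR_diff_right)
  qed
  ultimately show ?thesis by (simp add: filterlim_cong[OF refl refl])
qed

text \<open>The polar inequality \<open><u, h> \<le> 0\<close> for the reduced multiplier \<open>u\<close> of \<open>y\<close>, expressed in terms of
  \<open><y, h> = <u, \<Phi>'(B) h>\<close>.\<close>
lemma multiplier_first_order_bound:
  assumes h: "h \<in> T" and yN: "\<And>k. y k \<in> normal_cone K (B k)" and y: "y \<longlonglongrightarrow> y0"
    and t: "\<And>k. t k > 0" "t \<longlonglongrightarrow> (0::real)" and B: "(\<lambda>k. (B k - A) /\<^sub>R t k) \<longlonglongrightarrow> \<beta>"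
  shows "\<exists>r. r \<longlonglongrightarrow> inner y0 (\<Phi>'' \<beta> h) \<and> (\<forall>\<^sub>F k in sequentially. inner (y k) h / t k \<le> r k)"
proof -
  obtain u where u: "u \<longlonglongrightarrow> y0"
    and uQ: "\<forall>\<^sub>F k in sequentially. reduced_normal (B k) (y k) (u k)"
    using reduced_multiplier_sequence[OF yN sequence_to_A[OF t B] y] by (elim exE conjE) (rule that)
  define r where "r k = inner (u k) (((\<Phi>' (B k) - \<Phi>' A) /\<^sub>R t k) h)" for k
  have "r \<longlonglongrightarrow> inner y0 (\<Phi>'' \<beta> h)"
    unfolding r_def
    by (intro tendsto_inner u blinfun.tendsto tendsto_const derivative_along_sequence[OF \<Phi>'_der t B])
  moreover have "\<forall>\<^sub>F k in sequentially. inner (y k) h / t k \<le> r k"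
    using uQ
  proof eventually_elim
    case (elim k)
    then have "inner (y k) h \<le> inner (u k) (\<Phi>' (B k) h - h)"
      using h by (simp add: reduced_normal_def inner_diff_right)
    then have "inner (y k) h / t k \<le> inner (u k) (\<Phi>' (B k) h - h) / t k"
      using t(1)[of k] by (simp add: divide_right_mono)
    then show ?case
      by (simp add: r_def \<Phi>'_A blinfun.scaleR_left blinfun.diff_left divide_inverse mult.commute)
  qed
  ultimately show ?thesis by blast
qed

text \<open>The curve \<open>t \<mapsto> \<Psi> (t h)\<close> runs in \<open>K\<close> with velocity \<open>h\<close> and acceleration \<open>- \<Phi>''(h) h\<close> at \<open>A\<close>.\<close>
lemma second_order_tangent:
  assumes h: "h \<in> T"
  shows "- \<Phi>'' h h \<in> second_order_tangent_set K A h"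
proof -
  obtain s where s0: "\<forall>k. s k > 0" and s_lim: "s \<longlonglongrightarrow> 0" and sV0: "\<forall>k. s k *\<^sub>R h \<in> V"
    and lim: "(\<lambda>k. (\<Psi> (s k *\<^sub>R h) - A) /\<^sub>R s k) \<longlonglongrightarrow> h"
    using chart_curve[OF h] by (elim exE conjE) (rule that)
  have s: "\<And>k. s k > 0" "s \<longlonglongrightarrow> 0" and sV: "\<And>k. s k *\<^sub>R h \<in> V"
    using s0 s_lim sV0 by simp_all
  define q where "q k = (\<Phi> (\<Psi> (s k *\<^sub>R h)) - (\<Psi> (s k *\<^sub>R h) - A)) /\<^sub>R (s k)\<^sup>2 + (1/2) *\<^sub>R (- \<Phi>'' h h)" for k
  have "q \<longlonglongrightarrow> (1/2) *\<^sub>R \<Phi>'' h h + (1/2) *\<^sub>R (- \<Phi>'' h h)"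
    unfolding q_def by (rule tendsto_add[OF \<Phi>_taylor[OF s lim] tendsto_const])
  then have q0: "(\<lambda>k. norm (q k)) \<longlonglongrightarrow> 0" using tendsto_norm_zero by fastforce
  let ?p = "\<lambda>k. A + s k *\<^sub>R h + ((s k)\<^sup>2 / 2) *\<^sub>R (- \<Phi>'' h h)"
  have q: "infdist (?p k) K / (s k)\<^sup>2 \<le> norm (q k)" for k
  proof -
    have s2: "(s k)\<^sup>2 > 0" using s(1)[of k] by simp
    have "\<Psi> (s k *\<^sub>R h) \<in> K" using \<Psi>_K[OF sV] scale_T[OF h] s(1)[of k] by simp
    then have "infdist (?p k) K \<le> norm (?p k - \<Psi> (s k *\<^sub>R h))"
      unfolding dist_norm[symmetric] by (rule infdist_le)
    also have "?p k - \<Psi> (s k *\<^sub>R h) = (s k)\<^sup>2 *\<^sub>R q k"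
      unfolding q_def \<Phi>_\<Psi>[OF sV] scaleR_add_right scaleR_scaleR
      using s2 by (simp add: algebra_simps)
    also have "norm ((s k)\<^sup>2 *\<^sub>R q k) = norm (q k) * (s k)\<^sup>2" by simp
    finally show ?thesis using s2 by (simp only: pos_divide_le_eq)
  qed
  have "(\<lambda>k. infdist (?p k) K / (s k)\<^sup>2) \<longlonglongrightarrow> 0"
    by (rule Lim_null_comparison[OF _ q0]) (use q in \<open>simp add: infdist_nonneg\<close>)
  then have "(\<lambda>k. infdist (?p k) K) \<in> o(\<lambda>k. (s k)\<^sup>2)"
    by (rule smalloI_tendsto) (use s(1) in \<open>simp add: less_imp_neq[symmetric]\<close>)
  with s show ?thesis unfolding second_order_tangent_set_def mem_Collect_eq
    by (intro exI[of _ s] conjI allI)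
qed

end

text \<open>Let \<open>D\<close> be the derivative of the reducing map \<open>\<Xi>\<close> at \<open>A\<close> and \<open>R\<close> a linear right inverse of \<open>D\<close> on its range
  \<open>Z\<close>.  The map \<open>\<Phi> B = (B - A) + R (\<Xi> B - D (B - A))\<close> satisfies \<open>D (\<Phi> B) = \<Xi> B\<close>, as \<open>\<Xi>\<close> takes its values in
  \<open>Z\<close>; so \<open>\<Xi> B \<in> Q\<close> means that \<open>\<Phi> B\<close> lies in the preimage of \<open>Q\<close> under \<open>D\<close>.  The inverse function theorem
  applies because \<open>\<Phi>'(A)\<close> is the identity.\<close>
lemma C2_cone_reducible_chart:
  fixes K :: "'y::euclidean_space set"
  assumes K: "closed K" "convex K" and red: "C2_cone_reducible K" and A: "A \<in> K"
  shows "\<exists>\<Phi> \<Phi>' \<Phi>'' T U V \<Psi>. cone_chart K A \<Phi> \<Phi>' \<Phi>'' T U V \<Psi>"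
proof -
  obtain W Z Q :: "'y set" and \<Xi> :: "'y \<Rightarrow> 'y" where W: "open W" "A \<in> W" and Z: "subspace Z"
    and Q: "Q \<subseteq> Z" "cone Q" "convex Q" "closed Q" "pointed Q"
    and \<Xi>: "\<Xi> ` W \<subseteq> Z" "twice_cont_diff_on \<Xi> W" "\<Xi> A = 0" "range (frechet_derivative \<Xi> (at A)) = Z"
    and KW: "K \<inter> W = {B \<in> W. \<Xi> B \<in> Q}"
    using red[unfolded C2_cone_reducible_def, rule_format, OF A] by (elim exE conjE) (rule that, assumption+)
  obtain \<Xi>' \<Xi>'' where d: "\<And>x. x \<in> W \<Longrightarrow> (\<Xi> has_derivative blinfun_apply (\<Xi>' x)) (at x)"
    "\<And>x. x \<in> W \<Longrightarrow> (\<Xi>' has_derivative blinfun_apply (\<Xi>'' x)) (at x)"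
    using \<Xi>(2) unfolding twice_cont_diff_on_def by blast
  define D where "D = \<Xi>' A"
  have rD: "range D = Z" using \<Xi>(4) frechet_derivative_at[OF d(1)[OF W(2)]] by (simp add: D_def)
  have "linear D" by (rule bounded_linear.linear[OF blinfun.bounded_linear_right])
  from linear_exists_right_inverse_on[OF this subspace_UNIV]
  obtain R0 where R0: "linear R0" "\<And>v. v \<in> Z \<Longrightarrow> D (R0 v) = v" using rD by blast
  define R where "R = Blinfun R0"
  have R: "D (R v) = v" if "v \<in> Z" for v
    using R0 that by (simp add: R_def bounded_linear_Blinfun_apply linear_conv_bounded_linear)
  define \<Phi> where "\<Phi> B = (B - A) + R (\<Xi> B - D (B - A))" for B
  define \<Phi>' where "\<Phi>' B = id_blinfun + (R o\<^sub>L (\<Xi>' B - D))" for B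
  have "bounded_linear (\<lambda>v. R o\<^sub>L \<Xi>'' A v)"
    by (rule bounded_linear_compose[OF bounded_bilinear.bounded_linear_right[OF bounded_bilinear_blinfun_compose] blinfun.bounded_linear_right])
  then obtain \<Phi>'' where \<Phi>'': "blinfun_apply \<Phi>'' = (\<lambda>v. R o\<^sub>L \<Xi>'' A v)"
    using bounded_linear_Blinfun_apply by blast
  have der: "(\<Phi> has_derivative \<Phi>' B) (at B)" if "B \<in> W" for B
  proof -
    have "((\<lambda>B. (B - A) + R (\<Xi> B - D (B - A))) has_derivative (\<lambda>v. (v - 0) + R (\<Xi>' B v - D (v - 0)))) (at B)"
      by (intro has_derivative_add has_derivative_diff has_derivative_ident has_derivative_const
          bounded_linear.has_derivative[OF blinfun.bounded_linear_right] d(1)[OF that])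
    moreover have "(\<lambda>v. (v - 0) + R (\<Xi>' B v - D (v - 0))) = blinfun_apply (\<Phi>' B)"
      by (simp add: \<Phi>'_def fun_eq_iff blinfun.add_left blinfun.diff_left)
    ultimately show ?thesis unfolding \<Phi>_def by simp
  qed
  have der': "(\<Phi>' has_derivative (\<lambda>v. R o\<^sub>L \<Xi>'' B v)) (at B)" if "B \<in> W" for B
  proof -
    have "((\<lambda>B. id_blinfun + (R o\<^sub>L (\<Xi>' B - D))) has_derivative (\<lambda>v. 0 + (R o\<^sub>L (\<Xi>'' B v - 0)))) (at B)"
      by (intro has_derivative_add has_derivative_diff has_derivative_const
          bounded_linear.has_derivative[OF bounded_bilinear.bounded_linear_right[OF bounded_bilinear_blinfun_compose]] d(2)[OF that])
    then show ?thesis unfolding \<Phi>'_def by simp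
  qed
  have \<Phi>'A: "\<Phi>' A = id_blinfun"
    by (simp add: \<Phi>'_def D_def bounded_bilinear.zero_right[OF bounded_bilinear_blinfun_compose])
  have \<Phi>A: "\<Phi> A = 0" by (simp add: \<Phi>_def \<Xi>(3))
  have cont: "continuous_on W \<Phi>'"
    using der' has_derivative_continuous continuous_at_imp_continuous_on by blast
  have inv: "id_blinfun o\<^sub>L \<Phi>' A = id_blinfun" by (simp add: \<Phi>'A blinfun_eqI)
  obtain U V \<Psi> g' where U: "open U" "U \<subseteq> W" "A \<in> U" "open V" "\<Phi> A \<in> V" "homeomorphism U V \<Phi> \<Psi>"
    and g: "\<And>c. c \<in> V \<Longrightarrow> (\<Psi> has_derivative g' c) (at c)"
      "\<And>c. c \<in> V \<Longrightarrow> g' c = inv (blinfun_apply (\<Phi>' (\<Psi> c)))"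
      "\<And>c. c \<in> V \<Longrightarrow> bij (blinfun_apply (\<Phi>' (\<Psi> c)))"
    using inverse_function_theorem[OF W(1) der cont W(2) inv] by metis
  define T where "T = {d. D d \<in> Q}"
  have ZW: "\<Xi> B \<in> Z" if "B \<in> W" for B using \<Xi>(1) that by blast
  have D\<Phi>: "D (\<Phi> B) = \<Xi> B" if "B \<in> W" for B
  proof -
    have "\<Xi> B - D (B - A) \<in> Z" using ZW[OF that] rD Z by (blast intro: subspace_diff)
    then show ?thesis by (simp add: \<Phi>_def blinfun.add_right R)
  qed
  have KW': "B \<in> K \<longleftrightarrow> \<Xi> B \<in> Q" if "B \<in> W" for B
  proof -
    have "B \<in> K \<inter> W \<longleftrightarrow> B \<in> {B \<in> W. \<Xi> B \<in> Q}" by (simp only: KW)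
    with that show ?thesis by simp
  qed
  have "0 \<in> Q" using KW'[OF W(2)] A by (simp add: \<Xi>(3))
  have "closed (D -` Q)"
    by (rule closed_vimage[OF Q(4)]) (intro continuous_intros)
  moreover have "convex (D -` Q)"
    by (rule convex_linear_vimage[OF \<open>linear D\<close> Q(3)])
  moreover have "D -` Q = T" by (auto simp: T_def)
  ultimately have "closed T" "convex T" by simp_all
  moreover have "cone T" using Q(2) by (simp add: T_def cone_def blinfun.scaleR_right)
  moreover have "0 \<in> T" using \<open>0 \<in> Q\<close> by (simp add: T_def)
  moreover have "K \<inter> U = {B \<in> U. \<Phi> B \<in> T}"
    using U(2) by (auto simp: T_def subset_iff D\<Phi> KW')
  moreover have "(\<Phi>' has_derivative \<Phi>'') (at A)" using der'[OF W(2)] by (simp add: \<Phi>'')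
  ultimately have "cone_chart K A \<Phi> \<Phi>' \<Phi>'' T U V \<Psi>"
    using K A U g der \<Phi>A \<Phi>'A by unfold_locales (auto simp: subset_iff)
  then show ?thesis by blast
qed


section \<open>Calmness from the strict qualification and the second order condition\<close>

locale kkt_chart = cone_chart K "G xbar" \<Phi> \<Phi>' \<Phi>'' T U V \<Psi>
  for K :: "'y::euclidean_space set" and G :: "'x::euclidean_space \<Rightarrow> 'y" and xbar :: 'x
    and \<Phi> \<Phi>' \<Phi>'' T U V \<Psi> +
  fixes f :: "'x \<Rightarrow> real" and f' :: "'x \<Rightarrow> 'x \<Rightarrow>\<^sub>L real" and f'' :: "'x \<Rightarrow>\<^sub>L ('x \<Rightarrow>\<^sub>L real)"
    and G' :: "'x \<Rightarrow> 'x \<Rightarrow>\<^sub>L 'y" and G'' :: "'x \<Rightarrow>\<^sub>L ('x \<Rightarrow>\<^sub>L 'y)" and ybar :: 'y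
  assumes f_der: "\<And>x. (f has_derivative f' x) (at x)" and f'_der: "(f' has_derivative f'') (at xbar)"
    and G_der: "\<And>x. (G has_derivative G' x) (at x)" and G'_der: "(G' has_derivative G'') (at xbar)"
    and ybar_N: "ybar \<in> normal_cone K (G xbar)"
    and stationary: "\<And>v. f' xbar v + inner ybar (G' xbar v) = 0"
begin

text \<open>The Hessian at \<open>xbar\<close> of the Lagrangian of the straightened problem of minimizing \<open>f x\<close> subject to
  \<open>\<Phi> (G x) \<in> T\<close>.\<close>
definition reduced_hessian :: "'x \<Rightarrow> 'x \<Rightarrow> real" where
  "reduced_hessian s s' = f'' s s' + inner ybar (G'' s s') + inner ybar (\<Phi>'' (G' xbar s) (G' xbar s'))"

definition KKT :: "'x \<Rightarrow> 'y \<Rightarrow> 'x \<Rightarrow> 'y \<Rightarrow> bool" where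
  "KKT a b x y \<longleftrightarrow> (\<forall>v. f' x v + inner y (G' x v) = inner a v) \<and> y \<in> normal_cone K (G x + b)"

text \<open>Isolated calmness of the KKT solution mapping, in a form that treats the components of points and
  of perturbations separately.\<close>
definition kkt_calm :: bool where
  "kkt_calm \<longleftrightarrow> (\<exists>\<kappa>>0. \<exists>\<delta>>0. \<forall>a b x y. norm a < \<delta> \<longrightarrow> norm b < \<delta> \<longrightarrow> norm (x - xbar) < \<delta> \<longrightarrow>
     norm (y - ybar) < \<delta> \<longrightarrow> KKT a b x y \<longrightarrow> norm (x - xbar) + norm (y - ybar) \<le> \<kappa> * (norm a + norm b))"

definition strict_cq :: bool where
  "strict_cq \<longleftrightarrow> (\<forall>z. \<exists>s. \<exists>c\<in>T. inner ybar c = 0 \<and> z = G' xbar s + c)"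

definition reduced_sosc :: bool where
  "reduced_sosc \<longleftrightarrow> (\<forall>d. d \<noteq> 0 \<longrightarrow> G' xbar d \<in> T \<longrightarrow> inner ybar (G' xbar d) = 0 \<longrightarrow> reduced_hessian d d > 0)"

lemma f'_cont: "isCont f' xbar" and G'_cont: "isCont G' xbar"
  by (rule has_derivative_continuous[OF f'_der], rule has_derivative_continuous[OF G'_der])

lemma KKT_base: "KKT 0 0 xbar ybar"
  using stationary ybar_N by (simp add: KKT_def)

lemma K_nonempty: "K \<noteq> {}" using A_in by blast

lemma reduced_hessian_symmetric: "reduced_hessian s s' = reduced_hessian s' s"
  using second_derivative_symmetric[OF open_UNIV UNIV_I f_der f'_der, of s s']
    second_derivative_symmetric[OF open_UNIV UNIV_I G_der G'_der, of s s']
    second_derivative_symmetric[OF open_U A_U \<Phi>_der \<Phi>'_der, of "G' xbar s" "G' xbar s'"]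
  by (simp add: reduced_hessian_def)

lemma reduced_hessian_add:
  "reduced_hessian (s + s') w = reduced_hessian s w + reduced_hessian s' w"
  "reduced_hessian w (s + s') = reduced_hessian w s + reduced_hessian w s'"
  by (simp_all add: reduced_hessian_def blinfun.add_left blinfun.add_right inner_add_right)

lemma reduced_hessian_bounded: "\<exists>M\<ge>0. \<forall>e. \<bar>reduced_hessian e e\<bar> \<le> M * (norm e)\<^sup>2"
proof -
  have bil: "norm (g u u) \<le> norm g * (norm u)\<^sup>2" for g :: "'a::real_normed_vector \<Rightarrow>\<^sub>L ('a \<Rightarrow>\<^sub>L 'b::real_normed_vector)" and u
  proof -
    have "norm (g u u) \<le> norm (g u) * norm u" by (rule norm_blinfun)
    also have "\<dots> \<le> (norm g * norm u) * norm u" by (intro mult_right_mono norm_blinfun norm_ge_zero)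
    finally show ?thesis by (simp add: power2_eq_square mult.assoc)
  qed
  have in_y: "\<bar>inner ybar v\<bar> \<le> norm ybar * c" if "norm v \<le> c" for v c
    using order_trans[OF Cauchy_Schwarz_ineq2 mult_left_mono[OF that norm_ge_zero]] .
  define M where "M = norm f'' + norm ybar * norm G'' + norm ybar * (norm \<Phi>'' * (norm (G' xbar))\<^sup>2)"
  have "\<bar>reduced_hessian e e\<bar> \<le> M * (norm e)\<^sup>2" for e
  proof -
    have 1: "\<bar>f'' e e\<bar> \<le> norm f'' * (norm e)\<^sup>2" using bil[of f'' e] by simp
    have 2: "\<bar>inner ybar (G'' e e)\<bar> \<le> norm ybar * (norm G'' * (norm e)\<^sup>2)" by (rule in_y[OF bil])
    have "norm (\<Phi>'' (G' xbar e) (G' xbar e)) \<le> norm \<Phi>'' * (norm (G' xbar e))\<^sup>2" by (rule bil)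
    also have "\<dots> \<le> norm \<Phi>'' * (norm (G' xbar) * norm e)\<^sup>2"
      by (intro mult_left_mono power_mono norm_blinfun norm_ge_zero)
    finally have 3: "\<bar>inner ybar (\<Phi>'' (G' xbar e) (G' xbar e))\<bar> \<le> norm ybar * (norm \<Phi>'' * (norm (G' xbar) * norm e)\<^sup>2)"
      by (rule in_y)
    have "M * (norm e)\<^sup>2 = norm f'' * (norm e)\<^sup>2 + norm ybar * (norm G'' * (norm e)\<^sup>2)
        + norm ybar * (norm \<Phi>'' * (norm (G' xbar) * norm e)\<^sup>2)"
      by (simp add: M_def power_mult_distrib algebra_simps)
    with 1 2 3 show ?thesis unfolding reduced_hessian_def by linarith
  qed
  moreover have "M \<ge> 0" by (simp add: M_def)
  ultimately show ?thesis by blast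
qed

text \<open>The difference \<open>y - ybar\<close> is orthogonal to the range of \<open>G'\<close> and has nonpositive product with
  \<open>T \<inter> ybar\<^sup>\<bottom>\<close>, so it has nonpositive product with every vector.\<close>
lemma strict_cq_unique:
  assumes "strict_cq" and y: "KKT 0 0 xbar y"
  shows "y = ybar"
proof -
  obtain s c where c: "c \<in> T" "inner ybar c = 0" "y - ybar = G' xbar s + c"
    using \<open>strict_cq\<close> unfolding strict_cq_def by blast
  have "inner (y - ybar) (G' xbar s) = 0"
    using y stationary[of s] unfolding KKT_def by (simp add: inner_diff_left) (metis add_left_cancel)
  moreover have "inner (y - ybar) c \<le> 0"
    using normal_cone_imp_polar[of y c] y c(1,2) by (simp add: KKT_def inner_diff_left)
  ultimately have "inner (y - ybar) (y - ybar) \<le> 0"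
    by (subst (2) c(3)) (simp add: inner_add_right)
  then show ?thesis by (metis eq_iff_diff_eq_0 inner_ge_zero inner_eq_zero_iff order_antisym)
qed

lemma lagrangian_gradient_difference_limit:
  assumes t: "\<And>k. t k > 0" "t \<longlonglongrightarrow> (0::real)"
    and x: "(\<lambda>k. (x k - xbar) /\<^sub>R t k) \<longlonglongrightarrow> d" and y: "y \<longlonglongrightarrow> ybar"
  shows "(\<lambda>k. ((f' (x k) - f' xbar) /\<^sub>R t k) w + inner (y k) (((G' (x k) - G' xbar) /\<^sub>R t k) w))
    \<longlonglongrightarrow> f'' d w + inner ybar (G'' d w)"
  by (intro tendsto_add tendsto_inner y blinfun.tendsto tendsto_const
      derivative_along_sequence[OF f'_der t x] derivative_along_sequence[OF G'_der t x])

lemma in_tangent_limit: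
  assumes "\<And>k. t k > 0" "t \<longlonglongrightarrow> (0::real)" "(\<lambda>k. (B k - G xbar) /\<^sub>R t k) \<longlonglongrightarrow> h" "\<And>k. B k \<in> K"
  shows "h \<in> T"
proof -
  have "h \<in> tangent_cone K (G xbar)"
    unfolding tangent_cone_def mem_Collect_eq using assms sequence_to_A[OF assms(1-3)]
    by (intro exI[of _ B] exI[of _ t] conjI allI)
  then show ?thesis by (simp add: tangent_cone_eq)
qed

text \<open>Let \<open>(d, v)\<close> be a limit of normalized differences along a sequence of KKT points violating calmness.
  The equation \<open>\<nabla>\<^sup>2L d + G'\<^sup>* v = 0\<close> is the limit of the difference of stationarity equations, and comparing the
  expansions of \<open><y, B - A>\<close> and \<open><ybar, B - A>\<close> gives \<open><v, G' d> \<ge> <ybar, \<Phi>''(G' d)(G' d)>\<close>.  Testing the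
  equation with \<open>d\<close> forces \<open>d = 0\<close>; then \<open>v\<close> is orthogonal to the range of \<open>G'\<close> and lies in the polar of
  \<open>T \<inter> ybar\<^sup>\<bottom>\<close>.\<close>
lemma strict_cq_sosc_imp_calm:
  assumes scq: strict_cq and sosc: reduced_sosc
  shows kkt_calm
proof (rule ccontr)
  assume "\<not> kkt_calm"
  then have neg: "\<exists>a b x y. norm a < \<delta> \<and> norm b < \<delta> \<and> norm (x - xbar) < \<delta> \<and> norm (y - ybar) < \<delta> \<and> KKT a b x y
      \<and> norm (x - xbar) + norm (y - ybar) > \<kappa> * (norm a + norm b)" if "\<kappa> > 0" "\<delta> > 0" for \<kappa> \<delta>
    using that unfolding kkt_calm_def not_le[symmetric] by blast
  define q where "q k = inverse (real (Suc k))" for k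
  have q: "q k > 0" for k by (simp add: q_def)
  have q0: "q \<longlonglongrightarrow> 0" unfolding q_def using LIMSEQ_inverse_real_of_nat by simp
  have "\<exists>a b x y. norm a < q k \<and> norm b < q k \<and> norm (x - xbar) < q k \<and> norm (y - ybar) < q k \<and> KKT a b x y
      \<and> norm (x - xbar) + norm (y - ybar) > inverse (q k) * (norm a + norm b)" for k
    by (rule neg) (use q[of k] in simp_all)
  then obtain a0 b0 x0 y0 where p: "\<And>k. norm (a0 k) < q k \<and> norm (b0 k) < q k \<and> norm (x0 k - xbar) < q k
      \<and> norm (y0 k - ybar) < q k \<and> KKT (a0 k) (b0 k) (x0 k) (y0 k)
      \<and> norm (x0 k - xbar) + norm (y0 k - ybar) > inverse (q k) * (norm (a0 k) + norm (b0 k))"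
    by metis
  define t0 where "t0 k = norm (x0 k - xbar) + norm (y0 k - ybar)" for k
  have x0: "norm (x0 k - xbar) < q k" and y0: "norm (y0 k - ybar) < q k" and kkt0: "KKT (a0 k) (b0 k) (x0 k) (y0 k)"
    and t0: "t0 k > inverse (q k) * (norm (a0 k) + norm (b0 k))" for k
    using p[of k] by (simp_all add: t0_def)
  have t0pos: "t0 k > 0" for k
    by (rule le_less_trans[OF _ t0]) (use q[of k] in simp)
  have ab: "norm (a0 k) + norm (b0 k) \<le> q k * t0 k" for k
    using t0[of k] q[of k] by (simp add: field_simps)
  have t0lim: "t0 \<longlonglongrightarrow> 0"
  proof (rule Lim_null_comparison)
    show "\<forall>\<^sub>F k in sequentially. norm (t0 k) \<le> 2 * q k"
      using x0 y0 t0pos by (intro always_eventually allI) (smt (verit) real_norm_def t0_def)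
    show "(\<lambda>k. 2 * q k) \<longlonglongrightarrow> 0" using tendsto_mult_left[OF q0, of 2] by simp
  qed
  define z where "z k = ((x0 k - xbar) /\<^sub>R t0 k, (y0 k - ybar) /\<^sub>R t0 k)" for k
  have sum1: "norm (fst (z k)) + norm (snd (z k)) = 1" for k
  proof -
    have "norm (fst (z k)) + norm (snd (z k)) = inverse (t0 k) * t0 k"
      using t0pos[of k] by (simp add: z_def t0_def distrib_left)
    then show ?thesis using t0pos[of k] by simp
  qed
  have "norm (z k) \<le> 1" for k
    using norm_Pair_le[of "fst (z k)" "snd (z k)"] sum1[of k] by simp
  then obtain r l where r: "strict_mono r" and l: "(\<lambda>k. z (r k)) \<longlonglongrightarrow> l"
    by (rule bounded_sequence_subsequence)
  define d v where "d = fst l" and "v = snd l"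
  define t a b x y where "t k = t0 (r k)" and "a k = a0 (r k)" and "b k = b0 (r k)" and "x k = x0 (r k)" and "y k = y0 (r k)" for k
  have t: "\<And>k. t k > 0" "t \<longlonglongrightarrow> 0"
    using t0pos LIMSEQ_subseq_LIMSEQ[OF t0lim r] by (simp_all add: t_def[abs_def] o_def)
  have qr: "(\<lambda>k. q (r k)) \<longlonglongrightarrow> 0" using LIMSEQ_subseq_LIMSEQ[OF q0 r] by (simp add: o_def)
  have xd: "(\<lambda>k. (x k - xbar) /\<^sub>R t k) \<longlonglongrightarrow> d" and yv: "(\<lambda>k. (y k - ybar) /\<^sub>R t k) \<longlonglongrightarrow> v"
    using tendsto_fst[OF l] tendsto_snd[OF l] by (simp_all add: z_def x_def y_def t_def d_def v_def)
  have dv: "norm d + norm v = 1"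
  proof (rule LIMSEQ_unique)
    show "(\<lambda>k. norm (fst (z (r k))) + norm (snd (z (r k)))) \<longlonglongrightarrow> norm d + norm v"
      unfolding d_def v_def by (intro tendsto_add tendsto_norm tendsto_fst tendsto_snd l)
    show "(\<lambda>k. norm (fst (z (r k))) + norm (snd (z (r k)))) \<longlonglongrightarrow> 1" by (simp only: sum1 tendsto_const)
  qed
  have ylim: "y \<longlonglongrightarrow> ybar"
  proof -
    have "(\<lambda>k. y k - ybar) \<longlonglongrightarrow> 0"
      by (rule Lim_null_comparison[OF always_eventually qr]) (simp only: y_def less_imp_le[OF y0] simp_thms)
    then show ?thesis by (simp only: LIM_zero_iff)
  qed
  have abt: "norm (a k /\<^sub>R t k) \<le> q (r k)" "norm (b k /\<^sub>R t k) \<le> q (r k)" for k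
  proof -
    have "norm (a k) \<le> q (r k) * t k" "norm (b k) \<le> q (r k) * t k"
      using ab[of "r k"] norm_ge_zero[of "a k"] norm_ge_zero[of "b k"]
      unfolding a_def b_def t_def by linarith+
    then show "norm (a k /\<^sub>R t k) \<le> q (r k)" "norm (b k /\<^sub>R t k) \<le> q (r k)"
      using t(1)[of k] by (simp_all add: field_simps)
  qed
  have at: "(\<lambda>k. a k /\<^sub>R t k) \<longlonglongrightarrow> 0"
    by (rule Lim_null_comparison[OF always_eventually qr]) (use abt in blast)
  have bt: "(\<lambda>k. b k /\<^sub>R t k) \<longlonglongrightarrow> 0"
    by (rule Lim_null_comparison[OF always_eventually qr]) (use abt in blast)
  define B where "B k = G (x k) + b k" for k
  define h where "h = G' xbar d"
  have yN: "y k \<in> normal_cone K (B k)" and st: "f' (x k) w + inner (y k) (G' (x k) w) = inner (a k) w" for k w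
    using kkt0[of "r k"] by (simp_all add: KKT_def B_def y_def x_def b_def a_def)
  have BK: "B k \<in> K" for k using yN[of k] by (simp add: normal_cone_def)
  have "(\<lambda>k. (G (x k) - G xbar) /\<^sub>R t k + b k /\<^sub>R t k) \<longlonglongrightarrow> h + 0"
    unfolding h_def by (intro tendsto_add bt derivative_along_sequence[OF G_der t xd])
  moreover have "(G (x k) - G xbar) /\<^sub>R t k + b k /\<^sub>R t k = (B k - G xbar) /\<^sub>R t k" for k
    by (simp only: B_def algebra_simps)
  ultimately have Bh: "(\<lambda>k. (B k - G xbar) /\<^sub>R t k) \<longlonglongrightarrow> h" by (simp only: add_0_right)
  have hT: "h \<in> T" by (rule in_tangent_limit[OF t Bh BK])
  have C2: "(\<lambda>k. inner (y k) (B k - G xbar) / (t k)\<^sup>2) \<longlonglongrightarrow> (1/2) * inner ybar (\<Phi>'' h h)"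
    by (rule multiplier_second_order_limit[OF yN ylim t Bh])
  have "(\<lambda>k. t k * (inner (y k) (B k - G xbar) / (t k)\<^sup>2)) \<longlonglongrightarrow> 0 * ((1/2) * inner ybar (\<Phi>'' h h))"
    by (rule tendsto_mult[OF t(2) C2])
  moreover have "t k * (inner (y k) (B k - G xbar) / (t k)\<^sup>2) = inner (y k) ((B k - G xbar) /\<^sub>R t k)" for k
    using t(1)[of k] unfolding inner_scaleR_right by (simp add: power2_eq_square divide_simps)
  ultimately have "(\<lambda>k. inner (y k) ((B k - G xbar) /\<^sub>R t k)) \<longlonglongrightarrow> 0" by (simp only: mult_zero_left)
  with tendsto_inner[OF ylim Bh] have hy: "inner ybar h = 0" by (rule LIMSEQ_unique)
  obtain r1 where r1: "r1 \<longlonglongrightarrow> - (1/2) * inner ybar (\<Phi>'' h h)" "\<forall>\<^sub>F k in sequentially. inner ybar (B k - G xbar) / (t k)\<^sup>2 \<le> r1 k"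
    using fixed_multiplier_second_order_bound[OF ybar_N BK t Bh] by (elim exE conjE) (rule that)
  have "(\<lambda>k. inner ((y k - ybar) /\<^sub>R t k) ((B k - G xbar) /\<^sub>R t k)) \<longlonglongrightarrow> inner v h"
    by (rule tendsto_inner[OF yv Bh])
  moreover have "(\<lambda>k. inner (y k) (B k - G xbar) / (t k)\<^sup>2 - r1 k) \<longlonglongrightarrow> (1/2) * inner ybar (\<Phi>'' h h) - (- (1/2) * inner ybar (\<Phi>'' h h))"
    by (rule tendsto_diff[OF C2 r1(1)])
  moreover have "\<forall>\<^sub>F k in sequentially. inner (y k) (B k - G xbar) / (t k)\<^sup>2 - r1 k \<le> inner ((y k - ybar) /\<^sub>R t k) ((B k - G xbar) /\<^sub>R t k)"
    using r1(2)
  proof eventually_elim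
    case (elim k)
    have "inner ((y k - ybar) /\<^sub>R t k) ((B k - G xbar) /\<^sub>R t k) = inner (y k - ybar) (B k - G xbar) / (t k)\<^sup>2"
      by (simp only: inner_scaleR_left inner_scaleR_right divide_inverse power2_eq_square inverse_mult_distrib mult_ac)
    with elim show ?case by (simp add: inner_diff_left diff_divide_distrib)
  qed
  ultimately have "(1/2) * inner ybar (\<Phi>'' h h) - (- (1/2) * inner ybar (\<Phi>'' h h)) \<le> inner v h"
    using tendsto_le[OF sequentially_bot] by blast
  then have vh: "inner ybar (\<Phi>'' h h) \<le> inner v h" by simp
  have eqn: "f'' d w + inner ybar (G'' d w) + inner v (G' xbar w) = 0" for w
  proof -
    have 1: "(\<lambda>k. ((f' (x k) - f' xbar) /\<^sub>R t k) w + inner (y k) (((G' (x k) - G' xbar) /\<^sub>R t k) w) + inner ((y k - ybar) /\<^sub>R t k) (G' xbar w))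
        \<longlonglongrightarrow> f'' d w + inner ybar (G'' d w) + inner v (G' xbar w)"
      by (intro tendsto_add[OF lagrangian_gradient_difference_limit[OF t xd ylim]] tendsto_inner yv tendsto_const)
    have 2: "((f' (x k) - f' xbar) /\<^sub>R t k) w + inner (y k) (((G' (x k) - G' xbar) /\<^sub>R t k) w) + inner ((y k - ybar) /\<^sub>R t k) (G' xbar w)
        = inner (a k /\<^sub>R t k) w" for k
    proof -
      have "((f' (x k) - f' xbar) /\<^sub>R t k) w + inner (y k) (((G' (x k) - G' xbar) /\<^sub>R t k) w) + inner ((y k - ybar) /\<^sub>R t k) (G' xbar w)
        = inverse (t k) * ((f' (x k) w + inner (y k) (G' (x k) w)) - (f' xbar w + inner ybar (G' xbar w)))"
        by (simp add: blinfun.scaleR_left blinfun.diff_left inner_diff_left inner_diff_right algebra_simps)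
      then show ?thesis by (simp only: st stationary diff_zero inner_scaleR_left)
    qed
    have "(\<lambda>k. inner (a k /\<^sub>R t k) w) \<longlonglongrightarrow> inner 0 w" by (intro tendsto_inner at tendsto_const)
    with 1 show ?thesis unfolding 2 using LIMSEQ_unique by fastforce
  qed
  have "reduced_hessian d d \<le> 0" using eqn[of d] vh by (simp add: reduced_hessian_def h_def)
  then have d0: "d = 0" using sosc hT hy unfolding reduced_sosc_def h_def by force
  have h0: "h = 0" by (simp add: h_def d0)
  have vG: "inner v (G' xbar w) = 0" for w using eqn[of w] by (simp add: d0)
  obtain s c where c: "c \<in> T" "inner ybar c = 0" "v = G' xbar s + c"
    using scq unfolding strict_cq_def by blast
  obtain r3 where r3: "r3 \<longlonglongrightarrow> inner ybar (\<Phi>'' h c)" "\<forall>\<^sub>F k in sequentially. inner (y k) c / t k \<le> r3 k"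
    using multiplier_first_order_bound[OF c(1) yN ylim t Bh] by (elim exE conjE) (rule that)
  have "(\<lambda>k. inner ((y k - ybar) /\<^sub>R t k) c) \<longlonglongrightarrow> inner v c" by (intro tendsto_inner yv tendsto_const)
  moreover have "inner ((y k - ybar) /\<^sub>R t k) c = inner (y k) c / t k" for k
    using c(2) by (simp add: inner_diff_left divide_inverse mult.commute)
  ultimately have "(\<lambda>k. inner (y k) c / t k) \<longlonglongrightarrow> inner v c" by (simp only:)
  from tendsto_le[OF sequentially_bot r3(1) this r3(2)] have "inner v c \<le> 0" by (simp add: h0)
  then have "inner v v \<le> 0" using vG[of s] by (subst (2) c(3)) (simp add: inner_add_right)
  then have "v = 0" by (metis inner_ge_zero inner_eq_zero_iff order_antisym)
  with d0 dv show False by simp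
qed

text \<open>Along a sequence violating strictness, with projections \<open>B\<close> of \<open>G x\<close> onto \<open>K\<close>, the Lagrangian expansion
  bounds \<open>(\<rho> - \<bar>ybar\<bar>) dist(G x, K)\<close> by a multiple of \<open>t\<^sup>2\<close>.  So \<open>B\<close> follows \<open>G x\<close> to first order,
  the limit direction is critical, and the bound on \<open><ybar, B - A>\<close> makes the reduced Hessian
  nonpositive there.\<close>
lemma sosc_imp_penalty_strict_min:
  assumes sosc: reduced_sosc and \<rho>: "norm ybar < \<rho>"
  shows "\<exists>\<delta>>0. \<forall>x\<in>cball xbar \<delta>. x \<noteq> xbar \<longrightarrow> f xbar < f x + \<rho> * infdist (G x) K"
proof (rule ccontr)
  assume "\<not> ?thesis"
  then have neg: "\<exists>x. x \<in> cball xbar \<delta> \<and> x \<noteq> xbar \<and> f x + \<rho> * infdist (G x) K \<le> f xbar" if "\<delta> > 0" for \<delta>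
    using that by (meson not_le)
  define q where "q k = inverse (real (Suc k))" for k
  have q: "q k > 0" for k by (simp add: q_def)
  have q0: "q \<longlonglongrightarrow> 0" unfolding q_def using LIMSEQ_inverse_real_of_nat by simp
  obtain x0 where x0: "\<And>k. x0 k \<in> cball xbar (q k) \<and> x0 k \<noteq> xbar \<and> f (x0 k) + \<rho> * infdist (G (x0 k)) K \<le> f xbar"
    using neg[OF q] by metis
  define t0 where "t0 k = norm (x0 k - xbar)" for k
  have t0pos: "t0 k > 0" for k using x0[of k] by (simp add: t0_def)
  have t0lim: "t0 \<longlonglongrightarrow> 0"
    by (rule Lim_null_comparison[OF _ q0]) (use x0 in \<open>simp add: t0_def dist_norm norm_minus_commute\<close>)
  have "norm ((x0 k - xbar) /\<^sub>R t0 k) = 1" for k using t0pos[of k] by (simp add: t0_def)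
  note n1 = this
  then have "norm ((x0 k - xbar) /\<^sub>R t0 k) \<le> 1" for k by simp
  then obtain r d where r: "strict_mono r" and l: "(\<lambda>k. (x0 (r k) - xbar) /\<^sub>R t0 (r k)) \<longlonglongrightarrow> d"
    by (rule bounded_sequence_subsequence)
  have "norm d = 1" by (rule LIMSEQ_unique[OF tendsto_norm[OF l]]) (simp only: n1 tendsto_const)
  then have d0: "d \<noteq> 0" by auto
  define t x where "t k = t0 (r k)" and "x k = x0 (r k)" for k
  have t: "\<And>k. t k > 0" "t \<longlonglongrightarrow> 0"
    using t0pos LIMSEQ_subseq_LIMSEQ[OF t0lim r] by (simp_all add: t_def[abs_def] o_def)
  have xd: "(\<lambda>k. (x k - xbar) /\<^sub>R t k) \<longlonglongrightarrow> d" using l by (simp add: x_def t_def)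
  define \<delta> where "\<delta> k = infdist (G (x k)) K" for k
  have desc: "f (x k) + \<rho> * \<delta> k \<le> f xbar" for k using x0[of "r k"] by (simp add: x_def \<delta>_def)
  have \<delta>0: "\<delta> k \<ge> 0" for k by (simp add: \<delta>_def infdist_nonneg)
  define B where "B k = closest_point K (G (x k))" for k
  have BK: "B k \<in> K" for k by (simp add: B_def closest_point_in_set closed_K K_nonempty)
  have nB: "norm (G (x k) - B k) = \<delta> k" for k
    by (simp add: B_def \<delta>_def infdist_eq_dist_closest_point[OF closed_K K_nonempty])
  have c0: "\<rho> - norm ybar > 0" using \<rho> by simp
  define E where "E k = (f (x k) - f xbar - f' xbar (x k - xbar)) /\<^sub>R (t k)\<^sup>2
      + inner ybar ((G (x k) - G xbar - G' xbar (x k - xbar)) /\<^sub>R (t k)\<^sup>2)" for k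
  have Elim: "E \<longlonglongrightarrow> (1/2) *\<^sub>R f'' d d + inner ybar ((1/2) *\<^sub>R G'' d d)"
    unfolding E_def
    by (intro tendsto_add tendsto_inner tendsto_const
        second_order_taylor_along_sequence[OF open_UNIV UNIV_I f_der f'_der t xd]
        second_order_taylor_along_sequence[OF open_UNIV UNIV_I G_der G'_der t xd])
  have Eeq: "E k = (f (x k) - f xbar + inner ybar (G (x k) - G xbar)) / (t k)\<^sup>2" for k
  proof -
    have "E k = inverse ((t k)\<^sup>2) * (f (x k) - f xbar + inner ybar (G (x k) - G xbar) - (f' xbar (x k - xbar) + inner ybar (G' xbar (x k - xbar))))"
      by (simp only: E_def inner_scaleR_right real_scaleR_def inner_diff_right) (simp only: algebra_simps)
    then show ?thesis by (simp only: stationary diff_zero divide_inverse mult.commute)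
  qed
  have Ele: "(\<rho> - norm ybar) * (\<delta> k / (t k)\<^sup>2) + E k \<le> inner ybar (B k - G xbar) / (t k)\<^sup>2" for k
  proof -
    have "inner ybar (G (x k) - B k) \<le> norm ybar * \<delta> k"
      using norm_cauchy_schwarz[of ybar "G (x k) - B k"] by (simp add: nB)
    then have "(\<rho> - norm ybar) * \<delta> k + (f (x k) - f xbar + inner ybar (G (x k) - G xbar)) \<le> inner ybar (B k - G xbar)"
      using desc[of k] by (simp add: inner_diff_right algebra_simps)
    then have "((\<rho> - norm ybar) * \<delta> k + (f (x k) - f xbar + inner ybar (G (x k) - G xbar))) / (t k)\<^sup>2 \<le> inner ybar (B k - G xbar) / (t k)\<^sup>2"
      by (rule divide_right_mono) simp
    then show ?thesis by (simp only: Eeq add_divide_distrib times_divide_eq_right)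
  qed
  have "inner ybar (B k - G xbar) / (t k)\<^sup>2 \<le> 0" for k
    using ybar_N BK[of k] by (simp add: normal_cone_def divide_nonpos_nonneg)
  then have "(\<rho> - norm ybar) * (\<delta> k / (t k)\<^sup>2) \<le> - E k" for k using Ele[of k] by (smt (verit))
  then have bnd: "\<delta> k / (t k)\<^sup>2 \<le> - E k / (\<rho> - norm ybar)" for k
    by (simp only: pos_le_divide_eq[OF c0] mult.commute)
  have nle: "norm ((B k - G (x k)) /\<^sub>R t k) \<le> t k * (- E k / (\<rho> - norm ybar))" for k
  proof -
    have "norm ((B k - G (x k)) /\<^sub>R t k) = inverse (t k) * norm (B k - G (x k))"
      using t(1)[of k] by (simp only: norm_scaleR abs_inverse abs_of_pos)
    also have "norm (B k - G (x k)) = \<delta> k" using nB[of k] by (simp only: norm_minus_commute)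
    also have "inverse (t k) * \<delta> k = t k * (\<delta> k / (t k)\<^sup>2)"
      using t(1)[of k] by (simp add: power2_eq_square divide_simps)
    finally have "norm ((B k - G (x k)) /\<^sub>R t k) = t k * (\<delta> k / (t k)\<^sup>2)" .
    then show ?thesis using mult_left_mono[OF bnd[of k] less_imp_le[OF t(1)[of k]]] by simp
  qed
  have "(\<lambda>k. t k * (- E k / (\<rho> - norm ybar))) \<longlonglongrightarrow> 0 * (- ((1/2) *\<^sub>R f'' d d + inner ybar ((1/2) *\<^sub>R G'' d d)) / (\<rho> - norm ybar))"
    using c0 by (intro tendsto_mult t tendsto_divide tendsto_minus Elim tendsto_const) simp
  then have lim0: "(\<lambda>k. t k * (- E k / (\<rho> - norm ybar))) \<longlonglongrightarrow> 0" by (simp only: mult_zero_left)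
  have BG: "(\<lambda>k. (B k - G (x k)) /\<^sub>R t k) \<longlonglongrightarrow> 0"
    by (rule Lim_null_comparison[OF always_eventually lim0]) (rule allI, rule nle)
  define h where "h = G' xbar d"
  have "(\<lambda>k. (B k - G (x k)) /\<^sub>R t k + (G (x k) - G xbar) /\<^sub>R t k) \<longlonglongrightarrow> 0 + h"
    unfolding h_def by (intro tendsto_add BG derivative_along_sequence[OF G_der t xd])
  moreover have "(B k - G (x k)) /\<^sub>R t k + (G (x k) - G xbar) /\<^sub>R t k = (B k - G xbar) /\<^sub>R t k" for k
    by (simp only: algebra_simps)
  ultimately have Bh: "(\<lambda>k. (B k - G xbar) /\<^sub>R t k) \<longlonglongrightarrow> h" by (simp only: add_0)
  have hT: "h \<in> T" by (rule in_tangent_limit[OF t Bh BK])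
  have "f' xbar d \<le> 0"
  proof (rule LIMSEQ_le_const2)
    show "(\<lambda>k. (f (x k) - f xbar) /\<^sub>R t k) \<longlonglongrightarrow> f' xbar d" by (rule derivative_along_sequence[OF f_der t xd])
    have "(f (x k) - f xbar) /\<^sub>R t k \<le> 0" for k
    proof -
      have "\<rho> * \<delta> k \<ge> 0" using \<delta>0[of k] \<rho> norm_ge_zero[of ybar] by (intro mult_nonneg_nonneg) linarith+
      then have "f (x k) - f xbar \<le> 0" using desc[of k] by linarith
      then show ?thesis using t(1)[of k] by (simp add: mult_nonneg_nonpos)
    qed
    then show "\<exists>N. \<forall>n\<ge>N. (f (x n) - f xbar) /\<^sub>R t n \<le> 0" by blast
  qed
  then have hy: "inner ybar h = 0" using stationary[of d] normal_cone_imp_polar[OF ybar_N hT] by (simp add: h_def)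
  obtain r1 where r1: "r1 \<longlonglongrightarrow> - (1/2) * inner ybar (\<Phi>'' h h)" "\<forall>\<^sub>F k in sequentially. inner ybar (B k - G xbar) / (t k)\<^sup>2 \<le> r1 k"
    using fixed_multiplier_second_order_bound[OF ybar_N BK t Bh] by (elim exE conjE) (rule that)
  have "\<forall>\<^sub>F k in sequentially. E k \<le> r1 k"
    using r1(2)
  proof eventually_elim
    case (elim k)
    have "0 \<le> (\<rho> - norm ybar) * (\<delta> k / (t k)\<^sup>2)" using c0 \<delta>0[of k] by simp
    with elim Ele[of k] show ?case by linarith
  qed
  from tendsto_le[OF sequentially_bot r1(1) Elim this]
  have "reduced_hessian d d \<le> 0" by (simp add: reduced_hessian_def h_def)
  then show False using sosc d0 hT hy unfolding reduced_sosc_def h_def by force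
qed


lemma strict_cq_sosc_imp_solvable:
  assumes scq: strict_cq and sosc: reduced_sosc and \<eta>: "\<eta> > 0"
  shows "\<exists>\<gamma>>0. \<forall>a b. norm a < \<gamma> \<longrightarrow> norm b < \<gamma> \<longrightarrow>
    (\<exists>x y. norm (x - xbar) < \<eta> \<and> norm (y - ybar) < \<eta> \<and> KKT a b x y)"
proof (rule ccontr)
  assume "\<not> ?thesis"
  then have neg: "\<exists>p. norm (fst p) < \<gamma> \<and> norm (snd p) < \<gamma> \<and>
      (\<forall>x y. norm (x - xbar) < \<eta> \<longrightarrow> norm (y - ybar) < \<eta> \<longrightarrow> \<not> KKT (fst p) (snd p) x y)" if "\<gamma> > 0" for \<gamma>
    using that by simp
  define q where "q k = inverse (real (Suc k))" for k
  have q: "q k > 0" for k by (simp add: q_def)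
  have q0: "q \<longlonglongrightarrow> 0" unfolding q_def using LIMSEQ_inverse_real_of_nat by simp
  obtain p where p: "\<And>k. norm (fst (p k)) < q k \<and> norm (snd (p k)) < q k \<and>
      (\<forall>x y. norm (x - xbar) < \<eta> \<longrightarrow> norm (y - ybar) < \<eta> \<longrightarrow> \<not> KKT (fst (p k)) (snd (p k)) x y)"
    using neg[OF q] by metis
  have a: "(\<lambda>k. fst (p k)) \<longlonglongrightarrow> 0" and b: "(\<lambda>k. snd (p k)) \<longlonglongrightarrow> 0"
    by (rule Lim_null_comparison[OF always_eventually q0]; use p less_imp_le in blast)+
  have \<rho>: "norm ybar < norm ybar + 1" by simp
  obtain \<delta> where \<delta>: "\<delta> > 0" "\<forall>x\<in>cball xbar \<delta>. x \<noteq> xbar \<longrightarrow> f xbar < f x + (norm ybar + 1) * infdist (G x) K"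
    using sosc_imp_penalty_strict_min[OF sosc \<rho>] by blast
  have uniq: "\<forall>y\<in>normal_cone K (G xbar). (\<forall>v. f' xbar v + inner y (G' xbar v) = 0) \<longrightarrow> y = ybar"
    using strict_cq_unique[OF scq] by (simp add: KKT_def)
  obtain r :: "nat \<Rightarrow> nat" and x y where x: "x \<longlonglongrightarrow> xbar" and y: "y \<longlonglongrightarrow> ybar"
    and st: "\<forall>k v. f' (x k) v + inner (y k) (G' (x k) v) = inner (fst (p (r k))) v"
    and N: "\<forall>k. y k \<in> normal_cone K (G (x k) + snd (p (r k)))"
    using perturbed_kkt_points[OF closed_K convex_K K_nonempty f_der f'_cont G_der G'_cont A_in \<delta> uniq \<rho> a b]
    by (elim exE conjE) (rule that)
  have "\<forall>\<^sub>F k in sequentially. norm (x k - xbar) < \<eta> \<and> norm (y k - ybar) < \<eta>"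
    using tendstoD[OF x \<eta>] tendstoD[OF y \<eta>] by (simp add: dist_norm eventually_conj)
  then obtain k where "norm (x k - xbar) < \<eta>" "norm (y k - ybar) < \<eta>"
    by (auto simp: eventually_sequentially)
  moreover have "KKT (fst (p (r k))) (snd (p (r k))) (x k) (y k)" using st N by (simp add: KKT_def)
  ultimately show False using p[of "r k"] by simp
qed

section \<open>Necessity of the strict qualification and of the second order condition\<close>

lemma K_minus_A: "w \<in> K \<Longrightarrow> w - G xbar \<in> T"
proof -
  assume w: "w \<in> K"
  define t where "t k = inverse (real (Suc k))" for k
  have t: "\<And>k. t k > 0" "t \<longlonglongrightarrow> 0"
    unfolding t_def using LIMSEQ_inverse_real_of_nat by simp_all
  show ?thesis
  proof (rule in_tangent_limit[OF t])
    have "(G xbar + t k *\<^sub>R (w - G xbar) - G xbar) /\<^sub>R t k = w - G xbar" for k using t(1)[of k] by simp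
    then show "(\<lambda>k. (G xbar + t k *\<^sub>R (w - G xbar) - G xbar) /\<^sub>R t k) \<longlonglongrightarrow> w - G xbar"
      by (simp only: tendsto_const)
    have "G xbar + t k *\<^sub>R (w - G xbar) = (1 - t k) *\<^sub>R G xbar + t k *\<^sub>R w" for k
      by (simp add: algebra_simps)
    moreover have "t k \<le> 1" for k by (simp add: t_def inverse_le_1_iff)
    ultimately show "G xbar + t k *\<^sub>R (w - G xbar) \<in> K" for k
      using convexD_alt[OF convex_K A_in w, of "t k"] t(1)[of k] by simp
  qed
qed

lemma polar_in_normal_cone:
  assumes "\<And>c. c \<in> T \<Longrightarrow> inner y c \<le> 0"
  shows "y \<in> normal_cone K (G xbar)"
  using assms K_minus_A A_in by (simp add: normal_cone_def)

text \<open>The polar cone of \<open>T\<close> plus the line spanned by \<open>ybar\<close>: the directions in which \<open>ybar\<close> can be moved, for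
  a short distance, within the polar cone.\<close>
definition multiplier_directions :: "'y set" where
  "multiplier_directions = {u + \<mu> *\<^sub>R ybar | u \<mu>. \<forall>c\<in>T. inner u c \<le> 0}"

text \<open>Moving the multiplier to \<open>ybar + \<tau> e\<close> while keeping \<open>xbar\<close> solves the KKT system with residual \<open>\<tau> G'\<^sup>* e\<close>,
  so calmness bounds \<open>\<tau> e\<close> by it.\<close>
lemma calm_multiplier_bound:
  assumes calm: kkt_calm
  shows "\<exists>\<kappa>. \<forall>e\<in>multiplier_directions. norm e \<le> \<kappa> * norm (adjoint (G' xbar) e)"
proof -
  obtain \<kappa> \<delta> where \<kappa>: "\<kappa> > 0" "\<delta> > 0"
    and est: "\<And>a b x y. norm a < \<delta> \<Longrightarrow> norm b < \<delta> \<Longrightarrow> norm (x - xbar) < \<delta> \<Longrightarrow>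
     norm (y - ybar) < \<delta> \<Longrightarrow> KKT a b x y \<Longrightarrow> norm (x - xbar) + norm (y - ybar) \<le> \<kappa> * (norm a + norm b)"
    using calm unfolding kkt_calm_def by blast
  have "norm e \<le> \<kappa> * norm (adjoint (G' xbar) e)" if "e \<in> multiplier_directions" for e
  proof -
    obtain u \<mu> where u: "\<And>c. c \<in> T \<Longrightarrow> inner u c \<le> 0" and e: "e = u + \<mu> *\<^sub>R ybar"
      using \<open>e \<in> multiplier_directions\<close> unfolding multiplier_directions_def by blast
    let ?a = "adjoint (G' xbar) e"
    \<comment> \<open>The first bound on \<open>\<tau>\<close> keeps \<open>1 + \<tau> \<mu> \<ge> 0\<close>, so that \<open>ybar + \<tau> e\<close> stays in the polar cone; the
      second keeps the perturbation in the region where calmness applies.\<close>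
    define P where "P = norm e + norm ?a + 1"
    have p: "P > 0" by (simp add: P_def add_nonneg_pos)
    define \<tau> where "\<tau> = min (1 / (\<bar>\<mu>\<bar> + 1)) (\<delta> / (2 * P))"
    have \<tau>: "\<tau> > 0" using \<kappa> p by (simp add: \<tau>_def)
    have "\<tau> * P \<le> \<delta> / (2 * P) * P"
      using p by (intro mult_right_mono) (simp_all add: \<tau>_def)
    then have "\<tau> * P \<le> \<delta> / 2" using p by simp
    then have small: "\<tau> * norm e + \<tau> * norm ?a < \<delta>" using \<kappa> \<tau> by (simp add: P_def distrib_left)
    have "\<tau> * \<bar>\<mu>\<bar> \<le> (1 / (\<bar>\<mu>\<bar> + 1)) * \<bar>\<mu>\<bar>" by (intro mult_right_mono) (simp_all add: \<tau>_def)
    also have "\<dots> \<le> 1" by simp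
    finally have "\<bar>\<tau> * \<mu>\<bar> \<le> 1" using \<tau> by (simp add: abs_mult)
    then have \<mu>: "0 \<le> 1 + \<tau> * \<mu>" by linarith
    let ?y = "ybar + \<tau> *\<^sub>R e"
    have yeq: "?y = (1 + \<tau> * \<mu>) *\<^sub>R ybar + \<tau> *\<^sub>R u" by (simp add: e algebra_simps)
    have "inner ?y c \<le> 0" if "c \<in> T" for c
      unfolding yeq inner_add_left inner_scaleR_left
      using mult_nonneg_nonpos[OF \<mu> normal_cone_imp_polar[OF ybar_N that]] mult_nonneg_nonpos[OF less_imp_le[OF \<tau>] u[OF that]]
      by linarith
    then have "?y \<in> normal_cone K (G xbar + 0)" using polar_in_normal_cone by simp
    moreover have "f' xbar v + inner ?y (G' xbar v) = inner (\<tau> *\<^sub>R ?a) v" for v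
      using stationary[of v] by (simp add: inner_add_left adjoint_blinfun(2))
    ultimately have kkt: "KKT (\<tau> *\<^sub>R ?a) 0 xbar ?y" by (simp add: KKT_def)
    have nn: "\<tau> * norm e \<ge> 0" "\<tau> * norm ?a \<ge> 0" using \<tau> by simp_all
    have "norm (xbar - xbar) + norm (?y - ybar) \<le> \<kappa> * (norm (\<tau> *\<^sub>R ?a) + norm (0::'y))"
    proof (rule est[OF _ _ _ _ kkt])
      show "norm (\<tau> *\<^sub>R ?a) < \<delta>" "norm (?y - ybar) < \<delta>"
        unfolding add_diff_cancel_left' norm_scaleR abs_of_pos[OF \<tau>] using small nn by linarith+
    qed (use \<kappa> in simp_all)
    then have "\<tau> * norm e \<le> \<tau> * (\<kappa> * norm ?a)" using \<tau> by (simp add: mult.left_commute)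
    then show ?thesis using \<tau> by simp
  qed
  then show ?thesis by blast
qed

text \<open>The polar of an intersection is the closed sum of the polars; both this and \<open>T = T\<^sup>o\<^sup>o\<close> are obtained by
  separation.\<close>
lemma polar_of_critical:
  assumes v: "\<And>c. c \<in> T \<Longrightarrow> inner ybar c = 0 \<Longrightarrow> inner v c \<le> 0"
  shows "v \<in> closure multiplier_directions"
proof (rule ccontr)
  let ?E = multiplier_directions
  assume no: "v \<notin> closure ?E"
  have E0: "u + \<mu> *\<^sub>R ybar \<in> ?E" if "\<forall>c\<in>T. inner u c \<le> 0" for u \<mu>
    using that unfolding multiplier_directions_def by blast
  have scale: "a *\<^sub>R e \<in> ?E" if "e \<in> ?E" "a \<ge> 0" for a e
  proof -
    obtain u \<mu> where u: "\<forall>c\<in>T. inner u c \<le> 0" "e = u + \<mu> *\<^sub>R ybar"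
      using \<open>e \<in> ?E\<close> unfolding multiplier_directions_def by blast
    have "a *\<^sub>R u + (a * \<mu>) *\<^sub>R ybar \<in> ?E" by (rule E0) (use u that in \<open>simp add: mult_nonneg_nonpos\<close>)
    then show ?thesis by (simp add: u scaleR_add_right)
  qed
  have "convex ?E"
  proof (rule convexI)
    fix x y and p q :: real assume x: "x \<in> ?E" and y: "y \<in> ?E" and pq: "0 \<le> p" "0 \<le> q" "p + q = 1"
    obtain u \<mu> where u: "\<forall>c\<in>T. inner u c \<le> 0" "x = u + \<mu> *\<^sub>R ybar"
      using x unfolding multiplier_directions_def by blast
    obtain w \<nu> where w: "\<forall>c\<in>T. inner w c \<le> 0" "y = w + \<nu> *\<^sub>R ybar"
      using y unfolding multiplier_directions_def by blast
    have "(p *\<^sub>R u + q *\<^sub>R w) + (p * \<mu> + q * \<nu>) *\<^sub>R ybar \<in> ?E"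
      by (rule E0) (use u(1) w(1) pq in \<open>simp add: inner_add_left mult_nonneg_nonpos add_nonpos_nonpos\<close>)
    then show "p *\<^sub>R x + q *\<^sub>R y \<in> ?E" by (simp add: u(2) w(2) algebra_simps)
  qed
  then have "convex (closure ?E)" by (rule convex_closure)
  from separating_hyperplane_closed_point[OF this closed_closure no]
  obtain z b where z: "inner z v < b" "\<And>e. e \<in> closure ?E \<Longrightarrow> inner z e > b" by blast
  have zE: "inner z e > b" if "e \<in> ?E" for e using z(2) closure_subset that by blast
  have b0: "b < 0" using zE[OF E0[of 0 0]] by simp
  have pos: "inner z e \<ge> 0" if e: "e \<in> ?E" for e
  proof (rule ccontr)
    assume "\<not> ?thesis"
    then have n: "inner z e < 0" by simp
    have "b < inner z ((b / inner z e) *\<^sub>R e)"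
      by (rule zE[OF scale[OF e]]) (use n b0 in \<open>simp add: divide_nonpos_neg\<close>)
    with n show False by simp
  qed
  have zT: "- z \<in> T"
  proof (rule ccontr)
    assume "- z \<notin> T"
    from separating_hyperplane_closed_point[OF T(2,1) this]
    obtain a c0 where a: "inner a (- z) < c0" "\<And>c. c \<in> T \<Longrightarrow> inner a c > c0" by blast
    have c0: "c0 < 0" using a(2)[OF T(4)] by simp
    have "inner a c \<ge> 0" if c: "c \<in> T" for c
    proof (rule ccontr)
      assume "\<not> ?thesis"
      then have n: "inner a c < 0" by simp
      have "c0 < inner a ((c0 / inner a c) *\<^sub>R c)"
        by (rule a(2)[OF scale_T[OF c]]) (use n c0 in \<open>simp add: divide_nonpos_neg\<close>)
      with n show False by simp
    qed
    then have "- a + 0 *\<^sub>R ybar \<in> ?E" by (intro E0) simp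
    from pos[OF this] have "inner z a \<le> 0" by simp
    then show False using a(1) c0 by (simp add: inner_commute)
  qed
  have "inner z (0 + 1 *\<^sub>R ybar) \<ge> 0" "inner z (0 + (-1) *\<^sub>R ybar) \<ge> 0"
    by (rule pos, rule E0, simp)+
  then have "inner ybar (- z) = 0" by (simp add: inner_commute)
  from v[OF zT this] have "inner z v \<ge> 0" by (simp add: inner_commute)
  with z(1) b0 show False by simp
qed

text \<open>If the convex cone \<open>G' X + T \<inter> ybar\<^sup>\<bottom>\<close> is not the whole space, it has a nonzero polar vector \<open>v\<close>.  Then
  \<open>G'\<^sup>* v = 0\<close>, and \<open>v\<close> is a limit of multiplier directions, which contradicts the calmness estimate for
  these directions.\<close>
lemma calm_imp_strict_cq:
  assumes calm: kkt_calm
  shows strict_cq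
  unfolding strict_cq_def
proof (rule ccontr)
  assume "\<not> (\<forall>z. \<exists>s. \<exists>c\<in>T. inner ybar c = 0 \<and> z = G' xbar s + c)"
  then obtain z where z: "\<And>s c. c \<in> T \<Longrightarrow> inner ybar c = 0 \<Longrightarrow> z \<noteq> G' xbar s + c" by blast
  define S where "S = {G' xbar s + c | s c. c \<in> T \<and> inner ybar c = 0}"
  have SI: "G' xbar s + c \<in> S" if "c \<in> T" "inner ybar c = 0" for s c using that unfolding S_def by blast
  have "convex ((\<lambda>w. w - z) ` S)"
  proof (rule convex_translation_subtract)
    show "convex S"
    proof (rule convexI)
      fix x y and p q :: real assume x: "x \<in> S" and y: "y \<in> S" and pq: "0 \<le> p" "0 \<le> q" "p + q = 1"
      obtain s c where c: "c \<in> T" "inner ybar c = 0" "x = G' xbar s + c" using x unfolding S_def by blast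
      obtain s' c' where c': "c' \<in> T" "inner ybar c' = 0" "y = G' xbar s' + c'" using y unfolding S_def by blast
      have "G' xbar (p *\<^sub>R s + q *\<^sub>R s') + (p *\<^sub>R c + q *\<^sub>R c') \<in> S"
        by (rule SI[OF convexD[OF T(2) c(1) c'(1) pq]]) (simp add: inner_add_right c c')
      then show "p *\<^sub>R x + q *\<^sub>R y \<in> S"
        by (simp add: c(3) c'(3) blinfun.add_right blinfun.scaleR_right algebra_simps)
    qed
  qed
  moreover have "0 \<notin> (\<lambda>w. w - z) ` S"
  proof
    assume "0 \<in> (\<lambda>w. w - z) ` S"
    then have "z \<in> S" by auto
    then obtain s c where "z = G' xbar s + c" "c \<in> T" "inner ybar c = 0" unfolding S_def by blast
    with z[of c s] show False by simp
  qed
  ultimately have "\<exists>a. a \<noteq> 0 \<and> (\<forall>x\<in>(\<lambda>w. w - z) ` S. 0 \<le> inner a x)"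
    by (rule separating_hyperplane_set_0)
  then obtain a where a0: "a \<noteq> 0" and a: "\<forall>x\<in>(\<lambda>w. w - z) ` S. 0 \<le> inner a x"
    by (elim exE conjE) (rule that)
  have aS: "inner a z \<le> inner a w" if "w \<in> S" for w
    using bspec[OF a imageI[OF that]] by (simp add: inner_diff_right)
  have pos: "inner a (G' xbar s + c) \<ge> 0" if c: "c \<in> T" "inner ybar c = 0" for s c
  proof (rule ccontr)
    assume "\<not> ?thesis"
    then have n: "inner a (G' xbar s + c) < 0" by simp
    \<comment> \<open>Scaling by \<open>m\<close> stays in the cone and pushes the product with \<open>a\<close> below \<open>inner a z\<close>.\<close>
    define m where "m = (\<bar>inner a z\<bar> + 1) / (- inner a (G' xbar s + c))"
    have m: "m \<ge> 0" using n by (simp add: m_def divide_nonneg_neg)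
    have "G' xbar (m *\<^sub>R s) + m *\<^sub>R c \<in> S" by (rule SI[OF scale_T[OF c(1) m]]) (simp add: c(2))
    from aS[OF this] have "inner a z \<le> m * inner a (G' xbar s + c)"
      by (simp add: blinfun.scaleR_right flip: scaleR_add_right)
    also have "\<dots> = - (\<bar>inner a z\<bar> + 1)" using n by (simp add: m_def)
    finally show False by linarith
  qed
  define v where "v = - a"
  have "inner v c \<le> 0" if "c \<in> T" "inner ybar c = 0" for c
    using pos[OF that, of 0] by (simp add: v_def)
  then have vE: "v \<in> closure multiplier_directions" by (rule polar_of_critical)
  have aG: "inner a (G' xbar s) = 0" for s
    using pos[OF T(4), of s] pos[OF T(4), of "- s"] by (simp add: blinfun.minus_right)
  obtain e where e: "\<And>k. e k \<in> multiplier_directions" "e \<longlonglongrightarrow> v"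
    using vE unfolding closure_sequential by blast
  have "inner (adjoint (G' xbar) v) w = 0" for w
    using aG[of w] by (simp add: adjoint_blinfun(2) v_def)
  then have adjv: "adjoint (G' xbar) v = 0" using inner_eq_zero_iff by blast
  obtain \<kappa> where \<kappa>: "\<And>e. e \<in> multiplier_directions \<Longrightarrow> norm e \<le> \<kappa> * norm (adjoint (G' xbar) e)"
    using calm_multiplier_bound[OF calm] by blast
  have "isCont (adjoint (G' xbar)) v"
    using adjoint_blinfun(1)[of "G' xbar"] by (simp add: linear_continuous_at linear_conv_bounded_linear)
  then have "(\<lambda>k. \<kappa> * norm (adjoint (G' xbar) (e k))) \<longlonglongrightarrow> \<kappa> * norm (adjoint (G' xbar) v)"
    by (intro tendsto_mult_left tendsto_norm isCont_tendsto_compose[OF _ e(2)])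
  from LIMSEQ_le[OF tendsto_norm[OF e(2)] this] \<kappa> e(1) have "norm v \<le> 0" by (auto simp: adjv)
  with a0 show False by (simp add: v_def)
qed


text \<open>Suppose \<open>Q d d \<le> 0\<close> for a critical \<open>d \<noteq> 0\<close>, where \<open>Q\<close> is the reduced Hessian.  For \<open>\<Lambda>\<close> large, penalization
  produces KKT points \<open>x\<close> of the problem of minimizing \<open>f x + \<Lambda> \<bar>x - xbar - t d\<bar>\<^sup>2\<close> over the
  unperturbed feasible set; their error \<open>e = x - xbar - t d\<close> satisfies \<open>\<bar>e\<bar> \<le> t \<bar>d\<bar>\<close> by
  comparison with \<open>xbar\<close>.  If \<open>e / t\<close> tends to \<open>\<epsilon>\<close>, local optimality of \<open>xbar\<close> becomes
  \<open>0 \<le> - 1/2 Q (d + \<epsilon>) (d + \<epsilon>) - 2 \<Lambda> <\<epsilon>, d + \<epsilon>>\<close>, while \<open><y, G' d>\<close> being controlled by the curvature gives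
  \<open>- 2 \<Lambda> <\<epsilon>, d> \<le> Q (d + \<epsilon>) d\<close>.  Together, by symmetry of \<open>Q\<close>,
  \<open>0 \<le> 1/2 Q d d - 1/2 Q \<epsilon> \<epsilon> - 2 \<Lambda> \<bar>\<epsilon>\<bar>\<^sup>2\<close>, so \<open>\<epsilon> = 0\<close>.  The residual \<open>- 2 \<Lambda> e\<close> of the KKT system is then
  \<open>o(t)\<close>, although \<open>x - xbar\<close> is of order \<open>t\<close>.\<close>
lemma calm_local_min_imp_sosc:
  assumes calm: kkt_calm
    and locmin: "\<exists>\<delta>>0. \<forall>x. norm (x - xbar) < \<delta> \<longrightarrow> G x \<in> K \<longrightarrow> f xbar \<le> f x"
    and rcq: "\<forall>z. \<exists>s. \<exists>c\<in>T. z = G' xbar s + c"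
  shows reduced_sosc
proof (rule ccontr)
  assume "\<not> reduced_sosc"
  then obtain d where d: "d \<noteq> 0" "G' xbar d \<in> T" "inner ybar (G' xbar d) = 0" "reduced_hessian d d \<le> 0"
    unfolding reduced_sosc_def not_less[symmetric] by blast
  note scq = calm_imp_strict_cq[OF calm]
  obtain \<delta>0 where \<delta>0: "\<delta>0 > 0" "\<And>x. norm (x - xbar) < \<delta>0 \<Longrightarrow> G x \<in> K \<Longrightarrow> f xbar \<le> f x"
    using locmin by blast
  define \<delta> where "\<delta> = \<delta>0 / 2"
  have \<delta>: "\<delta> > 0" using \<delta>0(1) by (simp add: \<delta>_def)
  have lm: "\<forall>x\<in>cball xbar \<delta>. G x \<in> K \<longrightarrow> f xbar \<le> f x"
    using \<delta>0 by (auto simp: \<delta>_def dist_norm norm_minus_commute)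
  have cq: "\<forall>\<eta>\<in>normal_cone K (G xbar). (\<forall>v. inner \<eta> (G' xbar v) = 0) \<longrightarrow> \<eta> = 0"
  proof (intro ballI impI)
    fix \<eta> assume \<eta>: "\<eta> \<in> normal_cone K (G xbar)" "\<forall>v. inner \<eta> (G' xbar v) = 0"
    obtain s c where c: "c \<in> T" "\<eta> = G' xbar s + c" using rcq by blast
    have "inner \<eta> (G' xbar s + c) \<le> 0" using \<eta>(2) normal_cone_imp_polar[OF \<eta>(1) c(1)] by (simp add: inner_add_right)
    then have "inner \<eta> \<eta> \<le> 0" by (simp flip: c(2))
    then show "\<eta> = 0" by (metis inner_ge_zero inner_eq_zero_iff order_antisym)
  qed
  obtain \<rho>0 where \<rho>0: "\<rho>0 > 0" "\<And>x. x \<in> cball xbar \<delta> \<Longrightarrow> f xbar \<le> f x + (norm (x - xbar))\<^sup>2 + \<rho>0 * infdist (G x) K"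
    using exact_penalty[OF closed_K convex_K K_nonempty f_der f'_cont G_der G'_cont A_in \<delta> lm cq] by blast
  define \<rho> where "\<rho> = max \<rho>0 (norm ybar + 1)"
  have \<rho>: "norm ybar < \<rho>" by (simp add: \<rho>_def)
  obtain M where M: "M \<ge> 0" "\<And>e. \<bar>reduced_hessian e e\<bar> \<le> M * (norm e)\<^sup>2"
    using reduced_hessian_bounded by blast
  \<comment> \<open>\<open>\<Lambda> > 1\<close> outweighs the quadratic term of the exact penalty estimate and makes \<open>xbar\<close> a strict minimizer;
    \<open>\<Lambda> \<ge> M\<close> outweighs the reduced Hessian at \<open>\<epsilon>\<close>.\<close>
  define \<Lambda> where "\<Lambda> = 2 + M"
  have \<Lambda>: "\<Lambda> > 1" using M(1) by (simp add: \<Lambda>_def)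
  \<comment> \<open>Up to a constant, \<open>F x - inner (2 \<Lambda> t d) x\<close> is the objective \<open>f x + \<Lambda> (norm (x - xbar - t d))\<^sup>2\<close>, so the
    tilted problem is a linear perturbation of the fixed function \<open>F\<close>.\<close>
  define F where "F x = f x + \<Lambda> * inner (x - xbar) (x - xbar)" for x
  define F' where "F' x = f' x + (2 * \<Lambda>) *\<^sub>R blinfun_inner_right (x - xbar)" for x
  have F'_app: "F' x v = f' x v + 2 * \<Lambda> * inner (x - xbar) v" for x v
    by (simp add: F'_def blinfun.add_left blinfun.scaleR_left)
  have F_der: "(F has_derivative F' x) (at x)" for x
  proof -
    have "((\<lambda>w. f w + \<Lambda> * inner (w - xbar) (w - xbar)) has_derivative (\<lambda>v. f' x v + \<Lambda> * (inner (x - xbar) v + inner v (x - xbar)))) (at x)"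
      by (intro has_derivative_add f_der has_derivative_mult_right has_derivative_inner) (auto intro!: derivative_eq_intros)
    moreover have "(\<lambda>v. f' x v + \<Lambda> * (inner (x - xbar) v + inner v (x - xbar))) = blinfun_apply (F' x)"
      by (simp add: fun_eq_iff F'_app inner_commute[of _ "x - xbar"])
    ultimately show ?thesis by (simp add: F_def[abs_def])
  qed
  have F'_cont: "isCont F' xbar"
    unfolding F'_def
    by (intro continuous_intros f'_cont bounded_linear.continuous[OF bounded_linear_blinfun_inner_right])
  have strict: "\<forall>x\<in>cball xbar \<delta>. x \<noteq> xbar \<longrightarrow> F xbar < F x + \<rho> * infdist (G x) K"
  proof (intro ballI impI)
    fix x assume x: "x \<in> cball xbar \<delta>" "x \<noteq> xbar"
    have "(norm (x - xbar))\<^sup>2 > 0" using x(2) by simp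
    then have "(norm (x - xbar))\<^sup>2 < \<Lambda> * inner (x - xbar) (x - xbar)"
      using \<Lambda> by (simp add: power2_norm_eq_inner)
    moreover have "\<rho>0 * infdist (G x) K \<le> \<rho> * infdist (G x) K"
      by (intro mult_right_mono infdist_nonneg) (simp add: \<rho>_def)
    ultimately show "F xbar < F x + \<rho> * infdist (G x) K"
      using \<rho>0(2)[OF x(1)] by (simp add: F_def)
  qed
  have uniq: "\<forall>y\<in>normal_cone K (G xbar). (\<forall>v. F' xbar v + inner y (G' xbar v) = 0) \<longrightarrow> y = ybar"
    using strict_cq_unique[OF scq] by (simp add: KKT_def F'_app)
  define t0 where "t0 k = inverse (real (Suc k))" for k
  have t0: "\<And>k. t0 k > 0" "t0 \<longlonglongrightarrow> 0"
    unfolding t0_def using LIMSEQ_inverse_real_of_nat by simp_all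
  define a0 where "a0 k = (2 * \<Lambda> * t0 k) *\<^sub>R d" for k
  have "a0 \<longlonglongrightarrow> (2 * \<Lambda> * 0) *\<^sub>R d"
    unfolding a0_def by (intro tendsto_scaleR tendsto_mult tendsto_const t0)
  then have a0: "a0 \<longlonglongrightarrow> 0" by simp
  have b0: "(\<lambda>k. 0::'y) \<longlonglongrightarrow> 0" by simp
  obtain r0 :: "nat \<Rightarrow> nat" and x0 y0 where r0: "strict_mono r0" and x0: "x0 \<longlonglongrightarrow> xbar" and y0: "y0 \<longlonglongrightarrow> ybar"
    and st0: "\<forall>k v. F' (x0 k) v + inner (y0 k) (G' (x0 k) v) = inner (a0 (r0 k)) v"
    and N0: "\<forall>k. y0 k \<in> normal_cone K (G (x0 k) + 0)"
    and min0: "\<forall>k. F (x0 k) - inner (a0 (r0 k)) (x0 k) \<le> F xbar - inner (a0 (r0 k)) xbar + \<rho> * infdist (G xbar + 0) K"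
    using perturbed_kkt_points[OF closed_K convex_K K_nonempty F_der F'_cont G_der G'_cont A_in \<delta> strict uniq \<rho> a0 b0]
    by (elim exE conjE) (rule that)
  have "\<forall>\<^sub>F k in sequentially. norm (x0 k - xbar) < \<delta>0"
    using tendstoD[OF x0 \<delta>0(1)] by (simp add: dist_norm)
  then obtain N1 where N1: "\<And>k. k \<ge> N1 \<Longrightarrow> norm (x0 k - xbar) < \<delta>0"
    unfolding eventually_sequentially by blast
  define t1 x1 y1 where "t1 k = t0 (r0 (k + N1))" and "x1 k = x0 (k + N1)" and "y1 k = y0 (k + N1)" for k
  have t1: "t1 k > 0" for k using t0(1) by (simp add: t1_def)
  have t1lim: "t1 \<longlonglongrightarrow> 0"
    unfolding t1_def
    by (rule LIMSEQ_ignore_initial_segment[where f="\<lambda>k. t0 (r0 k)"])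
       (use LIMSEQ_subseq_LIMSEQ[OF t0(2) r0] in \<open>simp add: o_def\<close>)
  define e1 where "e1 k = x1 k - xbar - t1 k *\<^sub>R d" for k
  have feas1: "G (x1 k) \<in> K" and yN1: "y1 k \<in> normal_cone K (G (x1 k))" for k
    using N0 by (simp_all add: x1_def y1_def normal_cone_def)
  have ge1: "f xbar \<le> f (x1 k)" for k
    using \<delta>0(2)[OF N1 feas1[of k, unfolded x1_def]] by (simp add: x1_def)
  have st1: "f' (x1 k) v + inner (y1 k) (G' (x1 k) v) = - (2 * \<Lambda>) * inner (e1 k) v" for k v
  proof -
    have "F' (x1 k) v + inner (y1 k) (G' (x1 k) v) = inner (a0 (r0 (k + N1))) v"
      using st0 by (simp add: x1_def y1_def)
    then show ?thesis
      by (simp add: F'_app a0_def e1_def t1_def inner_diff_left algebra_simps)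
  qed
  have ne1: "norm (e1 k) \<le> t1 k * norm d" for k
  proof -
    have "F (x1 k) - inner (a0 (r0 (k + N1))) (x1 k) \<le> F xbar - inner (a0 (r0 (k + N1))) xbar"
      using min0 A_in by (simp add: x1_def)
    moreover have "\<Lambda> * inner (e1 k) (e1 k) = \<Lambda> * inner (x1 k - xbar) (x1 k - xbar) - inner (a0 (r0 (k + N1))) (x1 k - xbar) + \<Lambda> * ((t1 k)\<^sup>2 * inner d d)"
      by (simp add: e1_def a0_def t1_def inner_diff_left inner_diff_right inner_commute power2_eq_square algebra_simps)
    ultimately have "\<Lambda> * inner (e1 k) (e1 k) \<le> \<Lambda> * ((t1 k)\<^sup>2 * inner d d)"
      using ge1[of k] by (simp add: F_def inner_diff_right)
    then have "(norm (e1 k))\<^sup>2 \<le> (t1 k * norm d)\<^sup>2"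
      using \<Lambda> by (simp add: power2_norm_eq_inner power_mult_distrib)
    then show ?thesis using t1[of k] by (simp add: power2_le_iff_abs_le)
  qed
  have "norm (e1 k /\<^sub>R t1 k) \<le> norm d" for k
  proof -
    have "norm (e1 k /\<^sub>R t1 k) = inverse (t1 k) * norm (e1 k)"
      using t1[of k] by (simp only: norm_scaleR abs_inverse abs_of_pos)
    also have "\<dots> \<le> inverse (t1 k) * (t1 k * norm d)" using t1[of k] ne1[of k] by (intro mult_left_mono) simp_all
    also have "\<dots> = norm d" using t1[of k] by simp
    finally show ?thesis .
  qed
  then obtain r \<epsilon> where r: "strict_mono r" and \<epsilon>: "(\<lambda>k. e1 (r k) /\<^sub>R t1 (r k)) \<longlonglongrightarrow> \<epsilon>"
    by (rule bounded_sequence_subsequence)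
  define t x y e where "t k = t1 (r k)" and "x k = x1 (r k)" and "y k = y1 (r k)" and "e k = e1 (r k)" for k
  have t: "\<And>k. t k > 0" "t \<longlonglongrightarrow> 0"
    using t1 LIMSEQ_subseq_LIMSEQ[OF t1lim r] by (simp_all add: t_def[abs_def] o_def)
  have et: "(\<lambda>k. e k /\<^sub>R t k) \<longlonglongrightarrow> \<epsilon>" using \<epsilon> by (simp add: e_def t_def)
  have ylim: "y \<longlonglongrightarrow> ybar"
    using LIMSEQ_subseq_LIMSEQ[OF LIMSEQ_ignore_initial_segment[OF y0, of N1] r] by (simp add: y_def[abs_def] y1_def o_def)
  have xlim: "x \<longlonglongrightarrow> xbar"
    using LIMSEQ_subseq_LIMSEQ[OF LIMSEQ_ignore_initial_segment[OF x0, of N1] r] by (simp add: x_def[abs_def] x1_def o_def)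
  have yN: "y k \<in> normal_cone K (G (x k))" and ge: "f xbar \<le> f (x k)"
    and st: "f' (x k) v + inner (y k) (G' (x k) v) = - (2 * \<Lambda>) * inner (e k) v" for k v
    using yN1[of "r k"] ge1[of "r k"] st1[of "r k"] by (simp_all add: x_def y_def e_def)
  define \<sigma> where "\<sigma> = d + \<epsilon>"
  have xd: "(\<lambda>k. (x k - xbar) /\<^sub>R t k) \<longlonglongrightarrow> \<sigma>"
  proof -
    have "(\<lambda>k. d + e k /\<^sub>R t k) \<longlonglongrightarrow> d + \<epsilon>" by (intro tendsto_add tendsto_const et)
    moreover have "d + e k /\<^sub>R t k = (x k - xbar) /\<^sub>R t k" for k
    proof -
      have "x k - xbar = t k *\<^sub>R d + e k" by (simp add: e_def e1_def x_def t_def)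
      then show ?thesis using t(1)[of k] by (simp add: scaleR_add_right)
    qed
    ultimately show ?thesis by (simp only: \<sigma>_def)
  qed
  have Gd: "(\<lambda>k. (G (x k) - G xbar) /\<^sub>R t k) \<longlonglongrightarrow> G' xbar \<sigma>"
    by (rule derivative_along_sequence[OF G_der t xd])
  \<comment> \<open>As \<open>inner (y k) (G (x k) - G xbar)\<close> is known to second order, the decrease of \<open>f\<close> can be read off the
    Lagrangian with multiplier \<open>y k\<close>: \<open>E\<close> is its Taylor remainder at \<open>xbar\<close>, and \<open>D\<close> moves the gradient from \<open>xbar\<close>
    to \<open>x k\<close>, where stationarity evaluates it.\<close>
  define E where "E k = (f (x k) - f xbar - f' xbar (x k - xbar)) /\<^sub>R (t k)\<^sup>2
      + inner (y k) ((G (x k) - G xbar - G' xbar (x k - xbar)) /\<^sub>R (t k)\<^sup>2)" for k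
  have Elim: "E \<longlonglongrightarrow> (1/2) *\<^sub>R f'' \<sigma> \<sigma> + inner ybar ((1/2) *\<^sub>R G'' \<sigma> \<sigma>)"
    unfolding E_def
    by (intro tendsto_add tendsto_inner ylim
        second_order_taylor_along_sequence[OF open_UNIV UNIV_I f_der f'_der t xd]
        second_order_taylor_along_sequence[OF open_UNIV UNIV_I G_der G'_der t xd])
  define D where "D k = ((f' (x k) - f' xbar) /\<^sub>R t k) ((x k - xbar) /\<^sub>R t k)
      + inner (y k) (((G' (x k) - G' xbar) /\<^sub>R t k) ((x k - xbar) /\<^sub>R t k))" for k
  have Dlim: "D \<longlonglongrightarrow> f'' \<sigma> \<sigma> + inner ybar (G'' \<sigma> \<sigma>)"
    unfolding D_def
    by (intro tendsto_add tendsto_inner ylim blinfun.tendsto xd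
        derivative_along_sequence[OF f'_der t xd] derivative_along_sequence[OF G'_der t xd])
  have C2: "(\<lambda>k. inner (y k) (G (x k) - G xbar) / (t k)\<^sup>2) \<longlonglongrightarrow> (1/2) * inner ybar (\<Phi>'' (G' xbar \<sigma>) (G' xbar \<sigma>))"
    by (rule multiplier_second_order_limit[OF yN ylim t Gd])
  have ee: "(\<lambda>k. - (2 * \<Lambda>) * inner (e k /\<^sub>R t k) ((x k - xbar) /\<^sub>R t k)) \<longlonglongrightarrow> - (2 * \<Lambda>) * inner \<epsilon> \<sigma>"
    by (intro tendsto_mult tendsto_const tendsto_inner et xd)
  have id1: "(f (x k) - f xbar) / (t k)\<^sup>2 = E k - D k + - (2 * \<Lambda>) * inner (e k /\<^sub>R t k) ((x k - xbar) /\<^sub>R t k)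
      - inner (y k) (G (x k) - G xbar) / (t k)\<^sup>2" for k
  proof -
    define i where "i = inverse (t k)"
    have i: "inverse ((t k)\<^sup>2) = i * i" by (simp add: i_def power2_eq_square)
    have 1: "E k = (i * i) * ((f (x k) - f xbar - f' xbar (x k - xbar)) + inner (y k) (G (x k) - G xbar - G' xbar (x k - xbar)))"
      by (simp only: E_def i inner_scaleR_right real_scaleR_def distrib_left)
    have 2: "D k = (i * i) * ((f' (x k) (x k - xbar) - f' xbar (x k - xbar)) + inner (y k) (G' (x k) (x k - xbar) - G' xbar (x k - xbar)))"
      by (simp only: D_def i_def[symmetric] inner_scaleR_right real_scaleR_def distrib_left blinfun.scaleR_left blinfun.scaleR_right
          blinfun.diff_left scaleR_scaleR mult.assoc)
    have 3: "- (2 * \<Lambda>) * inner (e k /\<^sub>R t k) ((x k - xbar) /\<^sub>R t k) = (i * i) * (f' (x k) (x k - xbar) + inner (y k) (G' (x k) (x k - xbar)))"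
      by (simp only: st i_def[symmetric] inner_scaleR_right inner_scaleR_left) (simp only: mult_ac)
    show ?thesis
      unfolding 1 2 3 divide_inverse i by (simp add: inner_diff_right algebra_simps)
  qed
  have lim1: "(\<lambda>k. (f (x k) - f xbar) / (t k)\<^sup>2) \<longlonglongrightarrow>
      ((1/2) *\<^sub>R f'' \<sigma> \<sigma> + inner ybar ((1/2) *\<^sub>R G'' \<sigma> \<sigma>)) - (f'' \<sigma> \<sigma> + inner ybar (G'' \<sigma> \<sigma>)) + - (2 * \<Lambda>) * inner \<epsilon> \<sigma>
      - (1/2) * inner ybar (\<Phi>'' (G' xbar \<sigma>) (G' xbar \<sigma>))"
    unfolding id1 by (intro tendsto_diff tendsto_add Elim Dlim ee C2)
  have "0 \<le> ((1/2) *\<^sub>R f'' \<sigma> \<sigma> + inner ybar ((1/2) *\<^sub>R G'' \<sigma> \<sigma>)) - (f'' \<sigma> \<sigma> + inner ybar (G'' \<sigma> \<sigma>)) + - (2 * \<Lambda>) * inner \<epsilon> \<sigma>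
      - (1/2) * inner ybar (\<Phi>'' (G' xbar \<sigma>) (G' xbar \<sigma>))"
    by (rule LIMSEQ_le_const[OF lim1]) (use ge in simp)
  moreover have "(1/2 * p + 1/2 * q) - (p + q) + - (2 * c) * s - 1/2 * w = - (1/2) * (p + q + w) - 2 * c * s" for p q w c s :: real
    by (simp add: field_simps)
  ultimately have I: "0 \<le> - (1/2) * reduced_hessian \<sigma> \<sigma> - 2 * \<Lambda> * inner \<epsilon> \<sigma>"
    by (simp only: reduced_hessian_def inner_scaleR_right real_scaleR_def)
  \<comment> \<open>Stationarity tested with \<open>d\<close>, where \<open>f' xbar d = 0\<close>, bounds \<open>- 2 \<Lambda> \<epsilon>\<close> along \<open>d\<close> by the reduced Hessian.\<close>
  obtain r3 where r3: "r3 \<longlonglongrightarrow> inner ybar (\<Phi>'' (G' xbar \<sigma>) (G' xbar d))" "\<forall>\<^sub>F k in sequentially. inner (y k) (G' xbar d) / t k \<le> r3 k"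
    using multiplier_first_order_bound[OF d(2) yN ylim t Gd] by (elim exE conjE) (rule that)
  have id2: "inner (y k) (G' xbar d) / t k = - (2 * \<Lambda>) * inner (e k /\<^sub>R t k) d
      - (((f' (x k) - f' xbar) /\<^sub>R t k) d + inner (y k) (((G' (x k) - G' xbar) /\<^sub>R t k) d))" for k
  proof -
    have "f' xbar d = 0" using stationary[of d] d(3) by simp
    then have 1: "inner (y k) (G' xbar d) = - (2 * \<Lambda>) * inner (e k) d
      - ((f' (x k) d - f' xbar d) + inner (y k) (G' (x k) d - G' xbar d))"
      using st[of k d] by (simp add: inner_diff_right)
    show ?thesis
      by (simp only: 1 divide_inverse blinfun.scaleR_left blinfun.diff_left inner_scaleR_right inner_scaleR_left real_scaleR_def)
        (simp add: algebra_simps)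
  qed
  have "(\<lambda>k. inner (y k) (G' xbar d) / t k) \<longlonglongrightarrow> - (2 * \<Lambda>) * inner \<epsilon> d - (f'' \<sigma> d + inner ybar (G'' \<sigma> d))"
    unfolding id2
    by (intro tendsto_diff lagrangian_gradient_difference_limit[OF t xd ylim] tendsto_mult tendsto_const tendsto_inner et)
  from tendsto_le[OF sequentially_bot r3(1) this r3(2)]
  have II: "- (2 * \<Lambda>) * inner \<epsilon> d \<le> reduced_hessian \<sigma> d" by (simp add: reduced_hessian_def)
  have "0 \<le> - (1/2) * reduced_hessian \<sigma> \<sigma> + reduced_hessian \<sigma> d - 2 * \<Lambda> * inner \<epsilon> \<epsilon>"
    using I II by (simp add: \<sigma>_def inner_add_right algebra_simps)
  also have "\<dots> = (1/2) * reduced_hessian d d - (1/2) * reduced_hessian \<epsilon> \<epsilon> - 2 * \<Lambda> * inner \<epsilon> \<epsilon>"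
    using reduced_hessian_symmetric[of \<epsilon> d] by (simp add: \<sigma>_def reduced_hessian_add algebra_simps)
  also have "\<dots> \<le> (1/2) * (M * inner \<epsilon> \<epsilon>) - 2 * \<Lambda> * inner \<epsilon> \<epsilon>"
    using d(4) M(2)[of \<epsilon>] by (simp add: power2_norm_eq_inner)
  also have "\<dots> = - ((4 + 3/2 * M) * inner \<epsilon> \<epsilon>)" by (simp add: \<Lambda>_def algebra_simps)
  finally have "(4 + 3/2 * M) * inner \<epsilon> \<epsilon> \<le> 0" by simp
  moreover have "4 + 3/2 * M > 0" using M(1) by simp
  ultimately have "inner \<epsilon> \<epsilon> \<le> 0" by (simp add: mult_le_0_iff)
  then have \<epsilon>0: "\<epsilon> = 0" by (metis inner_ge_zero inner_eq_zero_iff order_antisym)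
  \<comment> \<open>The points \<open>x k\<close> leave \<open>xbar\<close> with speed \<open>t k\<close>, but their residual \<open>a k\<close> is of smaller order.\<close>
  obtain \<kappa> \<gamma> where \<kappa>: "\<kappa> > 0" "\<gamma> > 0"
    and est: "\<And>a b x y. norm a < \<gamma> \<Longrightarrow> norm b < \<gamma> \<Longrightarrow> norm (x - xbar) < \<gamma> \<Longrightarrow>
     norm (y - ybar) < \<gamma> \<Longrightarrow> KKT a b x y \<Longrightarrow> norm (x - xbar) + norm (y - ybar) \<le> \<kappa> * (norm a + norm b)"
    using calm unfolding kkt_calm_def by blast
  define a where "a k = (- (2 * \<Lambda>)) *\<^sub>R e k" for k
  have kkt: "KKT (a k) 0 (x k) (y k)" for k
    using st[of k] yN[of k] by (simp add: KKT_def a_def)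
  have "(\<lambda>k. (- (2 * \<Lambda>)) *\<^sub>R (t k *\<^sub>R (e k /\<^sub>R t k))) \<longlonglongrightarrow> (- (2 * \<Lambda>)) *\<^sub>R (0 *\<^sub>R \<epsilon>)"
    by (intro tendsto_scaleR tendsto_const t et)
  moreover have "t k *\<^sub>R (e k /\<^sub>R t k) = e k" for k using t(1)[of k] by simp
  ultimately have "a \<longlonglongrightarrow> (- (2 * \<Lambda>)) *\<^sub>R (0 *\<^sub>R \<epsilon>)" unfolding a_def[abs_def] by (simp only:)
  then have alim: "a \<longlonglongrightarrow> 0" by simp
  have "\<forall>\<^sub>F k in sequentially. norm ((x k - xbar) /\<^sub>R t k) \<le> \<kappa> * (2 * \<Lambda> * norm (e k /\<^sub>R t k))"
    using tendstoD[OF alim \<kappa>(2)] tendstoD[OF xlim \<kappa>(2)] tendstoD[OF ylim \<kappa>(2)]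
  proof eventually_elim
    case (elim k)
    have "norm (x k - xbar) + norm (y k - ybar) \<le> \<kappa> * (norm (a k) + norm (0::'y))"
      by (rule est[OF _ _ _ _ kkt]) (use elim \<kappa> in \<open>simp_all add: dist_norm\<close>)
    moreover have "norm (a k) + norm (0::'y) = 2 * \<Lambda> * norm (e k)"
      using \<Lambda> by (simp add: a_def abs_mult)
    ultimately have "norm (x k - xbar) + norm (y k - ybar) \<le> \<kappa> * (2 * \<Lambda> * norm (e k))"
      by (simp only:)
    then have "norm (x k - xbar) \<le> \<kappa> * (2 * \<Lambda> * norm (e k))"
      using norm_ge_zero[of "y k - ybar"] by linarith
    then have "inverse (t k) * norm (x k - xbar) \<le> inverse (t k) * (\<kappa> * (2 * \<Lambda> * norm (e k)))"
      using t(1)[of k] by (intro mult_left_mono) simp_all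
    moreover have "norm (w /\<^sub>R t k) = inverse (t k) * norm w" for w :: 'x
      using t(1)[of k] by (simp only: norm_scaleR abs_inverse abs_of_pos)
    ultimately show ?case by (simp only: mult_ac)
  qed
  from tendsto_le[OF sequentially_bot _ tendsto_norm[OF xd] this, of "\<kappa> * (2 * \<Lambda> * norm \<epsilon>)"]
  have "norm \<sigma> \<le> \<kappa> * (2 * \<Lambda> * norm \<epsilon>)"
    using tendsto_mult_left[OF tendsto_mult_left[OF tendsto_norm[OF et], of "2 * \<Lambda>"], of \<kappa>] by blast
  then show False using d(1) by (simp add: \<sigma>_def \<epsilon>0)
qed

end


section \<open>Translation of the conditions\<close>

lemma isolated_calm_pair_iff:
  fixes \<Psi> :: "'a::euclidean_space \<times> 'b::euclidean_space \<Rightarrow> ('c::euclidean_space \<times> 'd::euclidean_space) set"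
  shows "isolated_calm \<Psi> (0, 0) (x0, y0) \<longleftrightarrow> (x0, y0) \<in> \<Psi> (0, 0) \<and>
    (\<exists>\<kappa>>0. \<exists>\<delta>>0. \<forall>a b x y. norm a < \<delta> \<longrightarrow> norm b < \<delta> \<longrightarrow> norm (x - x0) < \<delta> \<longrightarrow> norm (y - y0) < \<delta> \<longrightarrow>
       (x, y) \<in> \<Psi> (a, b) \<longrightarrow> norm (x - x0) + norm (y - y0) \<le> \<kappa> * (norm a + norm b))"
    (is "?L \<longleftrightarrow> _ \<and> ?R")
proof (intro iffI conjI)
  assume ?L
  then show "(x0, y0) \<in> \<Psi> (0, 0)" by (simp add: isolated_calm_def)
  from \<open>?L\<close> obtain \<kappa> U V where \<kappa>: "\<kappa> > 0" and U: "open U" "(0, 0) \<in> U" and V: "open V" "(x0, y0) \<in> V"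
    and calm: "\<And>p. p \<in> U \<Longrightarrow> \<Psi> p \<inter> V \<subseteq> cball (x0, y0) (\<kappa> * norm (p - (0, 0)))"
    unfolding isolated_calm_def by blast
  obtain e1 where e1: "e1 > 0" "ball (0, 0) e1 \<subseteq> U" using U open_contains_ball by blast
  obtain e2 where e2: "e2 > 0" "ball (x0, y0) e2 \<subseteq> V" using V open_contains_ball by blast
  define \<delta> where "\<delta> = min e1 e2 / 2"
  have \<delta>: "\<delta> > 0" using e1 e2 by (simp add: \<delta>_def)
  have "norm (x - x0) + norm (y - y0) \<le> (2 * \<kappa>) * (norm a + norm b)"
    if n: "norm a < \<delta>" "norm b < \<delta>" "norm (x - x0) < \<delta>" "norm (y - y0) < \<delta>" and mem: "(x, y) \<in> \<Psi> (a, b)" for a b x y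
  proof -
    have "norm (a, b) < e1" using norm_Pair_le[of a b] n by (simp add: \<delta>_def)
    then have "(a, b) \<in> U" using e1(2) by (auto simp: dist_norm norm_minus_commute subset_iff)
    have "norm (x - x0, y - y0) < e2" using norm_Pair_le[of "x - x0" "y - y0"] n by (simp add: \<delta>_def)
    then have "(x, y) \<in> ball (x0, y0) e2" by (simp add: dist_norm norm_Pair norm_minus_commute)
    then have "(x, y) \<in> V" using e2(2) by blast
    have "(x, y) \<in> cball (x0, y0) (\<kappa> * norm ((a, b) - (0, 0)))"
      using calm[OF \<open>(a, b) \<in> U\<close>] mem \<open>(x, y) \<in> V\<close> by blast
    then have *: "norm (x - x0, y - y0) \<le> \<kappa> * norm (a, b)" by (simp add: dist_norm norm_Pair norm_minus_commute)
    have "\<kappa> * norm (a, b) \<le> \<kappa> * (norm a + norm b)" using norm_Pair_le[of a b] \<kappa> by simp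
    with * norm_fst_le[of "x - x0" "y - y0"] norm_snd_le[of "y - y0" "x - x0"] show ?thesis by simp
  qed
  then show ?R using \<kappa> \<delta> by (intro exI[of _ "2 * \<kappa>"] conjI exI[of _ \<delta>]) auto
next
  assume "(x0, y0) \<in> \<Psi> (0, 0) \<and> ?R"
  then obtain \<kappa> \<delta> where m: "(x0, y0) \<in> \<Psi> (0, 0)" and \<kappa>: "\<kappa> > 0" "\<delta> > 0"
    and est: "\<And>a b x y. norm a < \<delta> \<Longrightarrow> norm b < \<delta> \<Longrightarrow> norm (x - x0) < \<delta> \<Longrightarrow> norm (y - y0) < \<delta> \<Longrightarrow>
       (x, y) \<in> \<Psi> (a, b) \<Longrightarrow> norm (x - x0) + norm (y - y0) \<le> \<kappa> * (norm a + norm b)"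
    by blast
  have "\<Psi> p \<inter> ball (x0, y0) \<delta> \<subseteq> cball (x0, y0) ((2 * \<kappa>) * norm (p - (0, 0)))" if p: "p \<in> ball (0, 0) \<delta>" for p
  proof
    fix z assume z: "z \<in> \<Psi> p \<inter> ball (x0, y0) \<delta>"
    obtain a b x y where pz: "p = (a, b)" "z = (x, y)" by (cases p, cases z) blast
    have np: "norm (a, b) < \<delta>" using p by (simp add: pz dist_norm norm_Pair)
    have nz: "norm (x - x0, y - y0) < \<delta>" using z by (simp add: pz dist_norm norm_Pair norm_minus_commute)
    have "norm (x - x0) + norm (y - y0) \<le> \<kappa> * (norm a + norm b)"
    proof (rule est)
      show "(x, y) \<in> \<Psi> (a, b)" using z by (simp add: pz)
    qed (use np nz norm_fst_le[of a b] norm_snd_le[of b a] norm_fst_le[of "x - x0" "y - y0"] norm_snd_le[of "y - y0" "x - x0"] in linarith)+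
    moreover have "\<kappa> * (norm a + norm b) \<le> \<kappa> * (2 * norm (a, b))"
      using norm_fst_le[of a b] norm_snd_le[of b a] \<kappa> by (intro mult_left_mono) linarith+
    ultimately have "norm (x - x0, y - y0) \<le> (2 * \<kappa>) * norm (a, b)"
      using norm_Pair_le[of "x - x0" "y - y0"] by simp
    then show "z \<in> cball (x0, y0) ((2 * \<kappa>) * norm (p - (0, 0)))"
      by (simp add: pz dist_norm norm_Pair norm_minus_commute)
  qed
  then show ?L
    unfolding isolated_calm_def using m \<kappa>
    by (intro conjI exI[of _ "2 * \<kappa>"] exI[of _ "ball (0, 0) \<delta>"] exI[of _ "ball (x0, y0) \<delta>"]) auto
qed

lemma grad_eq_iff:
  fixes g :: "'a::euclidean_space \<Rightarrow> real"
  assumes "(g has_derivative D) (at x)"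
  shows "a = grad g x \<longleftrightarrow> (\<forall>v. D v = inner a v)"
proof -
  have lD: "linear D" using assms has_derivative_bounded_linear bounded_linear.linear by blast
  define w where "w = adjoint D 1"
  have w: "D v = inner v w" for v using adjoint_works[OF lD, of v 1] by (simp add: w_def)
  have "GDERIV g x :> w" using assms unfolding gderiv_def w[abs_def, symmetric] by (simp add: w)
  moreover have "u = w" if "GDERIV g x :> u" for u
  proof -
    have "(\<lambda>h. inner h u) = D" using has_derivative_unique[OF that[unfolded gderiv_def] assms] .
    then have "inner (u - w) u = inner (u - w) w" using w by metis
    then show ?thesis by (metis eq_iff_diff_eq_0 inner_diff_right inner_eq_zero_iff)
  qed
  ultimately have g: "grad g x = w" unfolding grad_def by (rule the_equality)
  show ?thesis
  proof
    assume "\<forall>v. D v = inner a v"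
    then have "inner (a - w) a = inner (a - w) w" using w by (metis inner_commute)
    then show "a = grad g x" unfolding g by (metis eq_iff_diff_eq_0 inner_diff_right inner_eq_zero_iff)
  qed (simp add: g w inner_commute)
qed

lemma closest_point_eq_iff_normal:
  fixes K :: "'a::euclidean_space set"
  assumes K: "closed K" "convex K" "K \<noteq> {}"
  shows "B = closest_point K z \<longleftrightarrow> z - B \<in> normal_cone K B"
proof
  assume "B = closest_point K z"
  then show "z - B \<in> normal_cone K B"
    using closest_point_in_set[OF K(1,3)] closest_point_dot[OF K(2,1)] by (simp add: normal_cone_def)
next
  assume N: "z - B \<in> normal_cone K B"
  let ?p = "closest_point K z"
  have p: "?p \<in> K" by (rule closest_point_in_set[OF K(1,3)])
  have "inner (z - B) (?p - B) \<le> 0" using N p by (simp add: normal_cone_def)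
  moreover have "inner (z - ?p) (B - ?p) \<le> 0"
    using N by (intro closest_point_dot[OF K(2,1)]) (simp add: normal_cone_def)
  ultimately have "inner (?p - B) (?p - B) \<le> 0"
    by (simp add: inner_diff_left inner_diff_right inner_commute)
  then show "B = ?p" by (metis eq_iff_diff_eq_0 inner_ge_zero inner_eq_zero_iff order_antisym)
qed

context kkt_chart
begin

lemma frechet_G: "frechet_derivative G (at x) = G' x"
  by (rule frechet_derivative_at[OF G_der, symmetric])

lemma frechet_f: "frechet_derivative f (at x) = f' x"
  by (rule frechet_derivative_at[OF f_der, symmetric])

lemma lagrangian_der: "(lagrangian f G y has_derivative (\<lambda>v. f' x v + inner y (G' x v))) (at x)"
  unfolding lagrangian_def[abs_def]
  by (intro has_derivative_add f_der has_derivative_inner_right G_der)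

lemma S_KKT_iff: "(x, y) \<in> S_KKT f G K (a, b) \<longleftrightarrow> KKT a b x y"
  by (simp add: S_KKT_def KKT_def grad_eq_iff[OF lagrangian_der])

lemma multipliers_iff: "y \<in> multipliers f G K xbar 0 0 \<longleftrightarrow> KKT 0 0 xbar y"
  by (simp add: multipliers_def S_KKT_iff)

lemma hessian_lagrangian: "inner d (hessian (lagrangian f G y) xbar d) = f'' d d + inner y (G'' d d)"
proof -
  have rep: "g w = inner (\<Sum>b\<in>Basis. g b *\<^sub>R b) w" if "linear g" for g :: "'x \<Rightarrow> real" and w
  proof -
    have "g w = g (\<Sum>b\<in>Basis. inner w b *\<^sub>R b)" by (simp only: euclidean_representation)
    also have "\<dots> = (\<Sum>b\<in>Basis. inner w b *\<^sub>R g b)" by (simp only: linear_sum[OF that] linear_scale[OF that])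
    also have "\<dots> = inner (\<Sum>b\<in>Basis. g b *\<^sub>R b) w" by (simp add: inner_sum_left inner_commute[of w] mult.commute)
    finally show ?thesis .
  qed
  have grad: "grad (lagrangian f G y) = (\<lambda>x. \<Sum>b\<in>Basis. (f' x b + inner y (G' x b)) *\<^sub>R b)"
  proof
    fix x
    have "linear (\<lambda>v. f' x v + inner y (G' x v))"
      using lagrangian_der has_derivative_bounded_linear bounded_linear.linear by blast
    from rep[OF this] show "grad (lagrangian f G y) x = (\<Sum>b\<in>Basis. (f' x b + inner y (G' x b)) *\<^sub>R b)"
      using grad_eq_iff[OF lagrangian_der] by metis
  qed
  have "((\<lambda>x. \<Sum>b\<in>Basis. (f' x b + inner y (G' x b)) *\<^sub>R b) has_derivative
      (\<lambda>d. \<Sum>b\<in>Basis. (f'' d b + inner y (G'' d b)) *\<^sub>R b)) (at xbar)"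
    by (intro has_derivative_sum has_derivative_scaleR_left has_derivative_add has_derivative_inner_right
        bounded_linear.has_derivative[OF blinfun.bounded_linear_left] f'_der G'_der)
  from frechet_derivative_at[OF this]
  have H: "hessian (lagrangian f G y) xbar d = (\<Sum>b\<in>Basis. (f'' d b + inner y (G'' d b)) *\<^sub>R b)"
    by (simp add: hessian_def grad fun_eq_iff)
  have "linear (\<lambda>v. f'' d v + inner y (G'' d v))"
    by (rule linearI) (simp_all add: blinfun.add_right blinfun.scaleR_right inner_add_right algebra_simps)
  from rep[OF this, of d] show ?thesis by (simp add: H inner_commute)
qed

lemma SRCQ_iff: "SRCQ G K xbar ybar \<longleftrightarrow> strict_cq"
proof -
  have "SRCQ G K xbar ybar \<longleftrightarrow> (\<forall>z. \<exists>s. \<exists>c\<in>T \<inter> {z. inner z ybar = 0}. z = G' xbar s + c)"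
    unfolding SRCQ_def frechet_G tangent_cone_eq set_plus_def by blast
  then show ?thesis unfolding strict_cq_def by (simp add: inner_commute Bex_def conj_assoc)
qed

lemma RCQ_iff: "RCQ G K xbar \<longleftrightarrow> (\<forall>z. \<exists>s. \<exists>c\<in>T. z = G' xbar s + c)"
  unfolding RCQ_def frechet_G tangent_cone_eq set_plus_def by blast

lemma critical_cone_iff: "d \<in> critical_cone f G K xbar \<longleftrightarrow> G' xbar d \<in> T \<and> inner ybar (G' xbar d) = 0"
  using stationary[of d] normal_cone_imp_polar[OF ybar_N, of "G' xbar d"]
  by (auto simp: critical_cone_def frechet_G frechet_f tangent_cone_eq)

text \<open>By the expansion along the fixed multiplier \<open>ybar\<close>, no second order tangent has a larger product
  with \<open>ybar\<close> than the acceleration of the chart curve.\<close>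
lemma support_second_order:
  assumes h: "h \<in> T" "inner ybar h = 0"
  shows "support_fun ybar (second_order_tangent_set K (G xbar) h) = ereal (- inner ybar (\<Phi>'' h h))"
  unfolding support_fun_def
proof (rule antisym)
  show "(SUP z\<in>second_order_tangent_set K (G xbar) h. ereal (inner ybar z)) \<le> ereal (- inner ybar (\<Phi>'' h h))"
  proof (rule SUP_least)
    fix w assume "w \<in> second_order_tangent_set K (G xbar) h"
    then obtain t :: "nat \<Rightarrow> real" where t: "\<And>k. 0 < t k" "t \<longlonglongrightarrow> 0"
      and o: "(\<lambda>k. infdist (G xbar + t k *\<^sub>R h + ((t k)\<^sup>2 / 2) *\<^sub>R w) K) \<in> o(\<lambda>k. (t k)\<^sup>2)"
      unfolding second_order_tangent_set_def by blast
    define P where "P k = G xbar + t k *\<^sub>R h + ((t k)\<^sup>2 / 2) *\<^sub>R w" for k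
    define B where "B k = closest_point K (P k)" for k
    have BK: "B k \<in> K" for k by (simp add: B_def closest_point_in_set closed_K K_nonempty)
    define u where "u k = (B k - P k) /\<^sub>R (t k)\<^sup>2" for k
    have t2: "(t k)\<^sup>2 > 0" for k using t(1)[of k] by simp
    have nu: "norm (u k) = infdist (P k) K / (t k)\<^sup>2" for k
    proof -
      have "norm (u k) = inverse ((t k)\<^sup>2) * norm (B k - P k)"
        unfolding u_def using t2[of k] by (simp only: norm_scaleR abs_inverse abs_of_pos)
      then show ?thesis
        by (simp add: B_def infdist_eq_dist_closest_point[OF closed_K K_nonempty] norm_minus_commute divide_inverse mult.commute)
    qed
    have "(\<lambda>k. infdist (P k) K / (t k)\<^sup>2) \<longlonglongrightarrow> 0"
      by (rule smalloD_tendsto) (use o in \<open>simp add: P_def\<close>)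
    then have u0: "u \<longlonglongrightarrow> 0" by (simp only: nu[symmetric] tendsto_norm_zero_iff)
    have Beq: "B k - G xbar = t k *\<^sub>R h + (t k)\<^sup>2 *\<^sub>R ((1/2) *\<^sub>R w + u k)" for k
    proof -
      have "(t k)\<^sup>2 *\<^sub>R u k = B k - P k" using t2[of k] by (simp add: u_def)
      then show ?thesis by (simp add: P_def scaleR_add_right algebra_simps)
    qed
    have "(\<lambda>k. h + t k *\<^sub>R ((1/2) *\<^sub>R w + u k)) \<longlonglongrightarrow> h + 0 *\<^sub>R ((1/2) *\<^sub>R w + 0)"
      by (intro tendsto_add tendsto_scaleR tendsto_const t u0)
    moreover have "h + t k *\<^sub>R ((1/2) *\<^sub>R w + u k) = (B k - G xbar) /\<^sub>R t k" for k
    proof -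
      have "(B k - G xbar) /\<^sub>R t k = (t k *\<^sub>R (h + t k *\<^sub>R ((1/2) *\<^sub>R w + u k))) /\<^sub>R t k"
        unfolding Beq by (simp only: scaleR_add_right scaleR_scaleR power2_eq_square mult_ac)
      then show ?thesis using t(1)[of k] by simp
    qed
    ultimately have Bh: "(\<lambda>k. (B k - G xbar) /\<^sub>R t k) \<longlonglongrightarrow> h" by (simp only: scaleR_zero_left add_0_right)
    obtain r1 where r1: "r1 \<longlonglongrightarrow> - (1/2) * inner ybar (\<Phi>'' h h)" "\<forall>\<^sub>F k in sequentially. inner ybar (B k - G xbar) / (t k)\<^sup>2 \<le> r1 k"
      using fixed_multiplier_second_order_bound[OF ybar_N BK t Bh] by (elim exE conjE) (rule that)
    have eq: "inner ybar (B k - G xbar) / (t k)\<^sup>2 = inner ybar ((1/2) *\<^sub>R w + u k)" for k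
      unfolding Beq using t2[of k] by (simp add: inner_add_right h(2))
    have "(\<lambda>k. inner ybar ((1/2) *\<^sub>R w + u k)) \<longlonglongrightarrow> inner ybar ((1/2) *\<^sub>R w + 0)"
      by (intro tendsto_inner tendsto_add tendsto_const u0)
    from tendsto_le[OF sequentially_bot r1(1) this] r1(2)[unfolded eq]
    have "inner ybar ((1/2) *\<^sub>R w + 0) \<le> - (1/2) * inner ybar (\<Phi>'' h h)" by blast
    then show "ereal (inner ybar w) \<le> ereal (- inner ybar (\<Phi>'' h h))" by simp
  qed
  show "ereal (- inner ybar (\<Phi>'' h h)) \<le> (SUP z\<in>second_order_tangent_set K (G xbar) h. ereal (inner ybar z))"
    using SUP_upper[OF second_order_tangent[OF h(1)], of "\<lambda>z. ereal (inner ybar z)"] by simp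
qed

text \<open>Under the strict qualification the supremum over multipliers runs over \<open>ybar\<close> alone.\<close>
lemma SOSC_iff:
  assumes "strict_cq"
  shows "SOSC f G K xbar \<longleftrightarrow> reduced_sosc"
proof -
  have M: "multipliers f G K xbar 0 0 = {ybar}"
    using strict_cq_unique[OF assms] KKT_base multipliers_iff by blast
  have "(SUP y \<in> multipliers f G K xbar 0 0.
           ereal (inner d (hessian (lagrangian f G y) xbar d))
           - support_fun y (second_order_tangent_set K (G xbar) (frechet_derivative G (at xbar) d))) = ereal (reduced_hessian d d)"
    if "G' xbar d \<in> T" "inner ybar (G' xbar d) = 0" for d
    by (simp add: M frechet_G hessian_lagrangian support_second_order[OF that] reduced_hessian_def)
  then show ?thesis
    unfolding SOSC_def reduced_sosc_def by (auto simp: critical_cone_iff)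
qed

lemma kkt_calm_iff: "isolated_calm (S_KKT f G K) (0, 0) (xbar, ybar) \<longleftrightarrow> kkt_calm"
  by (simp add: isolated_calm_pair_iff S_KKT_iff kkt_calm_def KKT_base)

lemma locally_optimal_iff:
  "locally_optimal f G K 0 0 xbar \<longleftrightarrow> (\<exists>\<delta>>0. \<forall>x. norm (x - xbar) < \<delta> \<longrightarrow> G x \<in> K \<longrightarrow> f xbar \<le> f x)"
proof
  assume "locally_optimal f G K 0 0 xbar"
  then obtain U where U: "open U" "xbar \<in> U" "\<And>x'. x' \<in> U \<Longrightarrow> G x' \<in> K \<Longrightarrow> f xbar \<le> f x'"
    by (auto simp: locally_optimal_def feasible_def)
  obtain \<delta> where "\<delta> > 0" "ball xbar \<delta> \<subseteq> U" using U open_contains_ball by blast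
  then show "\<exists>\<delta>>0. \<forall>x. norm (x - xbar) < \<delta> \<longrightarrow> G x \<in> K \<longrightarrow> f xbar \<le> f x"
    using U(3) by (intro exI[of _ \<delta>]) (auto simp: dist_norm norm_minus_commute subset_iff)
next
  assume "\<exists>\<delta>>0. \<forall>x. norm (x - xbar) < \<delta> \<longrightarrow> G x \<in> K \<longrightarrow> f xbar \<le> f x"
  then obtain \<delta> where \<delta>: "\<delta> > 0" "\<And>x. norm (x - xbar) < \<delta> \<Longrightarrow> G x \<in> K \<Longrightarrow> f xbar \<le> f x" by blast
  then show "locally_optimal f G K 0 0 xbar"
    using A_in unfolding locally_optimal_def feasible_def
    by (intro conjI exI[of _ "ball xbar \<delta>"]) (auto simp: dist_norm norm_minus_commute)
qed

lemma sosc_imp_locally_optimal: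
  assumes reduced_sosc
  shows "locally_optimal f G K 0 0 xbar"
proof -
  obtain \<delta> where \<delta>: "\<delta> > 0" "\<forall>x\<in>cball xbar \<delta>. x \<noteq> xbar \<longrightarrow> f xbar < f x + (norm ybar + 1) * infdist (G x) K"
    using sosc_imp_penalty_strict_min[OF assms, of "norm ybar + 1"] by auto
  have "f xbar \<le> f x" if "norm (x - xbar) < \<delta>" "G x \<in> K" for x
    using bspec[OF \<delta>(2), of x] that by (cases "x = xbar") (simp_all add: dist_norm norm_minus_commute)
  then show ?thesis unfolding locally_optimal_iff using \<delta>(1) by blast
qed

lemma strict_cq_sosc_imp_robust:
  assumes strict_cq reduced_sosc
  shows "robustly_isolated_calm (S_KKT f G K) (0, 0) (xbar, ybar)"
proof -
  have "isolated_calm (S_KKT f G K) (0, 0) (xbar, ybar)"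
    using strict_cq_sosc_imp_calm[OF assms] by (simp add: kkt_calm_iff)
  then obtain \<kappa> U V where m: "(xbar, ybar) \<in> S_KKT f G K (0, 0)" and \<kappa>: "\<kappa> > 0" and U: "open U" "(0, 0) \<in> U"
    and V: "open V" "(xbar, ybar) \<in> V"
    and calm: "\<And>p. p \<in> U \<Longrightarrow> S_KKT f G K p \<inter> V \<subseteq> cball (xbar, ybar) (\<kappa> * norm (p - (0, 0)))"
    unfolding isolated_calm_def by blast
  obtain e where e: "e > 0" "ball (xbar, ybar) e \<subseteq> V" using V open_contains_ball by blast
  have "e / 2 > 0" using e by simp
  from strict_cq_sosc_imp_solvable[OF assms this]
  obtain \<gamma> where \<gamma>: "\<gamma> > 0" "\<And>a b. norm a < \<gamma> \<Longrightarrow> norm b < \<gamma> \<Longrightarrow>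
      \<exists>x y. norm (x - xbar) < e / 2 \<and> norm (y - ybar) < e / 2 \<and> KKT a b x y" by blast
  have "S_KKT f G K p \<inter> V \<noteq> {}" if "p \<in> ball (0, 0) \<gamma>" for p
  proof -
    obtain a b where p: "p = (a, b)" by (cases p)
    have "norm (a, b) < \<gamma>" using that by (simp add: p dist_norm norm_Pair)
    then have "norm a < \<gamma>" "norm b < \<gamma>" using norm_fst_le[of a b] norm_snd_le[of b a] by linarith+
    from \<gamma>(2)[OF this] obtain x y where xy: "norm (x - xbar) < e / 2" "norm (y - ybar) < e / 2" "KKT a b x y" by blast
    have "norm (x - xbar, y - ybar) < e" using norm_Pair_le[of "x - xbar" "y - ybar"] xy by simp
    then have "(x, y) \<in> ball (xbar, ybar) e" by (simp add: dist_norm norm_Pair norm_minus_commute)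
    then have "(x, y) \<in> V" using e(2) by blast
    moreover have "(x, y) \<in> S_KKT f G K p" using xy(3) by (simp add: p S_KKT_iff)
    ultimately show ?thesis by blast
  qed
  with m \<kappa> U V calm \<gamma>(1) show ?thesis
    unfolding robustly_isolated_calm_def
    by (intro conjI exI[of _ \<kappa>] exI[of _ "U \<inter> ball (0, 0) \<gamma>"] exI[of _ V]) auto
qed

text \<open>With \<open>B = G x - b\<close>, the second component of \<open>F(x, y) = (a, b)\<close> says that \<open>B\<close> is the projection of \<open>G x + y\<close>,
  that is, that \<open>G x + y - B = y + b\<close> is normal to \<open>K\<close> at \<open>B\<close>.\<close>
lemma KKT_map_inv_iff:
  "(x, y) \<in> KKT_map_inv f G K (a, b) \<longleftrightarrow> KKT (a + adjoint (G' x) b) (- b) x (y + b)"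
proof -
  have "G x - closest_point K (G x + y) = b \<longleftrightarrow> G x - b = closest_point K (G x + y)" by (simp add: diff_eq_eq add.commute)
  also have "\<dots> \<longleftrightarrow> y + b \<in> normal_cone K (G x - b)"
    by (simp add: closest_point_eq_iff_normal[OF closed_K convex_K K_nonempty] algebra_simps)
  finally have 1: "G x - closest_point K (G x + y) = b \<longleftrightarrow> y + b \<in> normal_cone K (G x + - b)" by simp
  have "grad f x + adjoint (G' x) y = a \<longleftrightarrow> a - adjoint (G' x) y = grad f x" by (auto simp: diff_eq_eq)
  also have "\<dots> \<longleftrightarrow> (\<forall>v. f' x v + inner (y + b) (G' x v) = inner (a + adjoint (G' x) b) v)"
    unfolding grad_eq_iff[OF f_der] by (simp add: inner_diff_left inner_add_left adjoint_blinfun(2) algebra_simps)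
  finally have 2: "grad f x + adjoint (G' x) y = a \<longleftrightarrow> (\<forall>v. f' x v + inner (y + b) (G' x v) = inner (a + adjoint (G' x) b) v)" .
  show ?thesis by (simp add: KKT_map_inv_def KKT_map_def frechet_G 1 2 KKT_def)
qed

lemma adjoint_bound: "\<exists>C\<ge>0. \<exists>\<delta>>0. \<forall>x b. norm (x - xbar) < \<delta> \<longrightarrow> norm (adjoint (G' x) b) \<le> C * norm b"
proof -
  have "(G' \<longlongrightarrow> G' xbar) (at xbar)" using G'_cont by (simp add: isCont_def)
  then obtain \<delta> where \<delta>: "\<delta> > 0" "\<And>x. x \<noteq> xbar \<Longrightarrow> dist x xbar < \<delta> \<Longrightarrow> dist (G' x) (G' xbar) < 1"
    unfolding tendsto_iff eventually_at by (metis UNIV_I zero_less_one)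
  define C where "C = norm (G' xbar) + 1"
  have "norm (adjoint (G' x) b) \<le> C * norm b" if x: "norm (x - xbar) < \<delta>" for x b
  proof -
    have "norm (G' x) \<le> C"
      using \<delta>(2)[of x] x norm_triangle_sub[of "G' x" "G' xbar"]
      by (cases "x = xbar") (auto simp: C_def dist_norm)
    let ?w = "adjoint (G' x) b"
    have "norm ?w * norm ?w = inner b (G' x ?w)"
      by (simp add: dot_square_norm power2_eq_square flip: adjoint_blinfun(2))
    also have "\<dots> \<le> norm b * norm (G' x ?w)" by (rule norm_cauchy_schwarz)
    also have "\<dots> \<le> norm b * (norm (G' x) * norm ?w)" by (intro mult_left_mono norm_blinfun norm_ge_zero)
    also have "\<dots> \<le> norm b * (C * norm ?w)" by (intro mult_left_mono mult_right_mono \<open>norm (G' x) \<le> C\<close> norm_ge_zero)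
    finally have "norm ?w * norm ?w \<le> (C * norm b) * norm ?w" by (simp add: mult_ac)
    then show ?thesis
      by (cases "norm ?w = 0") (auto simp: C_def mult_le_cancel_right)
  qed
  then show ?thesis using \<delta>(1) by (intro exI[of _ C]) (auto simp: C_def)
qed

text \<open>The substitution \<open>(a, b, y) \<mapsto> (a + G'(x)\<^sup>* b, - b, y + b)\<close> is an involution with Lipschitz estimates
  uniform in \<open>x\<close> near \<open>xbar\<close>.  It exchanges the KKT system with the equation for \<open>F\<close>, so one transfer
  lemma serves both directions.\<close>
lemma calm_change_of_residual:
  fixes P P' :: "'x \<Rightarrow> 'y \<Rightarrow> 'x \<Rightarrow> 'y \<Rightarrow> bool"
  assumes imp: "\<And>a b x y. P' a b x y \<Longrightarrow> P (a + adjoint (G' x) b) (- b) x (y + b)"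
    and calm: "\<exists>\<kappa>>0. \<exists>\<delta>>0. \<forall>a b x y. norm a < \<delta> \<longrightarrow> norm b < \<delta> \<longrightarrow> norm (x - xbar) < \<delta> \<longrightarrow>
     norm (y - ybar) < \<delta> \<longrightarrow> P a b x y \<longrightarrow> norm (x - xbar) + norm (y - ybar) \<le> \<kappa> * (norm a + norm b)"
  shows "\<exists>\<kappa>>0. \<exists>\<delta>>0. \<forall>a b x y. norm a < \<delta> \<longrightarrow> norm b < \<delta> \<longrightarrow> norm (x - xbar) < \<delta> \<longrightarrow>
     norm (y - ybar) < \<delta> \<longrightarrow> P' a b x y \<longrightarrow> norm (x - xbar) + norm (y - ybar) \<le> \<kappa> * (norm a + norm b)"
proof -
  obtain \<kappa> \<delta> where \<kappa>: "\<kappa> > 0" "\<delta> > 0"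
    and est: "\<And>a b x y. norm a < \<delta> \<Longrightarrow> norm b < \<delta> \<Longrightarrow> norm (x - xbar) < \<delta> \<Longrightarrow>
     norm (y - ybar) < \<delta> \<Longrightarrow> P a b x y \<Longrightarrow> norm (x - xbar) + norm (y - ybar) \<le> \<kappa> * (norm a + norm b)"
    using calm by blast
  obtain C \<delta>1 where C: "C \<ge> 0" "\<delta>1 > 0" "\<And>x b. norm (x - xbar) < \<delta>1 \<Longrightarrow> norm (adjoint (G' x) b) \<le> C * norm b"
    using adjoint_bound by blast
  \<comment> \<open>The substitution enlarges the data by a factor of at most \<open>2 + C\<close>.\<close>
  define \<delta>2 where "\<delta>2 = min \<delta>1 (\<delta> / (2 + C))"
  have \<delta>2: "\<delta>2 > 0" using C \<kappa> by (simp add: \<delta>2_def)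
  have "\<delta>2 * (2 + C) \<le> \<delta> / (2 + C) * (2 + C)" using C by (intro mult_right_mono) (simp_all add: \<delta>2_def)
  also have "\<dots> = \<delta>" using C by simp
  finally have \<delta>2C: "2 * \<delta>2 + C * \<delta>2 \<le> \<delta>" by (simp add: algebra_simps)
  have C\<delta>: "C * \<delta>2 \<ge> 0" using C \<delta>2 by simp
  have "norm (x - xbar) + norm (y - ybar) \<le> (\<kappa> * (2 + C) + 1) * (norm a + norm b)"
    if n: "norm a < \<delta>2" "norm b < \<delta>2" "norm (x - xbar) < \<delta>2" "norm (y - ybar) < \<delta>2" and P': "P' a b x y" for a b x y
  proof -
    let ?a = "a + adjoint (G' x) b"
    have "norm ?a \<le> norm a + norm (adjoint (G' x) b)" by (rule norm_triangle_ineq)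
    also have "\<dots> \<le> norm a + C * norm b" using C(3)[of x b] n(3) by (simp add: \<delta>2_def)
    finally have na: "norm ?a \<le> norm a + C * norm b" .
    have Cb: "C * norm b \<le> C * \<delta>2" using n(2) C(1) by (simp add: mult_left_mono)
    have ny: "norm (y + b - ybar) \<le> norm (y - ybar) + norm b"
      using norm_triangle_ineq[of "y - ybar" b] by (simp add: algebra_simps)
    have "norm (x - xbar) + norm (y + b - ybar) \<le> \<kappa> * (norm ?a + norm (- b))"
    proof (rule est[OF _ _ _ _ imp[OF P']])
      show "norm ?a < \<delta>" using na Cb n(1) \<delta>2C \<delta>2 by linarith
      show "norm (- b) < \<delta>" using n(2) \<delta>2C \<delta>2 C\<delta> unfolding norm_minus_cancel by linarith
      show "norm (x - xbar) < \<delta>" using n(3) \<delta>2C \<delta>2 C\<delta> by linarith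
      show "norm (y + b - ybar) < \<delta>" using ny n(2,4) \<delta>2C C\<delta> by linarith
    qed
    also have "\<dots> \<le> \<kappa> * ((2 + C) * (norm a + norm b))"
    proof (rule mult_left_mono)
      have "0 \<le> C * norm a" using C(1) by simp
      moreover have "(2 + C) * (norm a + norm b) = 2 * norm a + 2 * norm b + C * norm a + C * norm b"
        by (simp add: algebra_simps)
      ultimately show "norm ?a + norm (- b) \<le> (2 + C) * (norm a + norm b)"
        using na norm_ge_zero[of a] norm_ge_zero[of b] unfolding norm_minus_cancel by linarith
    qed (use \<kappa> in simp)
    finally have 1: "norm (x - xbar) + norm (y + b - ybar) \<le> \<kappa> * (2 + C) * (norm a + norm b)" by (simp only: mult.assoc)
    have 2: "norm (y - ybar) \<le> norm (y + b - ybar) + norm b"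
      using norm_triangle_ineq4[of "y + b - ybar" b] by (simp add: algebra_simps)
    have "(\<kappa> * (2 + C) + 1) * (norm a + norm b) = \<kappa> * (2 + C) * (norm a + norm b) + (norm a + norm b)"
      by (simp add: distrib_right)
    with 1 2 norm_ge_zero[of a] show ?thesis by linarith
  qed
  moreover have "\<kappa> * (2 + C) + 1 > 0" using \<kappa> C by (simp add: add_nonneg_pos)
  ultimately show ?thesis using \<delta>2 by blast
qed

lemma KKT_map_inv_calm_iff:
  "isolated_calm (KKT_map_inv f G K) (0, 0) (xbar, ybar) \<longleftrightarrow> kkt_calm"
proof -
  have m: "(xbar, ybar) \<in> KKT_map_inv f G K (0, 0)"
    by (simp add: KKT_map_inv_iff linear_0[OF adjoint_blinfun(1)] KKT_base)
  have reverse: "(x, y + b) \<in> KKT_map_inv f G K (a + adjoint (G' x) b, - b)" if "KKT a b x y" for a b x y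
    using that by (simp add: KKT_map_inv_iff linear_neg[OF adjoint_blinfun(1)])
  show ?thesis
  proof
    assume "isolated_calm (KKT_map_inv f G K) (0, 0) (xbar, ybar)"
    then show kkt_calm
      unfolding isolated_calm_pair_iff kkt_calm_def
      by (elim conjE) (rule calm_change_of_residual[where P="\<lambda>a b x y. (x, y) \<in> KKT_map_inv f G K (a, b)"], rule reverse)
  next
    assume kkt_calm
    then show "isolated_calm (KKT_map_inv f G K) (0, 0) (xbar, ybar)"
      unfolding isolated_calm_pair_iff kkt_calm_def
      by (intro conjI m) (rule calm_change_of_residual[where P=KKT], rule iffD1[OF KKT_map_inv_iff])
  qed
qed

lemma SRCQ_SOSC_imp_robust:
  assumes "SRCQ G K xbar ybar" and "SOSC f G K xbar"
  shows "locally_optimal f G K 0 0 xbar \<and> robustly_isolated_calm (S_KKT f G K) (0, 0) (xbar, ybar)"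
proof -
  have s: strict_cq using assms(1) by (simp add: SRCQ_iff)
  then have r: reduced_sosc using assms(2) by (simp add: SOSC_iff)
  from sosc_imp_locally_optimal[OF r] strict_cq_sosc_imp_robust[OF s r] show ?thesis ..
qed

lemma isolated_calm_imp_SRCQ_SOSC:
  assumes "RCQ G K xbar" and opt: "locally_optimal f G K 0 0 xbar"
    and "isolated_calm (S_KKT f G K) (0, 0) (xbar, ybar)"
  shows "SRCQ G K xbar ybar \<and> SOSC f G K xbar"
proof -
  have c: kkt_calm using assms(3) by (simp add: kkt_calm_iff)
  have s: strict_cq by (rule calm_imp_strict_cq[OF c])
  have reduced_sosc
    by (rule calm_local_min_imp_sosc[OF c opt[unfolded locally_optimal_iff] assms(1)[unfolded RCQ_iff]])
  with s show ?thesis by (simp add: SRCQ_iff SOSC_iff)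
qed

end


section \<open>The characterization\<close>

theorem theorem24:
  fixes f :: "'x::euclidean_space \<Rightarrow> real"
    and G :: "'x \<Rightarrow> 'y::euclidean_space"
    and K :: "'y set"
    and xbar :: 'x and ybar :: 'y
  assumes f_C2: "twice_cont_diff_on f UNIV"
    and G_C2: "twice_cont_diff_on G UNIV"
    and K: "K \<noteq> {}" "closed K" "convex K"
    and reducible: "C2_cone_reducible K"
    and feas: "feasible G K 0 xbar"
    and rcq: "RCQ G K xbar"
    and mult: "ybar \<in> multipliers f G K xbar 0 0"
  shows "((SRCQ G K xbar ybar \<and> SOSC f G K xbar)
         \<longleftrightarrow> (locally_optimal f G K 0 0 xbar \<and>
           robustly_isolated_calm (S_KKT f G K) (0, 0) (xbar, ybar))) \<and>
         ((locally_optimal f G K 0 0 xbar \<and>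
           robustly_isolated_calm (S_KKT f G K) (0, 0) (xbar, ybar))
         \<longleftrightarrow> (locally_optimal f G K 0 0 xbar \<and>
           isolated_calm (S_KKT f G K) (0, 0) (xbar, ybar))) \<and>
         ((locally_optimal f G K 0 0 xbar \<and>
           isolated_calm (S_KKT f G K) (0, 0) (xbar, ybar))
         \<longleftrightarrow> (locally_optimal f G K 0 0 xbar \<and>
           isolated_calm (KKT_map_inv f G K) (0, 0) (xbar, ybar)))"
proof -
  have A: "G xbar \<in> K" using feas by (simp add: feasible_def)
  obtain \<Phi> \<Phi>' \<Phi>'' T U V \<Psi> where chart: "cone_chart K (G xbar) \<Phi> \<Phi>' \<Phi>'' T U V \<Psi>"
    using C2_cone_reducible_chart[OF K(2,3) reducible A] by blast
  obtain f' f'' where f: "\<And>x. (f has_derivative blinfun_apply (f' x)) (at x)"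
    "\<And>x. (f' has_derivative blinfun_apply (f'' x)) (at x)"
    using f_C2 unfolding twice_cont_diff_on_def by blast
  obtain G' G'' where G: "\<And>x. (G has_derivative blinfun_apply (G' x)) (at x)"
    "\<And>x. (G' has_derivative blinfun_apply (G'' x)) (at x)"
    using G_C2 unfolding twice_cont_diff_on_def by blast
  have "(lagrangian f G ybar has_derivative (\<lambda>v. f' xbar v + inner ybar (G' xbar v))) (at xbar)"
    unfolding lagrangian_def[abs_def]
    by (intro has_derivative_add f has_derivative_inner_right G)
  from iffD1[OF grad_eq_iff[OF this]]
  have "\<And>v. f' xbar v + inner ybar (G' xbar v) = 0" "ybar \<in> normal_cone K (G xbar)"
    using mult by (simp_all add: multipliers_def S_KKT_def)
  with f G have "kkt_chart_axioms K G xbar f f' (f'' xbar) G' (G'' xbar) ybar"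
    by unfold_locales
  with chart interpret kkt_chart K G xbar \<Phi> \<Phi>' \<Phi>'' T U V \<Psi> f f' "f'' xbar" G' "G'' xbar" ybar
    by (rule kkt_chart.intro)
  have "isolated_calm (S_KKT f G K) (0, 0) (xbar, ybar)"
    if "robustly_isolated_calm (S_KKT f G K) (0, 0) (xbar, ybar)"
    using that unfolding robustly_isolated_calm_def isolated_calm_def by meson
  then show ?thesis
    using SRCQ_SOSC_imp_robust isolated_calm_imp_SRCQ_SOSC[OF rcq]
    unfolding KKT_map_inv_calm_iff kkt_calm_iff by blast
qed

end
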